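(* Assume $\mathbb{E}[\log\xi]<\infty$. Suppose further that there exists a finite set $\mathcal{P}_0\subseteq\mathcal{P}$, $d:=|\mathcal{P}_0|$, such that the distributional tail of $(\lambda_p(\eta))_{p\in\mathcal{P}_0}$ is regularly varying at infinity in the following sense: for some positive function $(a(t))_{t>0}$ and a measure $\nu$ satisfying $\nu(\{x\in\mathbb{R}^d:\|x\|\ge r\})=c\cdot r^{-\alpha}$ for all $r>0$, with $c>0$ and $\alpha\in(0,1)$, it holds $$t\,\mathbb{P}\{(a(t))^{-1}(\lambda_p(\eta))_{p\in\mathcal{P}_0}\in\cdot\}\longrightarrow\nu(\cdot),\quad t\to\infty,$$ vaguely, on the space of locally finite measures on $(0,\infty]^d$ endowed with the vague topology. Finally, suppose that $\mathbb{E}[\lambda_p(\eta)]<\infty$ for $p\in\mathcal{P}\setminus\mathcal{P}_0$. Then, in the sense of weak convergence of finite-dimensional distributions, $$\left(\left(\frac{\max_{1\le k\le\lfloor tu\rfloor}T_k(p)}{a(t)}\right)_{u\ge0}\right)_{p\in\mathcal{P}_0}\longrightarrow\left((M_p(u))_{u\ge0}\right)_{p\in\mathcal{P}_0},\quad t\to\infty,$$ where $((M_p(u))_{u\ge0})_{p\in\mathcal{P}_0}$ is the multivariate extreme process defined by $$(M_p(u))_{p\in\mathcal{P}_0}=\sup_{k:\,t_k\le u}y_k,\quad u\ge0.$$ Here the pairs $(t_k,y_k)$ are the atoms of a Poisson point process on $[0,\infty)\times(0,\infty]^d$ with intensity measure $\mathrm{Leb}\otimes\nu$ ($\mathrm{Leb}$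 is Lebesgue measure), and the supremum is taken coordinatewise. Moreover, in the sense of weak convergence of finite-dimensional distributions, $$\left(\left(\frac{\max_{1\le k\le\lfloor tu\rfloor}T_k(p)}{a(t)}\right)_{u\ge0}\right)_{p\in\mathcal{P}\setminus\mathcal{P}_0}\longrightarrow0,\quad t\to\infty.$$
   Context: $\mathbb{N}=\{1,2,\ldots\}$. $(\xi_1,\eta_1),(\xi_2,\eta_2),\ldots$ are independent copies of an $\mathbb{N}^2$-valued random vector $(\xi,\eta)$ with arbitrarily dependent components. $\mathcal{P}$ is the set of prime numbers, and for $n\in\mathbb{N}$, $p\in\mathcal{P}$, $\lambda_p(n)$ is the multiplicity of $p$ in the prime decomposition of $n$, so $n=\prod_{p\in\mathcal{P}}p^{\lambda_p(n)}$. Put $\Pi_0=1$, $\Pi_k=\xi_1\cdots\xi_k$, and $\Theta_k=\Pi_{k-1}\cdot\eta_k$ for $k\in\mathbb{N}$. For $p\in\mathcal{P}$ and $k\in\mathbb{N}$, $$T_k(p):=\lambda_p(\Theta_k)=\sum_{j=1}^{k-1}\lambda_p(\xi_j)+\lambda_p(\eta_k).$$ $\|\cdot\|$ is a norm on $\mathbb{R}^d$, whose coordinates are indexed by $\mathcal{P}_0$. Locally finite means finite on compact sets, and vague convergence means convergence of integrals of all continuous compactly supported functions. Weak convergence of finite-dimensional distributions means joint convergence in distribution for any finite collection of pairs $(u,p)$. A maximum over the empty set is $0$ and a supremum over the empty set is the zero vector.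
   Formalization: The space (0,∞]^d is taken to be [0,∞]^d without the origin, so vague convergence also controls mass near the coordinate hyperplanes; with the literal product of half-open intervals the claim fails for d ≥ 2. *)

theory Defs
  imports "HOL-Probability.Probability" "HOL-Computational_Algebra.Primes"
begin

definition Nplus2 :: "(nat \<times> nat) measure" where
  "Nplus2 = count_space ({1..} \<times> {1..})"

text \<open>The sequences \<open>X\<close> and \<open>Y\<close> (playing the roles of the factors and of the perturbations) are
  indexed from 1; the values at index 0 are irrelevant.\<close>

definition Theta :: "(nat \<Rightarrow> 'a \<Rightarrow> nat) \<Rightarrow> (nat \<Rightarrow> 'a \<Rightarrow> nat) \<Rightarrow> nat \<Rightarrow> 'a \<Rightarrow> nat" where
  "Theta X Y k \<omega> = (\<Prod>j\<in>{1..<k}. X j \<omega>) * Y k \<omega>"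

definition T :: "(nat \<Rightarrow> 'a \<Rightarrow> nat) \<Rightarrow> (nat \<Rightarrow> 'a \<Rightarrow> nat) \<Rightarrow> nat \<Rightarrow> nat \<Rightarrow> 'a \<Rightarrow> nat" where
  "T X Y k p \<omega> = multiplicity p (Theta X Y k \<omega>)"

text \<open>Inserting 0 makes the maximum over an empty index set equal to 0 and changes nothing
  otherwise.\<close>

definition max_T :: "(nat \<Rightarrow> 'a \<Rightarrow> nat) \<Rightarrow> (nat \<Rightarrow> 'a \<Rightarrow> nat) \<Rightarrow> nat \<Rightarrow> nat \<Rightarrow> 'a \<Rightarrow> nat" where
  "max_T X Y n p \<omega> = Max (insert 0 ((\<lambda>k. T X Y k p \<omega>) ` {1..n}))"

text \<open>\<open>\<real>\<close> to the power \<open>I\<close> is modelled by the extensional functions on \<open>I\<close>.\<close>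

definition norm_on :: "'i set \<Rightarrow> (('i \<Rightarrow> real) \<Rightarrow> real) \<Rightarrow> bool" where
  "norm_on I N \<longleftrightarrow>
     (\<forall>x \<in> I \<rightarrow>\<^sub>E UNIV. N x = 0 \<longleftrightarrow> x = (\<lambda>i\<in>I. 0)) \<and>
     (\<forall>c. \<forall>x \<in> I \<rightarrow>\<^sub>E UNIV. N (\<lambda>i\<in>I. c * x i) = \<bar>c\<bar> * N x) \<and>
     (\<forall>x \<in> I \<rightarrow>\<^sub>E UNIV. \<forall>y \<in> I \<rightarrow>\<^sub>E UNIV. N (\<lambda>i\<in>I. x i + y i) \<le> N x + N y)"

text \<open>The state space of multivariate regular variation: the compactified orthant with coordinates
  in \<open>[0,\<infinity>]\<close>, with the origin removed.  This is the vector interval usually abbreviated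
  \<open>(0,\<infinity>]\<close> to the power \<open>d\<close>, where 0 denotes the zero vector; its compact sets stay away from the
  origin but may meet the coordinate hyperplanes.  It must not be replaced by the product of \<open>d\<close>
  copies of the one-dimensional \<open>(0,\<infinity>]\<close>: vague convergence there does not see the mass near the
  hyperplanes, and hence does not control the one-dimensional marginals.\<close>

definition orthant :: "'i set \<Rightarrow> ('i \<Rightarrow> ennreal) set" where
  "orthant I = (I \<rightarrow>\<^sub>E UNIV) - {\<lambda>i\<in>I. 0}"

definition orthant_top :: "'i set \<Rightarrow> ('i \<Rightarrow> ennreal) topology" where
  "orthant_top I = subtopology (product_topology (\<lambda>_. euclidean) I) (orthant I)"

definition orthant_borel :: "'i set \<Rightarrow> ('i \<Rightarrow> ennreal) measure" where
  "orthant_borel I = restrict_space (Pi\<^sub>M I (\<lambda>_. borel)) (orthant I)"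

definition locally_finite_measure :: "'c topology \<Rightarrow> 'c measure \<Rightarrow> bool" where
  "locally_finite_measure S \<nu> \<longleftrightarrow> (\<forall>K. compactin S K \<longrightarrow> emeasure \<nu> K < \<infinity>)"

definition vague_convergence ::
    "'c topology \<Rightarrow> ('t \<Rightarrow> 'c measure) \<Rightarrow> 'c measure \<Rightarrow> 't filter \<Rightarrow> bool" where
  "vague_convergence S \<mu> \<nu> F \<longleftrightarrow>
     (\<forall>f. continuous_map S euclideanreal f \<and>
          (\<exists>K. compactin S K \<and> (\<forall>x \<in> topspace S - K. f x = 0)) \<longrightarrow>
          ((\<lambda>t. integral\<^sup>L (\<mu> t) f) \<longlongrightarrow> integral\<^sup>L \<nu> f) F)"

definition convergence_in_distribution ::
    "'c topology \<Rightarrow> 'a measure \<Rightarrow> ('t \<Rightarrow> 'a \<Rightarrow> 'c) \<Rightarrow> 'b measure \<Rightarrow> ('b \<Rightarrow> 'c) \<Rightarrow> 't filter \<Rightarrow> bool" where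
  "convergence_in_distribution S M X N Y F \<longleftrightarrow>
     (\<forall>f. continuous_map S euclideanreal f \<and> bounded (f ` topspace S) \<longrightarrow>
          ((\<lambda>t. integral\<^sup>L M (\<lambda>\<omega>. f (X t \<omega>))) \<longlongrightarrow> integral\<^sup>L N (\<lambda>\<omega>. f (Y \<omega>))) F)"

definition fdd_convergence ::
    "'i set \<Rightarrow> 'a measure \<Rightarrow> ('t \<Rightarrow> 'i \<Rightarrow> 'a \<Rightarrow> real) \<Rightarrow> 'b measure \<Rightarrow> ('i \<Rightarrow> 'b \<Rightarrow> real) \<Rightarrow> 't filter \<Rightarrow> bool"
  where
  "fdd_convergence I M X N Y F \<longleftrightarrow>
     (\<forall>J. finite J \<and> J \<subseteq> I \<longrightarrow>
          convergence_in_distribution (powertop_real J)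
            M (\<lambda>t \<omega>. \<lambda>i\<in>J. X t i \<omega>) N (\<lambda>\<omega>. \<lambda>i\<in>J. Y i \<omega>) F)"

text \<open>A point process is given by a measurable enumeration \<open>Z\<close> of its atoms (an atom of
  multiplicity \<open>m\<close> is listed \<open>m\<close> times).  An infinite sequence of atoms is the appropriate format
  because the intensity measures considered here have infinite total mass.\<close>

definition num_points :: "(nat \<Rightarrow> 'b \<Rightarrow> 'c) \<Rightarrow> 'c set \<Rightarrow> 'b \<Rightarrow> ennreal" where
  "num_points Z B \<omega> = emeasure (count_space UNIV) {k. Z k \<omega> \<in> B}"

definition poisson_point_process :: "'b measure \<Rightarrow> 'c measure \<Rightarrow> (nat \<Rightarrow> 'b \<Rightarrow> 'c) \<Rightarrow> bool" where
  "poisson_point_process N \<mu> Z \<longleftrightarrow>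
     prob_space N \<and>
     (\<forall>k. Z k \<in> N \<rightarrow>\<^sub>M \<mu>) \<and>
     (\<forall>B \<in> sets \<mu>. emeasure \<mu> B < \<infinity> \<longrightarrow>
        (\<forall>n::nat. measure N {\<omega> \<in> space N. num_points Z B \<omega> = of_nat n} =
                   measure \<mu> B ^ n / fact n * exp (- measure \<mu> B))) \<and>
     (\<forall>B \<in> sets \<mu>. emeasure \<mu> B = \<infinity> \<longrightarrow> (AE \<omega> in N. num_points Z B \<omega> = \<infinity>)) \<and>
     (\<forall>(n::nat) B. (\<forall>i<n. B i \<in> sets \<mu>) \<and> disjoint_family_on B {..<n} \<longrightarrow>
        prob_space.indep_vars N (\<lambda>_. borel) (\<lambda>i. num_points Z (B i)) {..<n})"

text \<open>In \<open>ennreal\<close> the supremum of the empty set is 0.\<close>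

definition extreme_process ::
    "(nat \<Rightarrow> 'b \<Rightarrow> real \<times> ('i \<Rightarrow> ennreal)) \<Rightarrow> real \<Rightarrow> 'i \<Rightarrow> 'b \<Rightarrow> ennreal" where
  "extreme_process Z u p \<omega> = (SUP k \<in> {k. fst (Z k \<omega>) \<le> u}. snd (Z k \<omega>) p)"

end

theory Submission
  imports Defs
begin

text \<open>The perturbations \<open>\<eta>\<close> decide everything.  For a prime \<open>p\<close> the maximum of
  \<open>T\<^sub>1(p), \<dots>, T\<^sub>n(p)\<close> differs from the maximum of the exponents of \<open>p\<close> in
  \<open>\<eta>\<^sub>1, \<dots>, \<eta>\<^sub>n\<close> by at most the sum of the exponents of \<open>p\<close> in \<open>\<xi>\<^sub>1, \<dots>, \<xi>\<^sub>n\<close>.  An exponent in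
  \<open>\<xi>\<close> is at most \<open>ln \<xi> / ln 2\<close>, so this sum has mean of order \<open>n\<close>.  On the other hand an index
  \<open>\<alpha> < 1\<close> forces \<open>a t / t\<close> to diverge (\<open>normalisation_superlinear\<close>), so by Markov's inequality
  the sum disappears after division by \<open>a t\<close>.  For \<open>p\<close> outside \<open>P0\<close> the exponents of \<open>\<eta>\<close> have a
  finite mean as well, and the whole maximum disappears for the same reason.

  What remains for the primes in \<open>P0\<close> is a maximum of independent copies of one random vector.
  Fix finitely many indices \<open>j = (u\<^sub>j, p\<^sub>j)\<close> and levels \<open>y\<^sub>j > 0\<close>.  All maxima stay below their
  levels iff every \<open>k\<close>-th vector avoids the exceedance set of those \<open>j\<close> with \<open>k \<le> t u\<^sub>j\<close>.  Hence
  the joint distribution function is a product over \<open>k\<close>; grouping the factors by the set \<open>V\<close> of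
  indices that are active at \<open>k\<close> turns it asymptotically into the exponential of
  \<open>- (\<Sum>V. window V * \<nu> (exceedance V))\<close>, where \<open>window V\<close> is the length of the time interval on
  which exactly \<open>V\<close> is active (\<open>prod_not_exceeds_bounds\<close>).  This sum is also the mean number of
  Poisson points in the region that the extreme process has to avoid to stay below the same
  levels (\<open>poisson_extreme_process_cdf\<close>).

  Vague convergence bounds exceedance probabilities only up to a small shift of the levels,
  because \<open>\<nu>\<close> may charge the boundaries of exceedance sets (\<open>tail_sandwich\<close>).  Such bounds are
  enough: the coordinates of the limit have countably many atoms, so distribution functions that
  agree up to shifts converge for all levels outside a countable set, and this already implies
  convergence in distribution (\<open>convergence_in_distributionI_sandwich\<close>).

  A point of the state space may have infinite coordinates, and the limit is finite
  only if \<open>\<nu>\<close> gives such points no mass.  Mass at infinity would make tail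
  probabilities at level \<open>L * a t\<close> of the same order for all \<open>L\<close>, so that \<open>a (l * t) / a t\<close> would be
  unbounded for some fixed \<open>l\<close>; the growth of \<open>\<nu>\<close> near the origin forbids this
  (\<open>no_mass_at_infinity\<close>).\<close>

section \<open>Convergence in distribution from distribution functions\<close>

text \<open>Rounding a vector up to multiples of \<open>1 / (n + 1)\<close> factors
  through a countable discrete space, where everything is measurable, and \<open>f\<close> is the limit of
  its values at the rounded vectors.\<close>

lemma continuous_map_imp_measurable_PiM:
  fixes f :: "('i \<Rightarrow> real) \<Rightarrow> real"
  assumes J: "finite J" and f: "continuous_map (powertop_real J) euclideanreal f"
  shows "f \<in> borel_measurable (Pi\<^sub>M J (\<lambda>_. borel))"
proof (rule borel_measurable_LIMSEQ_metric)
  define r where "r n x = (\<lambda>j\<in>J. of_int \<lceil>x j * real (Suc n)\<rceil> / real (Suc n))" for n and x :: "'i \<Rightarrow> real"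
  have int_vec: "(\<lambda>x. \<lambda>j\<in>J. \<lceil>x j * real (Suc n)\<rceil>)
      \<in> Pi\<^sub>M J (\<lambda>_. borel) \<rightarrow>\<^sub>M count_space (PiE J (\<lambda>_. UNIV))" for n
    by (subst count_space_PiM_finite[OF J, symmetric]) measurable
  show "(\<lambda>x. f (r n x)) \<in> borel_measurable (Pi\<^sub>M J (\<lambda>_. borel))" for n
  proof -
    have "(\<lambda>x. (\<lambda>z. f (\<lambda>j\<in>J. of_int (z j) / real (Suc n))) (\<lambda>j\<in>J. \<lceil>x j * real (Suc n)\<rceil>))
        \<in> borel_measurable (Pi\<^sub>M J (\<lambda>_. borel))"
      by (rule measurable_compose[OF int_vec]) simp
    then show ?thesis by (simp add: r_def cong: restrict_cong)
  qed
  fix x :: "'i \<Rightarrow> real" assume x: "x \<in> space (Pi\<^sub>M J (\<lambda>_. borel))"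
  have "limitin (powertop_real J) (\<lambda>n. r n x) x sequentially"
  proof (subst limitin_componentwise, intro conjI ballI)
    show "x \<in> extensional J" using x by (auto simp: space_PiM PiE_def)
    show "\<forall>\<^sub>F n in sequentially. r n x \<in> topspace (powertop_real J)"
      by (auto simp: r_def)
    fix j assume j: "j \<in> J"
    have "(\<lambda>n. r n x j - x j) \<longlonglongrightarrow> 0"
    proof (rule Lim_null_comparison)
      show "\<forall>\<^sub>F n in sequentially. norm (r n x j - x j) \<le> 1 / real (Suc n)"
      proof (intro always_eventually allI)
        fix n
        have "\<bar>of_int \<lceil>x j * real (Suc n)\<rceil> - x j * real (Suc n)\<bar> \<le> 1" by linarith
        then have "\<bar>of_int \<lceil>x j * real (Suc n)\<rceil> - x j * real (Suc n)\<bar> / real (Suc n) \<le> 1 / real (Suc n)"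
          by (intro divide_right_mono) auto
        moreover have "r n x j - x j
            = (of_int \<lceil>x j * real (Suc n)\<rceil> - x j * real (Suc n)) / real (Suc n)"
          using j by (simp add: r_def field_simps)
        ultimately show "norm (r n x j - x j) \<le> 1 / real (Suc n)" by (simp del: of_nat_Suc)
      qed
      show "(\<lambda>n. 1 / real (Suc n)) \<longlonglongrightarrow> 0" by (rule LIMSEQ_Suc) (rule lim_1_over_n)
    qed
    then show "limitin euclideanreal (\<lambda>c. r c x j) (x j) sequentially" by (simp add: LIM_zero_iff)
  qed
  then have "limitin euclideanreal (\<lambda>n. f (r n x)) (f x) sequentially"
    using continuous_map_limit[OF f] by (auto simp: o_def)
  then show "(\<lambda>n. f (r n x)) \<longlonglongrightarrow> f x" by simp
qed

text \<open>The Heine-Cantor theorem in coordinates: the product topology carries no canonical metric, but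
  on finitely many coordinates small open boxes form a neighbourhood basis, and a Lebesgue number
  of a finite cover by such boxes is the required modulus.\<close>

lemma uniformly_continuous_on_box:
  fixes f :: "('i \<Rightarrow> real) \<Rightarrow> real"
  assumes J: "finite J" and f: "continuous_map (powertop_real J) euclideanreal f" and e: "0 < e"
  obtains d where "0 < d"
    "\<And>x y. x \<in> J \<rightarrow>\<^sub>E {-b..b} \<Longrightarrow> y \<in> J \<rightarrow>\<^sub>E UNIV \<Longrightarrow> (\<And>j. j \<in> J \<Longrightarrow> \<bar>x j - y j\<bar> < d) \<Longrightarrow> \<bar>f x - f y\<bar> < e"
proof -
  define K where "K = (J \<rightarrow>\<^sub>E {-b..b} :: ('i \<Rightarrow> real) set)"
  define B where "B x d = (J \<rightarrow>\<^sub>E UNIV) \<inter> {y. \<forall>j\<in>J. \<bar>x j - y j\<bar> < d}" for x :: "'i \<Rightarrow> real" and d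
  have B_box: "B x d = (\<Pi>\<^sub>E j\<in>J. {x j - d<..<x j + d})" for x d
    unfolding B_def PiE_iff set_eq_iff by (auto simp: PiE_iff abs_less_iff)
  have B_open: "openin (powertop_real J) (B x d)" for x d
    unfolding B_box using J by (simp add: openin_PiE)
  have ex: "\<exists>d>0. \<forall>y\<in>B x (2 * d). \<bar>f x - f y\<bar> < e / 2" if x: "x \<in> J \<rightarrow>\<^sub>E UNIV" for x
  proof -
    define W where "W = {y \<in> topspace (powertop_real J). f y \<in> {f x - e / 2<..<f x + e / 2}}"
    have "openin (powertop_real J) W"
      unfolding W_def by (rule openin_continuous_map_preimage[OF f]) auto
    moreover have "x \<in> W" using x e by (auto simp: W_def)
    ultimately have "\<exists>U. finite {j \<in> J. U j \<noteq> topspace euclideanreal} \<and>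
        (\<forall>j\<in>J. openin euclideanreal (U j)) \<and> x \<in> Pi\<^sub>E J U \<and> Pi\<^sub>E J U \<subseteq> W"
      using openin_product_topology_alt[of "\<lambda>_. euclideanreal" J W] by blast
    then obtain U where U: "\<And>j. j \<in> J \<Longrightarrow> open (U j)" "x \<in> Pi\<^sub>E J U" "Pi\<^sub>E J U \<subseteq> W"
      by auto
    have "\<exists>d. \<forall>j\<in>J. 0 < d j \<and> (\<forall>y. \<bar>x j - y\<bar> < d j \<longrightarrow> y \<in> U j)"
    proof (rule bchoice, rule ballI)
      fix j assume j: "j \<in> J"
      have "x j \<in> U j" using U(2) j by auto
      then show "\<exists>d. 0 < d \<and> (\<forall>y. \<bar>x j - y\<bar> < d \<longrightarrow> y \<in> U j)"
        using U(1)[OF j] unfolding open_dist by (metis abs_minus_commute dist_real_def)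
    qed
    then obtain d where d: "\<And>j. j \<in> J \<Longrightarrow> 0 < d j"
      "\<And>j y. j \<in> J \<Longrightarrow> \<bar>x j - y\<bar> < d j \<Longrightarrow> y \<in> U j" by blast
    define m where "m = Min (insert 1 (d ` J))"
    have m: "0 < m" "\<And>j. j \<in> J \<Longrightarrow> m \<le> d j" using J d(1) by (auto simp: m_def)
    have "\<bar>f x - f y\<bar> < e / 2" if "y \<in> B x (2 * (m / 2))" for y
    proof -
      have "y \<in> Pi\<^sub>E J U"
      proof (rule PiE_I)
        fix j assume j: "j \<in> J"
        have "\<bar>x j - y j\<bar> < m" using that j by (auto simp: B_def)
        then show "y j \<in> U j" using m(2)[OF j] by (intro d(2)[OF j]) linarith
      next
        fix j assume "j \<notin> J"
        then show "y j = undefined" using that by (auto simp: B_def PiE_iff extensional_def)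
      qed
      then have "f y \<in> {f x - e / 2<..<f x + e / 2}" using U(3) unfolding W_def by blast
      then show ?thesis unfolding greaterThanLessThan_iff by linarith
    qed
    then show ?thesis using m(1) by (intro exI[of _ "m / 2"]) auto
  qed
  then obtain d where d: "\<And>x. x \<in> J \<rightarrow>\<^sub>E UNIV \<Longrightarrow> 0 < d x"
    "\<And>x y. x \<in> J \<rightarrow>\<^sub>E UNIV \<Longrightarrow> y \<in> B x (2 * d x) \<Longrightarrow> \<bar>f x - f y\<bar> < e / 2" by metis
  have KU: "K \<subseteq> J \<rightarrow>\<^sub>E UNIV" by (auto simp: K_def PiE_iff)
  have K_compact: "compactin (powertop_real J) K"
    unfolding K_def by (subst compactin_PiE) auto
  have cover: "K \<subseteq> \<Union> ((\<lambda>x. B x (d x)) ` K)"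
  proof
    fix x assume "x \<in> K"
    then have "x \<in> B x (d x)" using KU d(1)[of x] by (auto simp: B_def)
    then show "x \<in> \<Union> ((\<lambda>x. B x (d x)) ` K)" using \<open>x \<in> K\<close> by auto
  qed
  have "openin (powertop_real J) U" if "U \<in> (\<lambda>x. B x (d x)) ` K" for U using that B_open by auto
  from compactinD[OF K_compact this cover]
  obtain \<F> where \<F>: "finite \<F>" "\<F> \<subseteq> (\<lambda>x. B x (d x)) ` K" "K \<subseteq> \<Union>\<F>" by blast
  obtain C where C: "C \<subseteq> K" "finite C" "\<F> = (\<lambda>x. B x (d x)) ` C"
    using finite_subset_image[OF \<F>(1,2)] by blast
  \<comment> \<open>the Lebesgue number of the finite cover; continuity was exploited on boxes of twice the radius\<close>
  define m where "m = Min (insert 1 (d ` C))"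
  have m: "0 < m" "\<And>x. x \<in> C \<Longrightarrow> m \<le> d x" using C(1,2) KU d(1) by (auto simp: m_def subset_iff)
  show ?thesis
  proof (rule that[OF m(1)])
    fix x y assume x: "x \<in> J \<rightarrow>\<^sub>E {-b..b}" and y: "y \<in> J \<rightarrow>\<^sub>E UNIV"
      and near: "\<And>j. j \<in> J \<Longrightarrow> \<bar>x j - y j\<bar> < m"
    obtain z where z: "z \<in> C" "x \<in> B z (d z)" using C(3) \<F>(3) x unfolding K_def by blast
    have zJ: "z \<in> J \<rightarrow>\<^sub>E UNIV" using z C(1) KU by blast
    have "x \<in> B z (2 * d z)" using z(2) d(1)[OF zJ] unfolding B_def by (smt (verit) Int_iff mem_Collect_eq)
    moreover have "\<bar>z j - y j\<bar> < 2 * d z" if "j \<in> J" for j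
      using z(2) near[OF that] m(2)[OF z(1)] that unfolding B_def by (smt (verit) Int_iff mem_Collect_eq)
    then have "y \<in> B z (2 * d z)"
      using y by (auto simp: B_def)
    ultimately have "\<bar>f z - f x\<bar> < e / 2" "\<bar>f z - f y\<bar> < e / 2" using d(2)[OF zJ] by auto
    then show "\<bar>f x - f y\<bar> < e" by linarith
  qed
qed

text \<open>The error off the cells is charged to the missing mass, so that later only the cell
  probabilities of the approximating and of the limiting vector have to be compared.\<close>

lemma (in prob_space) expectation_step_approx:
  fixes h :: "'a \<Rightarrow> real"
  assumes K: "finite K" and E: "\<And>k. k \<in> K \<Longrightarrow> E k \<in> events" and disj: "disjoint_family_on E K"
    and h: "h \<in> borel_measurable M" and C: "\<And>\<omega>. \<omega> \<in> space M \<Longrightarrow> \<bar>h \<omega>\<bar> \<le> C"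
    and e: "0 \<le> e" and near: "\<And>k \<omega>. k \<in> K \<Longrightarrow> \<omega> \<in> E k \<Longrightarrow> \<bar>h \<omega> - v k\<bar> \<le> e"
  shows "\<bar>expectation h - (\<Sum>k\<in>K. v k * prob (E k))\<bar> \<le> e + C * (1 - (\<Sum>k\<in>K. prob (E k)))"
proof -
  have int_h: "integrable M h" by (rule integrable_const_bound[where B = C]) (use h C in auto)
  have int_ind [simp]: "integrable M (indicator (E k) :: 'a \<Rightarrow> real)" if "k \<in> K" for k
    using E[OF that] by (auto simp: integrable_indicator_iff emeasure_eq_measure)
  have pt: "\<bar>h \<omega> - (\<Sum>k\<in>K. v k * indicator (E k) \<omega>)\<bar>
      \<le> e + C * (1 - (\<Sum>k\<in>K. indicator (E k) \<omega>))" if \<omega>: "\<omega> \<in> space M" for \<omega>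
  proof (cases "\<exists>k\<in>K. \<omega> \<in> E k")
    case True
    then obtain k where k: "k \<in> K" "\<omega> \<in> E k" by blast
    have ind: "indicator (E i) \<omega> = (if i = k then 1 else 0::real)" if "i \<in> K" for i
      using disj k that by (auto simp: disjoint_family_on_def indicator_def)
    have "(\<Sum>i\<in>K. v i * indicator (E i) \<omega>) = v k" "(\<Sum>i\<in>K. indicator (E i) \<omega>) = (1::real)"
      using K k(1) by (simp_all add: ind if_distrib sum.delta cong: if_cong sum.cong)
    then show ?thesis using near[OF k] by simp
  next
    case False
    then have "(\<Sum>i\<in>K. v i * indicator (E i) \<omega>) = 0" "(\<Sum>i\<in>K. indicator (E i) \<omega>) = (0::real)"
      by (auto simp: indicator_def intro!: sum.neutral)
    then show ?thesis using C[OF \<omega>] e by simp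
  qed
  have "\<bar>expectation h - (\<Sum>k\<in>K. v k * prob (E k))\<bar>
      = \<bar>expectation (\<lambda>\<omega>. h \<omega> - (\<Sum>k\<in>K. v k * indicator (E k) \<omega>))\<bar>"
    using int_h E by (simp add: Bochner_Integration.integral_diff integral_sum)
  also have "\<dots> \<le> expectation (\<lambda>\<omega>. \<bar>h \<omega> - (\<Sum>k\<in>K. v k * indicator (E k) \<omega>)\<bar>)"
    by (rule integral_abs_bound)
  also have "\<dots> \<le> expectation (\<lambda>\<omega>. e + C * (1 - (\<Sum>k\<in>K. indicator (E k) \<omega>)))"
    using int_h pt by (intro integral_mono) auto
  also have "\<dots> = e + C * (1 - (\<Sum>k\<in>K. prob (E k)))"
    using E by (simp add: Bochner_Integration.integral_diff prob_space)
  finally show ?thesis .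
qed

text \<open>Inclusion-exclusion without signs: lower bounds are imposed one coordinate at a time, and each
  new one turns a box probability into a difference of two box probabilities of the previous kind.\<close>

lemma (in prob_space) prob_box_tendsto:
  fixes X :: "'t \<Rightarrow> 'i \<Rightarrow> 'a \<Rightarrow> real" and Y :: "'i \<Rightarrow> 'b \<Rightarrow> real"
  assumes J: "finite J" and N: "prob_space N"
    and X [measurable]: "\<And>t j. j \<in> J \<Longrightarrow> X t j \<in> borel_measurable M"
    and Y [measurable]: "\<And>j. j \<in> J \<Longrightarrow> Y j \<in> borel_measurable N"
    and cdf: "\<And>y. (\<And>j. j \<in> J \<Longrightarrow> y j \<notin> D) \<Longrightarrow>
      ((\<lambda>t. prob {\<omega> \<in> space M. \<forall>j\<in>J. X t j \<omega> \<le> y j})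
        \<longlongrightarrow> measure N {\<omega> \<in> space N. \<forall>j\<in>J. Y j \<omega> \<le> y j}) F"
    and lo: "\<And>j. j \<in> J \<Longrightarrow> lo j \<notin> D" and hi: "\<And>j. j \<in> J \<Longrightarrow> hi j \<notin> D"
    and le: "\<And>j. j \<in> J \<Longrightarrow> lo j \<le> hi j"
  shows "((\<lambda>t. prob {\<omega> \<in> space M. \<forall>j\<in>J. lo j < X t j \<omega> \<and> X t j \<omega> \<le> hi j})
        \<longlongrightarrow> measure N {\<omega> \<in> space N. \<forall>j\<in>J. lo j < Y j \<omega> \<and> Y j \<omega> \<le> hi j}) F"
proof -
  interpret N: prob_space N by fact
  have "((\<lambda>t. prob {\<omega> \<in> space M. \<forall>j\<in>J. (j \<in> I \<longrightarrow> lo j < X t j \<omega>) \<and> X t j \<omega> \<le> z j})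
        \<longlongrightarrow> measure N {\<omega> \<in> space N. \<forall>j\<in>J. (j \<in> I \<longrightarrow> lo j < Y j \<omega>) \<and> Y j \<omega> \<le> z j}) F"
    if "finite I" "I \<subseteq> J" "\<And>j. j \<in> J \<Longrightarrow> z j \<notin> D" "\<And>j. j \<in> I \<Longrightarrow> lo j \<le> z j" for I z
    using that
  proof (induction I arbitrary: z rule: finite_induct)
    case empty
    then show ?case using cdf[of z] by simp
  next
    case (insert i I)
    define z' where "z' = z(i := lo i)"
    have i: "i \<in> J" using insert.prems by auto
    have z': "z' j \<le> z j" "j \<in> I \<Longrightarrow> z' j = z j" "j \<noteq> i \<Longrightarrow> z' j = z j" "z' i = lo i" if "j \<in> J" for j
      using insert.prems(3)[of i] insert.hyps by (auto simp: z'_def)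
    let ?E = "\<lambda>I z t. {\<omega> \<in> space M. \<forall>j\<in>J. (j \<in> I \<longrightarrow> lo j < X t j \<omega>) \<and> X t j \<omega> \<le> z j}"
    let ?G = "\<lambda>I z. {\<omega> \<in> space N. \<forall>j\<in>J. (j \<in> I \<longrightarrow> lo j < Y j \<omega>) \<and> Y j \<omega> \<le> z j}"
    have sub: "?E I z' t \<subseteq> ?E I z t" for t using z'(1) by (auto intro: order_trans)
    have subN: "?G I z' \<subseteq> ?G I z" using z'(1) by (auto intro: order_trans)
    have diff: "?E (insert i I) z t = ?E I z t - ?E I z' t" for t
    proof (intro equalityI subsetI)
      fix \<omega> assume \<omega>: "\<omega> \<in> ?E (insert i I) z t"
      then have "lo i < X t i \<omega>" using i by auto
      then have "\<omega> \<notin> ?E I z' t" using z'(4)[OF i] i by fastforce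
      then show "\<omega> \<in> ?E I z t - ?E I z' t" using \<omega> by auto
    next
      fix \<omega> assume \<omega>: "\<omega> \<in> ?E I z t - ?E I z' t"
      then obtain j where j: "j \<in> J" "\<not> X t j \<omega> \<le> z' j" by auto
      have "X t j \<omega> \<le> z j" using \<omega> j(1) by blast
      then have "j = i" using j z'(3)[OF j(1)] by fastforce
      then have "lo i < X t i \<omega>" using j z'(4) by auto
      then show "\<omega> \<in> ?E (insert i I) z t" using \<omega> by auto
    qed
    have diffN: "?G (insert i I) z = ?G I z - ?G I z'"
    proof (intro equalityI subsetI)
      fix \<omega> assume \<omega>: "\<omega> \<in> ?G (insert i I) z"
      then have "lo i < Y i \<omega>" using i by auto
      then have "\<omega> \<notin> ?G I z'" using z'(4)[OF i] i by fastforce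
      then show "\<omega> \<in> ?G I z - ?G I z'" using \<omega> by auto
    next
      fix \<omega> assume \<omega>: "\<omega> \<in> ?G I z - ?G I z'"
      then obtain j where j: "j \<in> J" "\<not> Y j \<omega> \<le> z' j" by auto
      have "Y j \<omega> \<le> z j" using \<omega> j(1) by blast
      then have "j = i" using j z'(3)[OF j(1)] by fastforce
      then have "lo i < Y i \<omega>" using j z'(4) by auto
      then show "\<omega> \<in> ?G (insert i I) z" using \<omega> by auto
    qed
    have ev: "?E I z t \<in> events" for t I z using J by measurable
    have evN: "?G I z \<in> sets N" for I z using J by measurable
    have "prob (?E (insert i I) z t) = prob (?E I z t) - prob (?E I z' t)" for t
      unfolding diff by (rule finite_measure_Diff[OF ev ev sub])
    moreover have "measure N (?G (insert i I) z) = measure N (?G I z) - measure N (?G I z')"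
      unfolding diffN by (rule N.finite_measure_Diff[OF evN evN subN])
    moreover have "((\<lambda>t. prob (?E I z t) - prob (?E I z' t))
        \<longlongrightarrow> measure N (?G I z) - measure N (?G I z')) F"
      by (intro tendsto_diff insert.IH) (use insert.prems insert.hyps lo in \<open>auto simp: z'_def\<close>)
    ultimately show ?case by simp
  qed
  from this[of J hi] show ?thesis using J hi le by simp
qed

text \<open>The Helly-Bray theorem in finitely many dimensions.  Its exceptional set is a countable set of
  levels, so that a grid of any mesh can be chosen among the admissible levels; a continuous
  function is uniformly close to a step function on the cells of a fine grid inside a box that
  carries almost all mass.\<close>

lemma (in prob_space) convergence_in_distributionI_cdf:
  fixes X :: "'t \<Rightarrow> 'i \<Rightarrow> 'a \<Rightarrow> real" and Y :: "'i \<Rightarrow> 'b \<Rightarrow> real"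
  assumes J: "finite J" and N: "prob_space N"
    and X [measurable]: "\<And>t j. j \<in> J \<Longrightarrow> X t j \<in> borel_measurable M"
    and Y [measurable]: "\<And>j. j \<in> J \<Longrightarrow> Y j \<in> borel_measurable N"
    and D: "countable D"
    and cdf: "\<And>y. (\<And>j. j \<in> J \<Longrightarrow> y j \<notin> D) \<Longrightarrow>
      ((\<lambda>t. prob {\<omega> \<in> space M. \<forall>j\<in>J. X t j \<omega> \<le> y j})
        \<longlongrightarrow> measure N {\<omega> \<in> space N. \<forall>j\<in>J. Y j \<omega> \<le> y j}) F"
  shows "convergence_in_distribution (powertop_real J) M (\<lambda>t \<omega>. \<lambda>j\<in>J. X t j \<omega>) N (\<lambda>\<omega>. \<lambda>j\<in>J. Y j \<omega>) F"
  unfolding convergence_in_distribution_def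
proof (intro allI impI, elim conjE)
  interpret N: prob_space N by fact
  fix f assume f: "continuous_map (powertop_real J) euclideanreal f"
    and bd: "bounded (f ` topspace (powertop_real J))"
  have fm [measurable]: "f \<in> borel_measurable (Pi\<^sub>M J (\<lambda>_. borel))"
    by (rule continuous_map_imp_measurable_PiM[OF J f])
  obtain C where C: "\<And>x. x \<in> J \<rightarrow>\<^sub>E UNIV \<Longrightarrow> \<bar>f x\<bar> \<le> C" and C0: "0 < C"
    using bd unfolding bounded_pos by (auto simp: )
  let ?hX = "\<lambda>t \<omega>. f (\<lambda>j\<in>J. X t j \<omega>)" and ?hY = "\<lambda>\<omega>. f (\<lambda>j\<in>J. Y j \<omega>)"
  show "((\<lambda>t. expectation (?hX t)) \<longlongrightarrow> N.expectation ?hY) F"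
  proof (rule tendstoI)
    fix e :: real assume e: "0 < e"
    \<comment> \<open>two step approximations, the missing mass (at most three times \<open>C * e2 = e1\<close>) and the convergence of the sums cost at most \<open>6 * e1\<close>\<close>
    define e1 where "e1 = e / 8"
    define e2 where "e2 = e / (8 * C)"
    have e12: "0 < e1" "0 < e2" using e C0 by (auto simp: e1_def e2_def)
    obtain b0 :: real where b0: "0 \<le> b0"
      "1 - e2 \<le> measure N {\<omega> \<in> space N. \<forall>j\<in>J. \<bar>Y j \<omega>\<bar> \<le> b0}"
    proof -
      let ?A = "\<lambda>n::nat. {\<omega> \<in> space N. \<forall>j\<in>J. \<bar>Y j \<omega>\<bar> \<le> real n}"
      have "(\<lambda>n. measure N (?A n)) \<longlonglongrightarrow> measure N (\<Union>n. ?A n)"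
      proof (rule N.finite_Lim_measure_incseq)
        have "?A n \<in> sets N" for n using J by measurable
        then show "range ?A \<subseteq> sets N" by blast
        show "incseq ?A" by (fastforce simp: incseq_def intro: order_trans)
      qed
      moreover have "(\<Union>n. ?A n) = space N"
      proof (intro equalityI subsetI)
        fix \<omega> assume \<omega>: "\<omega> \<in> space N"
        obtain n where n: "Max (insert 0 ((\<lambda>j. \<bar>Y j \<omega>\<bar>) ` J)) \<le> real n"
          using real_arch_simple by blast
        then have "\<forall>j\<in>J. \<bar>Y j \<omega>\<bar> \<le> real n" using J by simp
        then show "\<omega> \<in> (\<Union>n. ?A n)" using \<omega> by auto
      qed auto
      ultimately have "(\<lambda>n. measure N (?A n)) \<longlonglongrightarrow> 1" by (simp add: N.prob_space)
      then have "\<forall>\<^sub>F n in sequentially. 1 - e2 < measure N (?A n)"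
        by (rule order_tendstoD) (use e12 in auto)
      then obtain n where "1 - e2 < measure N (?A n)"
        by (auto simp: eventually_sequentially)
      then show thesis by (intro that[of "real n"]) auto
    qed
    obtain d0 where d0: "0 < d0" "\<And>x y. x \<in> J \<rightarrow>\<^sub>E {-(b0 + 2)..b0 + 2} \<Longrightarrow> y \<in> J \<rightarrow>\<^sub>E UNIV \<Longrightarrow>
        (\<And>j. j \<in> J \<Longrightarrow> \<bar>x j - y j\<bar> < d0) \<Longrightarrow> \<bar>f x - f y\<bar> < e1"
      by (rule uniformly_continuous_on_box[OF J f e12(1)]) blast
    define d where "d = min d0 1"
    have d: "0 < d" "d \<le> d0" "d \<le> 1" using d0(1) by (auto simp: d_def)
    \<comment> \<open>one admissible grid point in each interval of length d / 2, so that neighbours are closer than d\<close>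
    have "\<exists>z. z \<in> {-(b0 + 1) + real i * (d / 2) <..< -(b0 + 1) + real (Suc i) * (d / 2)} - D" for i
      using open_minus_countable[OF D, of "{-(b0 + 1) + real i * (d / 2) <..< -(b0 + 1) + real (Suc i) * (d / 2)}"]
        d(1) by (auto simp: algebra_simps)
    then obtain g where g: "\<And>i. g i \<notin> D" "\<And>i. -(b0 + 1) + real i * (d / 2) < g i"
      "\<And>i. g i < -(b0 + 1) + real (Suc i) * (d / 2)" by (metis DiffE greaterThanLessThan_iff)
    have g_less: "g i < g (Suc i)" for i using g(2)[of "Suc i"] g(3)[of i] by linarith
    then have g_mono: "strict_mono g" by (rule strict_monoI_Suc)
    have g_mesh: "g (Suc i) - g i < d" for i
      using g(2)[of i] g(3)[of "Suc i"] by (simp add: algebra_simps)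
    define m where "m = nat \<lceil>(4 * b0 + 2) / d\<rceil>"
    have m: "(4 * b0 + 2) / d \<le> real m" "real m \<le> (4 * b0 + 2) / d + 1"
    proof -
      have "0 \<le> (4 * b0 + 2) / d" using b0(1) d(1) by simp
      then show "(4 * b0 + 2) / d \<le> real m" "real m \<le> (4 * b0 + 2) / d + 1"
        unfolding m_def by linarith+
    qed
    have md: "4 * b0 + 2 \<le> real m * d" "real m * d \<le> 4 * b0 + 2 + d"
      using m d(1) by (auto simp: field_simps)
    have g0: "g 0 < - b0" using g(3)[of 0] d by simp
    have g0': "-(b0 + 2) < g 0" using g(2)[of 0] by simp
    have gm: "b0 < g m" using g(2)[of m] md(1) by (simp add: field_simps)
    have gm': "g m \<le> b0 + 2" using g(3)[of m] md(2) d by (simp add: algebra_simps)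
    define K where "K = (J \<rightarrow>\<^sub>E {..<m})"
    have K: "finite K" unfolding K_def using J by (intro finite_PiE) auto
    define cX where "cX t k = {\<omega> \<in> space M. \<forall>j\<in>J. g (k j) < X t j \<omega> \<and> X t j \<omega> \<le> g (Suc (k j))}" for t k
    define cY where "cY k = {\<omega> \<in> space N. \<forall>j\<in>J. g (k j) < Y j \<omega> \<and> Y j \<omega> \<le> g (Suc (k j))}" for k
    define v where "v k = f (\<lambda>j\<in>J. g (Suc (k j)))" for k
    have cell_unique: "i = i'" if "g i < z" "z \<le> g (Suc i)" "g i' < z" "z \<le> g (Suc i')" for i i' z
    proof (rule ccontr)
      assume "i \<noteq> i'"
      then have "Suc i \<le> i' \<or> Suc i' \<le> i" by auto
      then have "g (Suc i) \<le> g i' \<or> g (Suc i') \<le> g i"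
        using strict_mono_less_eq[OF g_mono] by blast
      then show False using that by linarith
    qed
    have PiE_eq: "k = k'" if "k \<in> K" "k' \<in> K" "\<And>j. j \<in> J \<Longrightarrow> k j = k' j" for k k'
      using that unfolding K_def by (intro PiE_ext[of k J _ k']) auto
    have disjX: "disjoint_family_on (cX t) K" for t
    unfolding disjoint_family_on_def
    proof (intro ballI impI, rule ccontr)
      fix k k' assume k: "k \<in> K" "k' \<in> K" "k \<noteq> k'" and "cX t k \<inter> cX t k' \<noteq> {}"
      then obtain \<omega> where \<omega>: "\<omega> \<in> cX t k" "\<omega> \<in> cX t k'" by auto
      have "k j = k' j" if "j \<in> J" for j
        using \<omega> that by (intro cell_unique[of _ "X t j \<omega>"]) (auto simp: cX_def)
      then show False using PiE_eq k by blast
    qed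
    have disjY: "disjoint_family_on cY K"
    unfolding disjoint_family_on_def
    proof (intro ballI impI, rule ccontr)
      fix k k' assume k: "k \<in> K" "k' \<in> K" "k \<noteq> k'" and "cY k \<inter> cY k' \<noteq> {}"
      then obtain \<omega> where \<omega>: "\<omega> \<in> cY k" "\<omega> \<in> cY k'" by auto
      have "k j = k' j" if "j \<in> J" for j
        using \<omega> that by (intro cell_unique[of _ "Y j \<omega>"]) (auto simp: cY_def)
      then show False using PiE_eq k by blast
    qed
    have evX [measurable]: "cX t k \<in> events" for t k unfolding cX_def using J by measurable
    have evY [measurable]: "cY k \<in> sets N" for k unfolding cY_def using J by measurable
    have corner: "(\<lambda>j\<in>J. g (Suc (k j))) \<in> J \<rightarrow>\<^sub>E {-(b0 + 2)..b0 + 2}" if k: "k \<in> K" for k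
    proof (rule restrict_PiE_iff[THEN iffD2], rule ballI)
      fix j assume j: "j \<in> J"
      have "k j \<in> {..<m}" using k j unfolding K_def by (rule PiE_mem)
      then have "Suc (k j) \<le> m" by simp
      then have "g (Suc (k j)) \<le> g m" "g 0 \<le> g (Suc (k j))"
        using strict_mono_less_eq[OF g_mono] by auto
      then show "g (Suc (k j)) \<in> {- (b0 + 2)..b0 + 2}" using g0' gm' by auto
    qed
    have near: "\<bar>f (\<lambda>j\<in>J. x j) - v k\<bar> \<le> e1"
      if k: "k \<in> K" and x: "\<And>j. j \<in> J \<Longrightarrow> g (k j) < x j \<and> x j \<le> g (Suc (k j))" for k x
    proof -
      have "\<bar>f (\<lambda>j\<in>J. g (Suc (k j))) - f (\<lambda>j\<in>J. x j)\<bar> < e1"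
      proof (rule d0(2)[OF corner[OF k]])
        fix j assume j: "j \<in> J"
        show "\<bar>(\<lambda>j\<in>J. g (Suc (k j))) j - (\<lambda>j\<in>J. x j) j\<bar> < d0"
          using j x[OF j] g_mesh[of "k j"] d(2) by auto
      qed auto
      then show ?thesis unfolding v_def by linarith
    qed
    have stepX: "\<bar>expectation (?hX t) - (\<Sum>k\<in>K. v k * prob (cX t k))\<bar>
        \<le> e1 + C * (1 - (\<Sum>k\<in>K. prob (cX t k)))" for t
    proof (rule expectation_step_approx[OF K evX disjX])
      show "?hX t \<in> borel_measurable M" by measurable
    qed (use C near e12 in \<open>auto simp: cX_def\<close>)
    have stepY: "\<bar>N.expectation ?hY - (\<Sum>k\<in>K. v k * measure N (cY k))\<bar>
        \<le> e1 + C * (1 - (\<Sum>k\<in>K. measure N (cY k)))"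
    proof (rule N.expectation_step_approx[OF K evY disjY])
      show "?hY \<in> borel_measurable N" by measurable
    qed (use C near e12 in \<open>auto simp: cY_def\<close>)
    have cell: "((\<lambda>t. prob (cX t k)) \<longlongrightarrow> measure N (cY k)) F" for k
      unfolding cX_def cY_def
      by (rule prob_box_tendsto[OF J N X Y cdf]) (use g(1) g_less in \<open>auto intro: less_imp_le\<close>)
    have massY: "1 - e2 \<le> (\<Sum>k\<in>K. measure N (cY k))"
    proof -
      have "{\<omega> \<in> space N. \<forall>j\<in>J. \<bar>Y j \<omega>\<bar> \<le> b0} \<subseteq> (\<Union>k\<in>K. cY k)"
      proof
        fix \<omega> assume \<omega>: "\<omega> \<in> {\<omega> \<in> space N. \<forall>j\<in>J. \<bar>Y j \<omega>\<bar> \<le> b0}"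
        have "\<exists>i<m. g i < Y j \<omega> \<and> Y j \<omega> \<le> g (Suc i)" if j: "j \<in> J" for j
        proof -
          have Yb: "\<bar>Y j \<omega>\<bar> \<le> b0" using \<omega> j by auto
          define n where "n = (LEAST n. Y j \<omega> \<le> g n)"
          have ex: "Y j \<omega> \<le> g m" using Yb gm by linarith
          then have n: "Y j \<omega> \<le> g n" "n \<le> m"
            unfolding n_def by (auto intro: LeastI Least_le)
          have "n \<noteq> 0"
          proof
            assume "n = 0"
            with n(1) Yb g0 show False by simp
          qed
          then obtain i where i: "n = Suc i" using not0_implies_Suc by blast
          have "\<not> Y j \<omega> \<le> g i" using not_less_Least[of i "\<lambda>n. Y j \<omega> \<le> g n"] i n_def by auto
          then show ?thesis using n i by (intro exI[of _ i]) auto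
        qed
        then obtain k where k: "\<And>j. j \<in> J \<Longrightarrow> k j < m \<and> g (k j) < Y j \<omega> \<and> Y j \<omega> \<le> g (Suc (k j))"
          by metis
        have "restrict k J \<in> K" using k by (auto simp: K_def)
        moreover have "\<omega> \<in> cY (restrict k J)" using \<omega> k by (auto simp: cY_def)
        ultimately show "\<omega> \<in> (\<Union>k\<in>K. cY k)" by blast
      qed
      then have "measure N {\<omega> \<in> space N. \<forall>j\<in>J. \<bar>Y j \<omega>\<bar> \<le> b0} \<le> measure N (\<Union>k\<in>K. cY k)"
        using K evY by (intro N.finite_measure_mono) auto
      also have "\<dots> = (\<Sum>k\<in>K. measure N (cY k))"
        using K evY disjY by (intro N.finite_measure_finite_Union) auto
      finally show ?thesis using b0(2) by simp
    qed
    have sums: "((\<lambda>t. \<Sum>k\<in>K. v k * prob (cX t k)) \<longlongrightarrow> (\<Sum>k\<in>K. v k * measure N (cY k))) F"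
      "((\<lambda>t. \<Sum>k\<in>K. prob (cX t k)) \<longlongrightarrow> (\<Sum>k\<in>K. measure N (cY k))) F"
      by (rule tendsto_sum, rule tendsto_mult_left, rule cell) (rule tendsto_sum, rule cell)
    have "\<forall>\<^sub>F t in F. dist (\<Sum>k\<in>K. v k * prob (cX t k)) (\<Sum>k\<in>K. v k * measure N (cY k)) < e1"
      by (rule tendstoD[OF sums(1) e12(1)])
    moreover have "\<forall>\<^sub>F t in F. dist (\<Sum>k\<in>K. prob (cX t k)) (\<Sum>k\<in>K. measure N (cY k)) < e2"
      by (rule tendstoD[OF sums(2) e12(2)])
    ultimately show "\<forall>\<^sub>F t in F. dist (expectation (?hX t)) (N.expectation ?hY) < e"
    proof eventually_elim
      case (elim t)
      have "1 - (\<Sum>k\<in>K. prob (cX t k)) \<le> 2 * e2"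
        using elim(2) massY unfolding dist_real_def by linarith
      then have "C * (1 - (\<Sum>k\<in>K. prob (cX t k))) \<le> C * (2 * e2)"
        using C0 by (intro mult_left_mono) auto
      moreover have "C * (1 - (\<Sum>k\<in>K. measure N (cY k))) \<le> C * e2"
        using massY C0 by (intro mult_left_mono) auto
      moreover have "C * e2 = e1" using C0 by (simp add: e1_def e2_def)
      ultimately show ?case
        using stepX[of t] stepY elim(1) e unfolding dist_real_def e1_def by linarith
    qed
  qed
qed

text \<open>Two distribution functions that dominate each other up to arbitrarily small shifts agree in
  the limit at every level vector none of whose entries is an atom of the corresponding
  coordinate of \<open>Y\<close>; such atoms are countable.\<close>

lemma (in prob_space) convergence_in_distributionI_sandwich:
  fixes X :: "'t \<Rightarrow> 'i \<Rightarrow> 'a \<Rightarrow> real" and Y :: "'i \<Rightarrow> 'b \<Rightarrow> real"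
  assumes J: "finite J" and N: "prob_space N"
    and X [measurable]: "\<And>t j. j \<in> J \<Longrightarrow> X t j \<in> borel_measurable M"
    and Y [measurable]: "\<And>j. j \<in> J \<Longrightarrow> Y j \<in> borel_measurable N"
    and upper: "\<And>y d e. 0 < d \<Longrightarrow> 0 < e \<Longrightarrow> \<forall>\<^sub>F t in F. prob {\<omega> \<in> space M. \<forall>j\<in>J. X t j \<omega> \<le> y j}
        \<le> measure N {\<omega> \<in> space N. \<forall>j\<in>J. Y j \<omega> \<le> y j + d} + e"
    and lower: "\<And>y d e. 0 < d \<Longrightarrow> 0 < e \<Longrightarrow> \<forall>\<^sub>F t in F. prob {\<omega> \<in> space M. \<forall>j\<in>J. X t j \<omega> \<le> y j}
        \<ge> measure N {\<omega> \<in> space N. \<forall>j\<in>J. Y j \<omega> \<le> y j - d} - e"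
  shows "convergence_in_distribution (powertop_real J) M (\<lambda>t \<omega>. \<lambda>j\<in>J. X t j \<omega>) N (\<lambda>\<omega>. \<lambda>j\<in>J. Y j \<omega>) F"
proof -
  interpret N: prob_space N by fact
  define D where "D = (\<Union>j\<in>J. {z. measure (distr N borel (Y j)) {z} \<noteq> 0})"
  have D: "countable D"
    unfolding D_def
  proof (rule countable_UN)
    show "countable J" using J by (rule countable_finite)
    fix j assume j: "j \<in> J"
    interpret d: prob_space "distr N borel (Y j)" by (rule N.prob_space_distr) (use j in simp)
    show "countable {z. measure (distr N borel (Y j)) {z} \<noteq> 0}" by (rule d.countable_support)
  qed
  show ?thesis
  proof (rule convergence_in_distributionI_cdf[OF J N X Y D])
    fix y :: "'i \<Rightarrow> real" assume y: "\<And>j. j \<in> J \<Longrightarrow> y j \<notin> D"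
    let ?G = "\<lambda>d. {\<omega> \<in> space N. \<forall>j\<in>J. Y j \<omega> \<le> y j + d}"
    have G [measurable]: "?G d \<in> sets N" for d using J by measurable
    have G_mono: "\<omega> \<in> ?G b" if "a \<le> b" "\<omega> \<in> ?G a" for a b \<omega>
    proof -
      have "Y j \<omega> \<le> y j + b" if "j \<in> J" for j
        using \<open>\<omega> \<in> ?G a\<close> \<open>a \<le> b\<close> that by fastforce
      then show ?thesis using that(2) by blast
    qed
    have null: "AE \<omega> in N. \<forall>j\<in>J. Y j \<omega> \<noteq> y j"
    proof (rule AE_finite_allI[OF J])
      fix j assume j: "j \<in> J"
      have "measure N (Y j -` {y j} \<inter> space N) = 0"
        using y[OF j] j by (simp add: D_def measure_distr)
      then have "AE \<omega> in N. \<omega> \<notin> Y j -` {y j} \<inter> space N"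
        using j by (intro AE_not_in) (auto simp: null_sets_def N.emeasure_eq_measure)
      then show "AE \<omega> in N. Y j \<omega> \<noteq> y j" using AE_space by eventually_elim auto
    qed
    have up: "(\<lambda>n. measure N (?G (1 / real (Suc n)))) \<longlonglongrightarrow> measure N (?G 0)"
    proof -
      have "(\<lambda>n. measure N (?G (1 / real (Suc n)))) \<longlonglongrightarrow> measure N (\<Inter>n. ?G (1 / real (Suc n)))"
      proof (rule N.finite_Lim_measure_decseq)
        show "decseq (\<lambda>n. ?G (1 / real (Suc n)))"
        proof (rule decseq_SucI, rule subsetI)
          fix n \<omega> assume \<omega>: "\<omega> \<in> ?G (1 / real (Suc (Suc n)))"
          have "1 / real (Suc (Suc n)) \<le> 1 / real (Suc n)" by (simp add: frac_le)
          then show "\<omega> \<in> ?G (1 / real (Suc n))" using \<omega> by (rule G_mono)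
        qed
      qed auto
      also have "(\<Inter>n. ?G (1 / real (Suc n))) = ?G 0"
      proof (intro equalityI subsetI)
        fix \<omega> assume \<omega>: "\<omega> \<in> (\<Inter>n. ?G (1 / real (Suc n)))"
        have "Y j \<omega> \<le> y j + 0" if j: "j \<in> J" for j
        proof (rule LIMSEQ_le_const)
          show "(\<lambda>n. y j + 1 / real (Suc n)) \<longlonglongrightarrow> y j + 0"
            by (intro tendsto_add tendsto_const LIMSEQ_Suc[OF lim_1_over_n])
          show "\<exists>n0. \<forall>n\<ge>n0. Y j \<omega> \<le> y j + 1 / real (Suc n)" using \<omega> j by blast
        qed
        then show "\<omega> \<in> ?G 0" using \<omega> by auto
      next
        fix \<omega> assume \<omega>: "\<omega> \<in> ?G 0"
        show "\<omega> \<in> (\<Inter>n. ?G (1 / real (Suc n)))"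
        proof
          fix n
          have "0 \<le> 1 / real (Suc n)" by simp
          then show "\<omega> \<in> ?G (1 / real (Suc n))" using \<omega> by (rule G_mono)
        qed
      qed
      finally show ?thesis .
    qed
    have down: "(\<lambda>n. measure N (?G (- (1 / real (Suc n))))) \<longlonglongrightarrow> measure N (?G 0)"
    proof -
      have "(\<lambda>n. measure N (?G (- (1 / real (Suc n))))) \<longlonglongrightarrow> measure N (\<Union>n. ?G (- (1 / real (Suc n))))"
      proof (rule N.finite_Lim_measure_incseq)
        show "incseq (\<lambda>n. ?G (- (1 / real (Suc n))))"
        proof (rule incseq_SucI, rule subsetI)
          fix n \<omega> assume \<omega>: "\<omega> \<in> ?G (- (1 / real (Suc n)))"
          have "- (1 / real (Suc n)) \<le> - (1 / real (Suc (Suc n)))" by (simp add: frac_le)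
          then show "\<omega> \<in> ?G (- (1 / real (Suc (Suc n))))" using \<omega> by (rule G_mono)
        qed
      qed (use G in blast)
      also have "measure N (\<Union>n. ?G (- (1 / real (Suc n)))) = measure N (?G 0)"
      proof (rule N.finite_measure_eq_AE)
        show "AE \<omega> in N. \<omega> \<in> (\<Union>n. ?G (- (1 / real (Suc n)))) \<longleftrightarrow> \<omega> \<in> ?G 0"
          using null
        proof eventually_elim
          case (elim \<omega>)
          show ?case
          proof
            assume "\<omega> \<in> (\<Union>n. ?G (- (1 / real (Suc n))))"
            then obtain n where n: "\<omega> \<in> ?G (- (1 / real (Suc n)))" by blast
            have "- (1 / real (Suc n)) \<le> 0" by simp
            then show "\<omega> \<in> ?G 0" using n by (rule G_mono)
          next
            assume \<omega>: "\<omega> \<in> ?G 0"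
            define r where "r = Min (insert 1 ((\<lambda>j. y j - Y j \<omega>) ` J))"
            have "0 < y j - Y j \<omega>" if "j \<in> J" for j
              using \<omega> elim that by (fastforce simp: less_le)
            then have r: "0 < r" "\<And>j. j \<in> J \<Longrightarrow> r \<le> y j - Y j \<omega>"
              unfolding r_def using J by (simp_all add: Min_gr_iff)
            obtain n where "1 / real (Suc n) < r"
              using reals_Archimedean[OF r(1)] by (auto simp: inverse_eq_divide)
            then have "\<omega> \<in> ?G (- (1 / real (Suc n)))" using \<omega> r(2) by force
            then show "\<omega> \<in> (\<Union>n. ?G (- (1 / real (Suc n))))" by blast
          qed
        qed
      qed (use G in \<open>blast intro: sets.countable_UN\<close>)+
      finally show ?thesis .
    qed
    show "((\<lambda>t. prob {\<omega> \<in> space M. \<forall>j\<in>J. X t j \<omega> \<le> y j})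
        \<longlongrightarrow> measure N {\<omega> \<in> space N. \<forall>j\<in>J. Y j \<omega> \<le> y j}) F" (is "(?P \<longlongrightarrow> ?p) F")
    proof (rule tendstoI)
      fix e :: real assume e: "0 < e"
      have p: "?p = measure N (?G 0)" by simp
      have "\<forall>\<^sub>F n in sequentially. measure N (?G (1 / real (Suc n))) < ?p + e / 2 \<and>
          measure N (?G (- (1 / real (Suc n)))) > ?p - e / 2"
        unfolding p by (intro eventually_conj order_tendstoD(2)[OF up] order_tendstoD(1)[OF down]) (use e in auto)
      then obtain n where n: "measure N (?G (1 / real (Suc n))) < ?p + e / 2"
        "measure N (?G (- (1 / real (Suc n)))) > ?p - e / 2" by (auto simp: eventually_sequentially)
      have pos: "0 < 1 / real (Suc n)" "0 < e / 2" using e by auto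
      show "\<forall>\<^sub>F t in F. dist (?P t) ?p < e"
        using upper[OF pos, of y] lower[OF pos, of y]
      proof eventually_elim
        case (elim t)
        then show ?case using n unfolding dist_real_def by (simp del: of_nat_Suc)
      qed
    qed
  qed
qed

section \<open>The normalisation grows faster than linearly\<close>

text \<open>The function \<open>a\<close> need be neither monotone nor measurable, so its growth is read off the monotone tail
  \<open>F\<close>.  Whenever \<open>F x\<close> is small, the time \<open>t = 2 * B / F x\<close> satisfies \<open>x < a t\<close>, and the lower bound
  at level \<open>L * a t\<close> gives \<open>F (L * x) \<ge> \<kappa> * L powr (- \<alpha>) / (2 * B) * F x\<close>.  Since \<open>\<alpha> < 1\<close>, a
  large fixed \<open>L\<close> makes \<open>x * F x\<close> at least double when \<open>x\<close> is multiplied by \<open>L\<close>, hence \<open>x * F x\<close>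
  diverges.  If \<open>a t \<le> K * t\<close> happened for large \<open>t\<close>, then \<open>t * F (a t)\<close> would be at least
  \<open>t * F (K * t)\<close> and could not stay bounded.\<close>

lemma ratio_at_top_of_heavy_tail:
  fixes F a :: "real \<Rightarrow> real"
  assumes anti: "\<And>x y. x \<le> y \<Longrightarrow> F y \<le> F x" and F_nonneg: "\<And>x. 0 \<le> F x"
    and F_lim: "(F \<longlongrightarrow> 0) at_top"
    and a_pos: "\<And>t. 0 < t \<Longrightarrow> 0 < a t"
    and B: "0 < B" and upper: "\<forall>\<^sub>F t in at_top. t * F (a t) \<le> B"
    and \<kappa>: "0 < \<kappa>" and lower: "\<And>L. 1 \<le> L \<Longrightarrow> \<forall>\<^sub>F t in at_top. \<kappa> * L powr (- \<alpha>) \<le> t * F (a t * L)"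
    and \<alpha>: "\<alpha> < 1"
  shows "filterlim (\<lambda>t. a t / t) at_top at_top"
proof -
  \<comment> \<open>a vanishing tail would first force \<open>a t\<close> to 0 and then, as \<open>F (a t) \<le> B / t\<close>, a tail that vanishes on the positive axis, against the lower bound\<close>
  have F_pos: "0 < F x" for x
  proof (rule ccontr)
    assume "\<not> 0 < F x"
    define x0 where "x0 = max x 1"
    have "F x0 \<le> F x" by (rule anti) (simp add: x0_def)
    then have x0: "F x0 = 0" "0 < x0" using \<open>\<not> 0 < F x\<close> F_nonneg[of x0] by (auto simp: x0_def)
    have small: "\<forall>\<^sub>F t in at_top. a t < z" if z: "0 < z" for z
    proof -
      define L where "L = max 1 (x0 / z)"
      have L: "1 \<le> L" "x0 \<le> z * L"
        using z by (auto simp: L_def max_def field_simps)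
      show ?thesis using lower[OF L(1)] eventually_gt_at_top[of 0]
      proof eventually_elim
        case (elim t)
        have "0 < \<kappa> * L powr (- \<alpha>)" using \<kappa> L(1) by simp
        then have "0 < t * F (a t * L)" using elim(1) by linarith
        then have "0 < F (a t * L)" using elim(2) by (simp add: zero_less_mult_iff)
        then have "\<not> x0 \<le> a t * L" using anti[of x0 "a t * L"] x0(1) by auto
        then have "a t * L < z * L" using L(2) by linarith
        then show ?case using L(1) by (simp add: mult_less_cancel_right)
      qed
    qed
    have zero: "F z \<le> 0" if z: "0 < z" for z
    proof (rule tendsto_lowerbound)
      show "((\<lambda>t. B / t) \<longlongrightarrow> 0) at_top"
        by (intro tendsto_divide_0[OF tendsto_const] filterlim_at_top_imp_at_infinity filterlim_ident)
      show "\<forall>\<^sub>F t in at_top. F z \<le> B / t"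
        using small[OF z] upper eventually_gt_at_top[of 0]
      proof eventually_elim
        case (elim t)
        have "F z \<le> F (a t)" using elim(1) by (intro anti) simp
        also have "\<dots> \<le> B / t" using elim(2,3) by (simp add: field_simps)
        finally show ?case .
      qed
    qed simp
    obtain t where t: "\<kappa> * 1 powr (- \<alpha>) \<le> t * F (a t * 1)" "0 < t"
      using eventually_happens'[OF trivial_limit_at_top_linorder
          eventually_conj[OF lower[OF order_refl] eventually_gt_at_top[of 0]]] by blast
    have "t * F (a t * 1) \<le> 0" using zero[OF a_pos[OF t(2)]] t(2) by (simp add: mult_nonneg_nonpos)
    then show False using t(1) \<kappa> by simp
  qed
  obtain L where L: "2 \<le> L" "4 * B \<le> \<kappa> * L powr (1 - \<alpha>)"
  proof
    define l where "l = (4 * B / \<kappa>) powr (1 / (1 - \<alpha>))"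
    show "2 \<le> max 2 l" by simp
    have "4 * B / \<kappa> = l powr (1 - \<alpha>)" using \<alpha> B \<kappa> by (simp add: l_def powr_powr)
    also have "\<dots> \<le> (max 2 l) powr (1 - \<alpha>)" using \<alpha> by (intro powr_mono2) (auto simp: l_def)
    finally show "4 * B \<le> \<kappa> * max 2 l powr (1 - \<alpha>)" using \<kappa> by (simp add: field_simps)
  qed
  define H where "H x = x * F x" for x
  obtain T0 where T0: "1 \<le> T0" "\<And>t. T0 \<le> t \<Longrightarrow> t * F (a t) \<le> B"
    "\<And>t. T0 \<le> t \<Longrightarrow> \<kappa> * L powr (- \<alpha>) \<le> t * F (a t * L)"
  proof -
    have "1 \<le> L" using L(1) by simp
    from eventually_conj[OF upper lower[OF this]]
    obtain T where "\<And>t. T \<le> t \<Longrightarrow> t * F (a t) \<le> B \<and> \<kappa> * L powr (- \<alpha>) \<le> t * F (a t * L)"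
      unfolding eventually_at_top_linorder by blast
    then show thesis by (intro that[of "max 1 T"]) auto
  qed
  obtain x0 where x0: "1 \<le> x0" "\<And>x. x0 \<le> x \<Longrightarrow> F x \<le> 2 * B / T0"
  proof -
    have "\<forall>\<^sub>F x in at_top. F x < 2 * B / T0"
      by (rule order_tendstoD(2)[OF F_lim]) (use B T0(1) in auto)
    then obtain z where "\<And>x. z \<le> x \<Longrightarrow> F x < 2 * B / T0"
      unfolding eventually_at_top_linorder by blast
    then show thesis by (intro that[of "max 1 z"]) (auto intro: less_imp_le)
  qed
  have double: "2 * H x \<le> H (L * x)" if x: "x0 \<le> x" for x
  proof -
    define t where "t = 2 * B / F x"
    have t: "T0 \<le> t" "0 < t" using x0(2)[OF x] T0(1) F_pos[of x] B by (auto simp: t_def field_simps)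
    have tF: "t * F x = 2 * B" using F_pos[of x] by (simp add: t_def)
    have "t * F (a t) < t * F x" using T0(2)[OF t(1)] tF B by linarith
    then have "\<not> a t \<le> x" using anti[of "a t" x] t(2) by (auto simp: mult_less_cancel_left)
    then have "L * x \<le> a t * L" using L(1) by (simp add: mult.commute)
    then have "F (a t * L) \<le> F (L * x)" by (rule anti)
    then have "t * F (a t * L) \<le> t * F (L * x)" using t(2) by simp
    then have "\<kappa> * L powr (- \<alpha>) \<le> t * F (L * x)" using T0(3)[OF t(1)] by linarith
    then have "L * (\<kappa> * L powr (- \<alpha>)) \<le> L * (t * F (L * x))" using L(1) by (intro mult_left_mono) auto
    moreover have "L * (\<kappa> * L powr (- \<alpha>)) = \<kappa> * L powr (1 - \<alpha>)"
      using L(1) powr_add[of L 1 "- \<alpha>"] by simp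
    ultimately have "2 * (t * F x) \<le> t * (L * F (L * x))" using L(2) tF by (simp add: mult_ac)
    then have "2 * F x \<le> L * F (L * x)" using t(2) by (simp add: mult.left_commute[of 2])
    then have "x * (2 * F x) \<le> x * (L * F (L * x))" using x x0(1) by (intro mult_left_mono) auto
    then show ?thesis by (simp add: H_def mult_ac)
  qed
  have iter: "2 ^ n * H x0 \<le> H (L ^ n * x0)" for n
  proof (induction n)
    case (Suc n)
    have "1 \<le> L ^ n" using L(1) by (intro one_le_power) auto
    then have "x0 \<le> L ^ n * x0" using x0(1) by simp
    from double[OF this] Suc.IH show ?case by (simp add: mult.assoc)
  qed simp
  have H_pos: "0 < H x0" using F_pos x0(1) by (simp add: H_def)
  have H_lim: "filterlim H at_top at_top"
    unfolding filterlim_at_top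
  proof
    fix K :: real
    obtain n where n: "K * L / H x0 < 2 ^ n" using real_arch_pow[of 2 "K * L / H x0"] by auto
    show "\<forall>\<^sub>F x in at_top. K \<le> H x"
      using eventually_ge_at_top[of "L ^ n * x0"]
    proof eventually_elim
      case (elim x)
      obtain k0 where k0: "x < L ^ k0" using real_arch_pow[of L x] L(1) by auto
      have "1 * L ^ k0 \<le> L ^ k0 * x0" using x0(1) L(1) by simp
      then have ex: "x < L ^ k0 * x0" using k0 by simp
      define k where "k = (LEAST k. x < L ^ k * x0)"
      have k: "x < L ^ k * x0" unfolding k_def by (rule LeastI[of "\<lambda>k. x < L ^ k * x0", OF ex])
      have "n < k"
      proof (rule ccontr)
        assume "\<not> n < k"
        then have "L ^ k \<le> L ^ n" using L(1) by (intro power_increasing) auto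
        then have "L ^ k * x0 \<le> L ^ n * x0" using x0(1) by simp
        then show False using k elim by linarith
      qed
      then obtain m where m: "k = Suc m" "n \<le> m" by (cases k) auto
      have mx: "L ^ m * x0 \<le> x" using not_less_Least[of m "\<lambda>k. x < L ^ k * x0"] m(1) k_def by auto
      have "0 \<le> L ^ m * x0" using L(1) x0(1) by simp
      then have x_nonneg: "0 \<le> x" using mx by linarith
      have "K * L \<le> 2 ^ n * H x0" using n H_pos by (simp add: field_simps)
      also have "\<dots> \<le> 2 ^ k * H x0" using m H_pos by (intro mult_right_mono power_increasing) auto
      also have "\<dots> \<le> H (L ^ k * x0)" by (rule iter)
      also have "\<dots> = L * (L ^ m * x0) * F (L ^ k * x0)" by (simp add: H_def m(1))
      also have "\<dots> \<le> L * x * F x"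
        using x_nonneg mx L(1) x0(1) k F_nonneg by (intro mult_mono mult_left_mono anti) auto
      finally have "K * L \<le> H x * L" by (simp add: H_def mult_ac)
      then show ?case using L(1) by simp
    qed
  qed
  show ?thesis
    unfolding filterlim_at_top_gt[where c = "0::real"]
  proof (intro allI impI)
    fix K :: real assume K: "0 < K"
    have "filterlim (\<lambda>t. K * t) at_top at_top"
      by (rule filterlim_tendsto_pos_mult_at_top[OF tendsto_const K filterlim_ident])
    then have "filterlim (\<lambda>t. H (K * t)) at_top at_top" by (rule filterlim_compose[OF H_lim])
    then have "\<forall>\<^sub>F t in at_top. K * B < H (K * t)" by (simp add: filterlim_at_top_dense)
    then show "\<forall>\<^sub>F t in at_top. K \<le> a t / t"
      using upper eventually_gt_at_top[of 0]
    proof eventually_elim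
      case (elim t)
      have "B < t * F (K * t)" using elim(1) K by (simp add: H_def mult.assoc)
      then have "\<not> a t \<le> K * t" using anti[of "a t" "K * t"] elim(2,3)
        by (metis less_le_trans linorder_not_le mult_less_cancel_left_pos)
      then show ?case using elim(3) by (simp add: field_simps)
    qed
  qed
qed

text \<open>The easy half of the equivalence of norms: expand a vector in the standard basis.\<close>

lemma norm_on_le_sup:
  fixes N :: "('i \<Rightarrow> real) \<Rightarrow> real"
  assumes I: "finite I" and N: "norm_on I N"
  obtains C where "0 < C" "\<And>x b. x \<in> I \<rightarrow>\<^sub>E UNIV \<Longrightarrow> (\<And>i. i \<in> I \<Longrightarrow> \<bar>x i\<bar> \<le> b) \<Longrightarrow> 0 \<le> b \<Longrightarrow> N x \<le> C * b"
proof -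
  define u where "u i = (\<lambda>k\<in>I. if k = i then 1 else 0 :: real)" for i
  define C where "C = 1 + (\<Sum>i\<in>I. \<bar>N (u i)\<bar>)"
  have zero: "N (\<lambda>i\<in>I. 0) = 0" using N unfolding norm_on_def by simp
  have scale: "N (\<lambda>i\<in>I. r * x i) = \<bar>r\<bar> * N x" if "x \<in> I \<rightarrow>\<^sub>E UNIV" for r x
    using N that unfolding norm_on_def by blast
  have tri: "N (\<lambda>i\<in>I. x i + y i) \<le> N x + N y" if "x \<in> I \<rightarrow>\<^sub>E UNIV" "y \<in> I \<rightarrow>\<^sub>E UNIV" for x y
    using N that unfolding norm_on_def by blast
  have partial: "N (\<lambda>k\<in>I. if k \<in> S then x k else 0) \<le> (\<Sum>i\<in>S. \<bar>x i\<bar> * N (u i))"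
    if "finite S" "S \<subseteq> I" for S x
    using that
  proof (induction S rule: finite_induct)
    case (insert i S)
    have "(\<lambda>k\<in>I. if k \<in> insert i S then x k else 0)
        = (\<lambda>k\<in>I. (\<lambda>k\<in>I. x i * u i k) k + (\<lambda>k\<in>I. if k \<in> S then x k else 0) k)"
      using insert.hyps by (auto simp: u_def restrict_def fun_eq_iff)
    then have "N (\<lambda>k\<in>I. if k \<in> insert i S then x k else 0)
        \<le> N (\<lambda>k\<in>I. x i * u i k) + N (\<lambda>k\<in>I. if k \<in> S then x k else 0)"
      using tri[of "\<lambda>k\<in>I. x i * u i k" "\<lambda>k\<in>I. if k \<in> S then x k else 0"] by simp
    moreover have "u i \<in> I \<rightarrow>\<^sub>E UNIV" by (simp add: u_def)
    moreover have "N (\<lambda>k\<in>I. if k \<in> S then x k else 0) \<le> (\<Sum>i\<in>S. \<bar>x i\<bar> * N (u i))"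
      by (rule insert.IH) (use insert.prems in auto)
    moreover have "(\<Sum>i\<in>insert i S. \<bar>x i\<bar> * N (u i)) = \<bar>x i\<bar> * N (u i) + (\<Sum>i\<in>S. \<bar>x i\<bar> * N (u i))"
      using insert.hyps by simp
    ultimately show ?case using scale[of "u i" "x i"] by linarith
  qed (simp add: zero)
  show thesis
  proof (rule that[of C])
    show "0 < C" by (simp add: C_def add_pos_nonneg sum_nonneg)
    fix x :: "'i \<Rightarrow> real" and b assume x: "x \<in> I \<rightarrow>\<^sub>E UNIV" and b: "\<And>i. i \<in> I \<Longrightarrow> \<bar>x i\<bar> \<le> b" "0 \<le> b"
    have "x = (\<lambda>k\<in>I. if k \<in> I then x k else 0)" using x by (auto simp: fun_eq_iff PiE_iff extensional_def)
    then have "N x \<le> (\<Sum>i\<in>I. \<bar>x i\<bar> * N (u i))" using partial[OF I order_refl, of x] by simp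
    also have "\<dots> \<le> (\<Sum>i\<in>I. b * \<bar>N (u i)\<bar>)"
    proof (rule sum_mono)
      fix i assume i: "i \<in> I"
      have "\<bar>x i\<bar> * N (u i) \<le> \<bar>x i\<bar> * \<bar>N (u i)\<bar>" by (intro mult_left_mono) auto
      also have "\<dots> \<le> b * \<bar>N (u i)\<bar>" using b(1)[OF i] by (intro mult_right_mono) auto
      finally show "\<bar>x i\<bar> * N (u i) \<le> b * \<bar>N (u i)\<bar>" .
    qed
    also have "\<dots> \<le> C * b" using b(2) by (simp add: C_def sum_distrib_left[symmetric] algebra_simps)
    finally show "N x \<le> C * b" .
  qed
qed

section \<open>Exceedance probabilities from vague convergence\<close>

text \<open>The index \<open>j\<close> selects the coordinate \<open>\<pi> j\<close> and the level \<open>y j\<close>; a coordinate may be selected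
  several times, which is what happens when one prime is observed at several times.\<close>

definition exceedance :: "'i set \<Rightarrow> ('j \<Rightarrow> 'i) \<Rightarrow> ('j \<Rightarrow> real) \<Rightarrow> 'j set \<Rightarrow> ('i \<Rightarrow> ennreal) set" where
  "exceedance I \<pi> y V = {x \<in> orthant I. \<exists>j\<in>V. ennreal (y j) < x (\<pi> j)}"

text \<open>Rises linearly from 0 at \<open>y\<close> to 1 at \<open>y + d\<close>; the minimum keeps the value at infinity equal to 1.\<close>

definition ramp :: "real \<Rightarrow> real \<Rightarrow> ennreal \<Rightarrow> real" where
  "ramp y d z = max 0 ((enn2real (min z (ennreal (y + d))) - y) / d)"

lemma continuous_on_ramp: "continuous_on UNIV (ramp y d)"
proof -
  have "continuous_on UNIV (\<lambda>z::ennreal. enn2real (min z (ennreal c)))" for c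
    unfolding continuous_on_def
  proof
    fix z :: ennreal
    have lim: "((\<lambda>w. min w (ennreal c)) \<longlongrightarrow> min z (ennreal c)) (at z)"
      by (intro tendsto_min tendsto_ident_at tendsto_const)
    have "min z (ennreal c) < \<infinity>" by (simp add: min_less_iff_disj)
    then have "min z (ennreal c) = ennreal (enn2real (min z (ennreal c)))" by simp
    with lim have "((\<lambda>w. min w (ennreal c)) \<longlongrightarrow> ennreal (enn2real (min z (ennreal c)))) (at z)" by metis
    then show "((\<lambda>z. enn2real (min z (ennreal c))) \<longlongrightarrow> enn2real (min z (ennreal c))) (at z)"
      by (rule tendsto_enn2real) simp
  qed
  then show ?thesis unfolding ramp_def divide_inverse by (intro continuous_intros)
qed

lemma ramp_bounds:
  assumes "0 < y" "0 < d"
  shows "0 \<le> ramp y d z" "ramp y d z \<le> 1" "z \<le> ennreal y \<Longrightarrow> ramp y d z = 0"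
    "ennreal (y + d) \<le> z \<Longrightarrow> ramp y d z = 1"
proof -
  show "0 \<le> ramp y d z" by (simp add: ramp_def)
  have "enn2real (min z (ennreal (y + d))) \<le> enn2real (ennreal (y + d))" by (intro enn2real_mono) auto
  then have "enn2real (min z (ennreal (y + d))) \<le> y + d" using assms by (simp del: ennreal_plus)
  then show "ramp y d z \<le> 1" using assms by (simp add: ramp_def field_simps)
  show "ramp y d z = 0" if "z \<le> ennreal y"
  proof -
    have "enn2real (min z (ennreal (y + d))) \<le> enn2real (ennreal y)"
      using that by (intro enn2real_mono) (auto simp: min_le_iff_disj)
    then show ?thesis using assms by (simp add: ramp_def max_def field_simps)
  qed
  show "ramp y d z = 1" if "ennreal (y + d) \<le> z"
    using that assms by (simp add: ramp_def min_absorb2 del: ennreal_plus)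
qed

text \<open>Turns the convergence of integrals of one test function into two-sided bounds for measures.\<close>

lemma integral_between_measures:
  fixes \<phi> :: "'c \<Rightarrow> real"
  assumes "A \<in> sets \<mu>" "A' \<in> sets \<mu>" "emeasure \<mu> A < \<infinity>" "A' \<subseteq> A" and [measurable]: "\<phi> \<in> borel_measurable \<mu>"
    and lo: "\<And>x. x \<in> space \<mu> \<Longrightarrow> indicator A' x \<le> \<phi> x"
    and up: "\<And>x. x \<in> space \<mu> \<Longrightarrow> \<phi> x \<le> indicator A x"
  shows "measure \<mu> A' \<le> integral\<^sup>L \<mu> \<phi>" "integral\<^sup>L \<mu> \<phi> \<le> measure \<mu> A"
proof -
  have iA: "integrable \<mu> (indicator A :: 'c \<Rightarrow> real)" using assms by (auto simp: integrable_indicator_iff)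
  have "emeasure \<mu> A' < \<infinity>" using assms(1,3,4) by (meson emeasure_mono le_less_trans)
  then have iA': "integrable \<mu> (indicator A' :: 'c \<Rightarrow> real)" using assms by (auto simp: integrable_indicator_iff)
  have i\<phi>: "integrable \<mu> \<phi>"
  proof (rule Bochner_Integration.integrable_bound[OF iA])
    show "AE x in \<mu>. norm (\<phi> x) \<le> norm (indicator A x :: real)"
    proof (rule AE_I2)
      fix x assume x: "x \<in> space \<mu>"
      have "0 \<le> (indicator A' x :: real)" by simp
      then have "0 \<le> \<phi> x" using lo[OF x] by linarith
      then show "norm (\<phi> x) \<le> norm (indicator A x :: real)" using up[OF x] by simp
    qed
  qed simp
  have "integral\<^sup>L \<mu> (indicator A') \<le> integral\<^sup>L \<mu> \<phi>" by (intro integral_mono iA' i\<phi> lo)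
  then show "measure \<mu> A' \<le> integral\<^sup>L \<mu> \<phi>" using assms(2) by (simp add: sets.Int_space_eq2)
  have "integral\<^sup>L \<mu> \<phi> \<le> integral\<^sup>L \<mu> (indicator A)" by (intro integral_mono iA i\<phi> up)
  then show "integral\<^sup>L \<mu> \<phi> \<le> measure \<mu> A" using assms(1) by (simp add: sets.Int_space_eq2)
qed

lemma orthant_in_sets_PiM:
  assumes "finite I"
  shows "orthant I \<in> sets (Pi\<^sub>M I (\<lambda>_. borel :: ennreal measure))"
proof -
  have "(\<Pi>\<^sub>E i\<in>I. {0::ennreal}) \<in> sets (Pi\<^sub>M I (\<lambda>_. borel))"
    using assms by (intro sets_PiM_I_finite) auto
  moreover have "(\<Pi>\<^sub>E i\<in>I. {0::ennreal}) = {\<lambda>i\<in>I. 0}" by (auto simp: PiE_iff extensional_def)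
  moreover have "(I \<rightarrow>\<^sub>E UNIV) \<in> sets (Pi\<^sub>M I (\<lambda>_. borel :: ennreal measure))"
    using sets.top[of "Pi\<^sub>M I (\<lambda>_. borel :: ennreal measure)"] by (simp add: space_PiM)
  ultimately show ?thesis unfolding orthant_def by auto
qed

lemma space_orthant_borel: "space (orthant_borel I) = orthant I"
  by (auto simp: orthant_borel_def space_restrict_space space_PiM orthant_def)

lemma component_measurable_orthant:
  "i \<in> I \<Longrightarrow> (\<lambda>x. x i) \<in> borel_measurable (orthant_borel I)"
  unfolding orthant_borel_def by (intro measurable_restrict_space1 measurable_component_singleton)

lemma exceedance_in_sets:
  assumes "finite V" "\<pi> ` V \<subseteq> I"
  shows "exceedance I \<pi> y V \<in> sets (orthant_borel I)"
proof -
  have "exceedance I \<pi> y V = (\<Union>j\<in>V. {x \<in> space (orthant_borel I). ennreal (y j) < x (\<pi> j)})"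
    by (auto simp: exceedance_def space_orthant_borel)
  moreover have "{x \<in> space (orthant_borel I). ennreal (y j) < x (\<pi> j)} \<in> sets (orthant_borel I)" if "j \<in> V" for j
  proof -
    have [measurable]: "(\<lambda>x. x (\<pi> j)) \<in> borel_measurable (orthant_borel I)"
      using assms(2) that by (intro component_measurable_orthant) auto
    show ?thesis by measurable
  qed
  ultimately show ?thesis using assms(1) by auto
qed

text \<open>Compactness of \<open>[0, \<infinity>]\<close> leaves only the origin as a point to which mass could escape, and
  positive levels keep the set away from it.  Both the support of the test functions and the
  finiteness of \<open>\<nu>\<close> on exceedance sets come from here.\<close>

lemma compactin_exceedance_closure:
  fixes I :: "'i set"
  assumes V: "finite V" "\<pi> ` V \<subseteq> I" and y: "\<And>j. j \<in> V \<Longrightarrow> 0 < y j"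
  shows "compactin (orthant_top I) {x \<in> I \<rightarrow>\<^sub>E UNIV. \<exists>j\<in>V. ennreal (y j) \<le> x (\<pi> j)}"
    (is "compactin _ ?K")
proof -
  let ?P = "product_topology (\<lambda>_. euclidean :: ennreal topology) I"
  have "compactin ?P (I \<rightarrow>\<^sub>E UNIV)"
    by (subst compactin_PiE) (simp add: compact_UNIV)
  moreover have "closedin ?P ?K"
  proof -
    have "?K = (\<Union>j\<in>V. {x \<in> topspace ?P. x (\<pi> j) \<in> {ennreal (y j)..}})" by auto
    also have "closedin ?P \<dots>"
    proof (rule closedin_Union)
      show "finite ((\<lambda>j. {x \<in> topspace ?P. x (\<pi> j) \<in> {ennreal (y j)..}}) ` V)" using V(1) by simp
      fix S assume "S \<in> (\<lambda>j. {x \<in> topspace ?P. x (\<pi> j) \<in> {ennreal (y j)..}}) ` V"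
      then obtain j where j: "j \<in> V" "S = {x \<in> topspace ?P. x (\<pi> j) \<in> {ennreal (y j)..}}" by auto
      have "\<pi> j \<in> I" using V(2) j(1) by auto
      then have "continuous_map ?P (euclidean :: ennreal topology) (\<lambda>x. x (\<pi> j))"
        by (rule continuous_map_product_projection)
      then show "closedin ?P S" unfolding j(2)
        by (rule closedin_continuous_map_preimage) simp
    qed
    finally show ?thesis .
  qed
  ultimately have "compactin ?P ?K" by (elim closed_compactin) auto
  moreover have "?K \<subseteq> orthant I"
  proof
    fix x assume x: "x \<in> ?K"
    then obtain j where j: "j \<in> V" "ennreal (y j) \<le> x (\<pi> j)" by auto
    have "x \<noteq> (\<lambda>i\<in>I. 0)"
    proof
      assume "x = (\<lambda>i\<in>I. 0)"
      then have "ennreal (y j) \<le> 0" using j V(2) by auto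
      then show False using y[OF j(1)] by (simp add: ennreal_eq_0_iff)
    qed
    then show "x \<in> orthant I" using x by (auto simp: orthant_def)
  qed
  ultimately show ?thesis by (simp add: orthant_top_def compactin_subtopology)
qed

text \<open>Everything that vague convergence of the normalised tail of \<open>R\<close> yields by itself.  The radial
  power law enters in an extension below, which keeps the comparison of probabilities with \<open>\<nu>\<close>
  apart from the growth of \<open>a\<close>.\<close>

locale vague_tail = prob_space M for M :: "'a measure" +
  fixes I :: "'i set" and R :: "'i \<Rightarrow> 'a \<Rightarrow> real" and a :: "real \<Rightarrow> real"
    and \<nu> :: "('i \<Rightarrow> ennreal) measure"
  assumes finite_I: "finite I"
    and R_measurable: "\<And>i. i \<in> I \<Longrightarrow> R i \<in> borel_measurable M"
    and R_nonneg: "\<And>i \<omega>. 0 \<le> R i \<omega>"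
    and a_pos: "\<And>t. 0 < t \<Longrightarrow> 0 < a t"
    and sets_\<nu>: "sets \<nu> = sets (orthant_borel I)"
    and locally_finite: "locally_finite_measure (orthant_top I) \<nu>"
    and vague: "vague_convergence (orthant_top I)
           (\<lambda>t. scale_measure (ennreal t)
                  (restrict_space
                    (distr M (Pi\<^sub>M I (\<lambda>_. borel)) (\<lambda>\<omega>. \<lambda>i\<in>I. ennreal (R i \<omega> / a t)))
                    (orthant I)))
           \<nu> at_top"
begin

lemma space_\<nu>: "space \<nu> = orthant I"
  using sets_eq_imp_space_eq[OF sets_\<nu>] by (simp add: space_orthant_borel)

lemma exceedance_sets [simp]: "finite V \<Longrightarrow> \<pi> ` V \<subseteq> I \<Longrightarrow> exceedance I \<pi> y V \<in> sets \<nu>"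
  by (simp add: sets_\<nu> exceedance_in_sets)

lemma exceedance_finite:
  assumes V: "finite V" "\<pi> ` V \<subseteq> I" and y: "\<And>j. j \<in> V \<Longrightarrow> 0 < y j"
  shows "emeasure \<nu> (exceedance I \<pi> y V) < \<infinity>"
proof -
  let ?K = "{x \<in> I \<rightarrow>\<^sub>E UNIV. \<exists>j\<in>V. ennreal (y j) \<le> x (\<pi> j)}"
  have K: "emeasure \<nu> ?K < \<infinity>"
    using compactin_exceedance_closure[of V \<pi> I y, OF V y] locally_finite unfolding locally_finite_measure_def by blast
  have "?K \<in> sets \<nu>"
  proof -
    have "?K \<subseteq> orthant I"
      using compactin_exceedance_closure[of V \<pi> I y, OF V y] by (auto simp: orthant_top_def compactin_subtopology)
    then have "?K = (\<Union>j\<in>V. {x \<in> space (orthant_borel I). ennreal (y j) \<le> x (\<pi> j)})"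
      by (auto simp: space_orthant_borel orthant_def)
    moreover have "{x \<in> space (orthant_borel I). ennreal (y j) \<le> x (\<pi> j)} \<in> sets (orthant_borel I)" if "j \<in> V" for j
    proof -
      have [measurable]: "(\<lambda>x. x (\<pi> j)) \<in> borel_measurable (orthant_borel I)"
        using V(2) that by (intro component_measurable_orthant) auto
      show ?thesis by measurable
    qed
    ultimately show ?thesis using V(1) by (auto simp: sets_\<nu>)
  qed
  moreover have "exceedance I \<pi> y V \<subseteq> ?K" by (auto simp: exceedance_def orthant_def intro: less_imp_le)
  ultimately have "emeasure \<nu> (exceedance I \<pi> y V) \<le> emeasure \<nu> ?K" by (intro emeasure_mono)
  then show ?thesis using K by (rule le_less_trans)
qed

definition exceeds :: "real \<Rightarrow> ('j \<Rightarrow> 'i) \<Rightarrow> ('j \<Rightarrow> real) \<Rightarrow> 'j set \<Rightarrow> 'a set" where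
  "exceeds t \<pi> y V = {\<omega> \<in> space M. \<exists>j\<in>V. a t * y j < R (\<pi> j) \<omega>}"

text \<open>The test function \<open>1 - (\<Prod>j\<in>V. 1 - ramp (y j) d (x (\<pi> j)))\<close> is continuous with compact support and lies
  between the indicators of the exceedance sets for the levels \<open>y + d\<close> and \<open>y\<close>.\<close>

lemma tail_sandwich:
  assumes V: "finite V" "\<pi> ` V \<subseteq> I" and y: "\<And>j. j \<in> V \<Longrightarrow> 0 < y j" and d: "0 < d" and e: "0 < e"
  shows "\<forall>\<^sub>F t in at_top. t * prob (exceeds t \<pi> (\<lambda>j. y j + d) V) \<le> measure \<nu> (exceedance I \<pi> y V) + e"
    and "\<forall>\<^sub>F t in at_top. measure \<nu> (exceedance I \<pi> (\<lambda>j. y j + d) V) - e \<le> t * prob (exceeds t \<pi> y V)"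
proof -
  define \<phi> where "\<phi> x = 1 - (\<Prod>j\<in>V. 1 - ramp (y j) d (x (\<pi> j)))" for x :: "'i \<Rightarrow> ennreal"
  let ?A = "exceedance I \<pi> y V" and ?A' = "exceedance I \<pi> (\<lambda>j. y j + d) V"
  let ?\<mu> = "\<lambda>t. scale_measure (ennreal t) (restrict_space
    (distr M (Pi\<^sub>M I (\<lambda>_. borel)) (\<lambda>\<omega>. \<lambda>i\<in>I. ennreal (R i \<omega> / a t))) (orthant I))"
  have \<phi>_le: "\<phi> x \<le> 1" for x
    unfolding \<phi>_def using ramp_bounds(2)[OF y d] by (simp add: prod_nonneg)
  have \<phi>_ge: "0 \<le> \<phi> x" for x
    unfolding \<phi>_def using ramp_bounds(1,2)[OF y d] by (simp add: prod_le_1)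
  have \<phi>_0: "\<phi> x = 0" if "\<And>j. j \<in> V \<Longrightarrow> x (\<pi> j) \<le> ennreal (y j)" for x
    unfolding \<phi>_def using ramp_bounds(3)[OF y d that] by simp
  have \<phi>_1: "\<phi> x = 1" if "j \<in> V" "ennreal (y j + d) \<le> x (\<pi> j)" for x j
  proof -
    have "ramp (y j) d (x (\<pi> j)) = 1" using ramp_bounds(4)[OF y d] that by blast
    then have "(\<Prod>j\<in>V. 1 - ramp (y j) d (x (\<pi> j))) = 0" using V(1) that(1) by (intro prod_zero) auto
    then show ?thesis by (simp add: \<phi>_def)
  qed
  have lo: "indicator ?A' x \<le> \<phi> x" for x
    using \<phi>_1 \<phi>_ge[of x] by (auto simp: indicator_def exceedance_def intro: less_imp_le)
  have up: "\<phi> x \<le> indicator ?A x" if "x \<in> orthant I" for x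
    using \<phi>_0[of x] \<phi>_le[of x] that by (force simp: indicator_def exceedance_def not_less)
  have ramp_meas: "ramp (y j) d \<in> borel_measurable borel" for j
    using continuous_on_ramp by (rule borel_measurable_continuous_onI)
  have \<phi>_meas: "\<phi> \<in> borel_measurable (orthant_borel I)"
    unfolding \<phi>_def
    by (intro borel_measurable_diff borel_measurable_const borel_measurable_prod
        measurable_compose[OF component_measurable_orthant ramp_meas]) (use V(2) in auto)
  have \<phi>_cont: "continuous_map (orthant_top I) euclideanreal \<phi>"
    unfolding \<phi>_def orthant_top_def
  proof (intro continuous_map_from_subtopology continuous_map_diff continuous_map_canonical_const continuous_map_prod V(1))
    fix j assume "j \<in> V"
    then have "continuous_map (product_topology (\<lambda>_. euclidean) I) (euclidean :: ennreal topology) (\<lambda>x. x (\<pi> j))"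
      using V(2) by (intro continuous_map_product_projection) auto
    moreover have "continuous_map euclidean euclideanreal (ramp (y j) d)"
      using continuous_on_ramp by simp
    ultimately have "continuous_map (product_topology (\<lambda>_. euclidean) I) euclideanreal (ramp (y j) d \<circ> (\<lambda>x. x (\<pi> j)))"
      by (rule continuous_map_compose)
    then show "continuous_map (product_topology (\<lambda>_. euclidean) I) euclideanreal (\<lambda>x. ramp (y j) d (x (\<pi> j)))"
      by (simp add: o_def)
  qed
  have support: "\<exists>K. compactin (orthant_top I) K \<and> (\<forall>x\<in>topspace (orthant_top I) - K. \<phi> x = 0)"
  proof (intro exI conjI ballI)
    show "compactin (orthant_top I) {x \<in> I \<rightarrow>\<^sub>E UNIV. \<exists>j\<in>V. ennreal (y j) \<le> x (\<pi> j)}"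
      by (rule compactin_exceedance_closure[of V \<pi> I y, OF V y])
    fix x assume "x \<in> topspace (orthant_top I) - {x \<in> I \<rightarrow>\<^sub>E UNIV. \<exists>j\<in>V. ennreal (y j) \<le> x (\<pi> j)}"
    then show "\<phi> x = 0" by (intro \<phi>_0) (auto simp: orthant_top_def orthant_def)
  qed
  have lim: "((\<lambda>t. integral\<^sup>L (?\<mu> t) \<phi>) \<longlongrightarrow> integral\<^sup>L \<nu> \<phi>) at_top"
    using vague \<phi>_cont support unfolding vague_convergence_def by blast
  have sub: "?A' \<subseteq> ?A"
  proof
    fix x assume "x \<in> ?A'"
    then obtain j where j: "x \<in> orthant I" "j \<in> V" "ennreal (y j + d) < x (\<pi> j)" by (auto simp: exceedance_def)
    have "ennreal (y j) \<le> ennreal (y j + d)" using d by (intro ennreal_leI) simp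
    then have "ennreal (y j) < x (\<pi> j)" using j(3) by (rule le_less_trans)
    then show "x \<in> ?A" using j by (auto simp: exceedance_def)
  qed
  have \<nu>_bounds: "measure \<nu> ?A' \<le> integral\<^sup>L \<nu> \<phi>" "integral\<^sup>L \<nu> \<phi> \<le> measure \<nu> ?A"
  proof -
    have "\<phi> \<in> borel_measurable \<nu>" using \<phi>_meas by (simp add: measurable_cong_sets[OF sets_\<nu> refl])
    from integral_between_measures[OF _ _ exceedance_finite[OF V y] sub this lo up]
    show "measure \<nu> ?A' \<le> integral\<^sup>L \<nu> \<phi>" "integral\<^sup>L \<nu> \<phi> \<le> measure \<nu> ?A"
      using V by (simp_all add: space_\<nu>)
  qed
  have \<mu>_sets: "sets (?\<mu> t) = sets (orthant_borel I)" for t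
    by (simp add: orthant_borel_def sets_restrict_space)
  have \<mu>_space: "space (?\<mu> t) = orthant I" for t
    using sets_eq_imp_space_eq[OF \<mu>_sets] by (simp add: space_orthant_borel)
  have vec: "(\<lambda>\<omega>. \<lambda>i\<in>I. ennreal (R i \<omega> / a t)) \<in> M \<rightarrow>\<^sub>M Pi\<^sub>M I (\<lambda>_. borel)" for t
    using R_measurable by (intro measurable_restrict) auto
  have \<mu>_exceed: "measure (?\<mu> t) (exceedance I \<pi> z V) = t * prob (exceeds t \<pi> z V)"
    "emeasure (?\<mu> t) (exceedance I \<pi> z V) < \<infinity>"
    if t: "0 < t" and z: "\<And>j. j \<in> V \<Longrightarrow> 0 < z j" for t z
  proof -
    have orth: "orthant I \<in> sets (distr M (Pi\<^sub>M I (\<lambda>_. borel)) (\<lambda>\<omega>. \<lambda>i\<in>I. ennreal (R i \<omega> / a t)))"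
      using orthant_in_sets_PiM[OF finite_I] by simp
    have ex: "exceedance I \<pi> z V \<in> sets (Pi\<^sub>M I (\<lambda>_. borel))"
      using exceedance_in_sets[OF V, of z] orthant_in_sets_PiM[OF finite_I]
      by (auto simp: orthant_borel_def sets_restrict_space_iff)
    have "(\<lambda>\<omega>. \<lambda>i\<in>I. ennreal (R i \<omega> / a t)) -` exceedance I \<pi> z V \<inter> space M = exceeds t \<pi> z V"
    proof -
      have "(\<lambda>i\<in>I. ennreal (R i \<omega> / a t)) \<in> exceedance I \<pi> z V \<longleftrightarrow> (\<exists>j\<in>V. a t * z j < R (\<pi> j) \<omega>)" for \<omega>
      proof -
        have iff: "ennreal (z j) < ennreal (R (\<pi> j) \<omega> / a t) \<longleftrightarrow> a t * z j < R (\<pi> j) \<omega>" if "j \<in> V" for j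
          using z[OF that] a_pos[OF t] by (simp add: ennreal_less_iff field_simps)
        have "(\<lambda>i\<in>I. ennreal (R i \<omega> / a t)) \<in> orthant I"
          if j: "j \<in> V" "ennreal (z j) < ennreal (R (\<pi> j) \<omega> / a t)" for j
        proof -
          have "(\<lambda>i\<in>I. ennreal (R i \<omega> / a t)) (\<pi> j) \<noteq> (\<lambda>i\<in>I. 0) (\<pi> j)"
            using j V(2) by (auto simp: image_subset_iff)
          then have "(\<lambda>i\<in>I. ennreal (R i \<omega> / a t)) \<noteq> (\<lambda>i\<in>I. 0)" by metis
          then show ?thesis by (simp add: orthant_def)
        qed
        then show ?thesis using iff V(2) by (auto simp: exceedance_def image_subset_iff)
      qed
      then show ?thesis by (auto simp: exceeds_def)
    qed
    then show "measure (?\<mu> t) (exceedance I \<pi> z V) = t * prob (exceeds t \<pi> z V)"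
      using t orth ex vec by (simp add: measure_restrict_space exceedance_def measure_distr Collect_restrict)
    have "emeasure (restrict_space (distr M (Pi\<^sub>M I (\<lambda>_. borel)) (\<lambda>\<omega>. \<lambda>i\<in>I. ennreal (R i \<omega> / a t))) (orthant I))
        (exceedance I \<pi> z V) \<le> 1"
    proof -
      interpret d: prob_space "distr M (Pi\<^sub>M I (\<lambda>_. borel)) (\<lambda>\<omega>. \<lambda>i\<in>I. ennreal (R i \<omega> / a t))"
        by (rule prob_space_distr[OF vec])
      show ?thesis using orth
        by (subst emeasure_restrict_space) (auto simp: exceedance_def d.emeasure_le_1)
    qed
    then show "emeasure (?\<mu> t) (exceedance I \<pi> z V) < \<infinity>"
      by (auto simp: ennreal_mult_less_top intro: le_less_trans)
  qed
  have \<mu>_bounds: "t * prob (exceeds t \<pi> (\<lambda>j. y j + d) V) \<le> integral\<^sup>L (?\<mu> t) \<phi>"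
    "integral\<^sup>L (?\<mu> t) \<phi> \<le> t * prob (exceeds t \<pi> y V)" if t: "0 < t" for t
  proof -
    have y': "0 < y j + d" if "j \<in> V" for j using y[OF that] d by simp
    have m: "\<phi> \<in> borel_measurable (?\<mu> t)" using \<phi>_meas by (simp only: measurable_cong_sets[OF \<mu>_sets refl])
    have s: "exceedance I \<pi> z V \<in> sets (?\<mu> t)" for z
      unfolding \<mu>_sets by (rule exceedance_in_sets[OF V])
    have up': "\<phi> x \<le> indicator ?A x" if "x \<in> space (?\<mu> t)" for x
      using that unfolding \<mu>_space by (rule up)
    have fin: "emeasure (?\<mu> t) ?A < \<infinity>" using t y by (rule \<mu>_exceed(2))
    have eq: "measure (?\<mu> t) ?A = t * prob (exceeds t \<pi> y V)" using t y by (rule \<mu>_exceed(1))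
    have eq': "measure (?\<mu> t) ?A' = t * prob (exceeds t \<pi> (\<lambda>j. y j + d) V)" using t y' by (rule \<mu>_exceed(1))
    show "t * prob (exceeds t \<pi> (\<lambda>j. y j + d) V) \<le> integral\<^sup>L (?\<mu> t) \<phi>"
      using integral_between_measures(1)[OF s s fin sub m lo up'] unfolding eq' .
    show "integral\<^sup>L (?\<mu> t) \<phi> \<le> t * prob (exceeds t \<pi> y V)"
      using integral_between_measures(2)[OF s s fin sub m lo up'] unfolding eq .
  qed
  show "\<forall>\<^sub>F t in at_top. t * prob (exceeds t \<pi> (\<lambda>j. y j + d) V) \<le> measure \<nu> ?A + e"
  proof -
    have "\<forall>\<^sub>F t in at_top. integral\<^sup>L (?\<mu> t) \<phi> < integral\<^sup>L \<nu> \<phi> + e"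
      by (rule order_tendstoD(2)[OF lim]) (use e in simp)
    then show ?thesis using eventually_gt_at_top[of 0]
    proof eventually_elim
      case (elim t)
      then show ?case using \<mu>_bounds(1)[OF elim(2)] \<nu>_bounds(2) by linarith
    qed
  qed
  show "\<forall>\<^sub>F t in at_top. measure \<nu> ?A' - e \<le> t * prob (exceeds t \<pi> y V)"
  proof -
    have "\<forall>\<^sub>F t in at_top. integral\<^sup>L \<nu> \<phi> - e < integral\<^sup>L (?\<mu> t) \<phi>"
      by (rule order_tendstoD(1)[OF lim]) (use e in simp)
    then show ?thesis using eventually_gt_at_top[of 0]
    proof eventually_elim
      case (elim t)
      then show ?case using \<mu>_bounds(2)[OF elim(2)] \<nu>_bounds(1) by linarith
    qed
  qed
qed

lemma sigma_finite_\<nu>: "sigma_finite_measure \<nu>"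
proof
  let ?A = "\<lambda>n. exceedance I id (\<lambda>_. 1 / real (Suc n)) I"
  show "\<exists>A. countable A \<and> A \<subseteq> sets \<nu> \<and> \<Union>A = space \<nu> \<and> (\<forall>a\<in>A. emeasure \<nu> a \<noteq> \<infinity>)"
  proof (intro exI[of _ "range ?A"] conjI ballI)
    show "range ?A \<subseteq> sets \<nu>" using finite_I by auto
    show "\<Union> (range ?A) = space \<nu>"
    proof (intro equalityI subsetI)
      fix x assume x: "x \<in> space \<nu>"
      then have xE: "x \<in> I \<rightarrow>\<^sub>E UNIV" "x \<noteq> (\<lambda>i\<in>I. 0)" by (auto simp: space_\<nu> orthant_def)
      have "\<exists>i\<in>I. x i \<noteq> 0"
      proof (rule ccontr)
        assume "\<not> (\<exists>i\<in>I. x i \<noteq> 0)"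
        then have "x = (\<lambda>i\<in>I. 0)" using xE(1) by (auto simp: fun_eq_iff PiE_iff extensional_def)
        then show False using xE(2) by simp
      qed
      then obtain i where i: "i \<in> I" "0 < x i" by (auto simp: zero_less_iff_neq_zero)
      obtain z where z: "0 < z" "z < x i" using dense[OF i(2)] by blast
      then have zr: "0 < enn2real z" "z = ennreal (enn2real z)"
        by (auto simp: enn2real_positive_iff less_top[symmetric] ennreal_enn2real_if)
      obtain n where "1 / real (Suc n) < enn2real z"
        using reals_Archimedean[OF zr(1)] by (auto simp: inverse_eq_divide)
      then have "ennreal (1 / real (Suc n)) < ennreal (enn2real z)" by (intro ennreal_lessI) (use zr in auto)
      then have "ennreal (1 / real (Suc n)) < x i" using z(2) zr(2) by (metis less_trans)
      then have "x \<in> ?A n" using x i(1) by (auto simp: exceedance_def space_\<nu>)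
      then show "x \<in> \<Union> (range ?A)" by blast
    qed (auto simp: exceedance_def space_\<nu>)
    fix A assume "A \<in> range ?A"
    then obtain n where A: "A = ?A n" by blast
    have "emeasure \<nu> (?A n) < \<infinity>" using finite_I by (intro exceedance_finite) auto
    then show "emeasure \<nu> A \<noteq> \<infinity>" unfolding A by simp
  qed auto
qed

end

section \<open>Consequences of the radial power law\<close>

locale heavy_tail = vague_tail +
  fixes nrm :: "('b \<Rightarrow> real) \<Rightarrow> real" and c \<alpha> :: real
  assumes nrm: "norm_on I nrm" and c: "0 < c" and \<alpha>: "0 < \<alpha>" "\<alpha> < 1"
    and radial: "\<And>r. 0 < r \<Longrightarrow>
      emeasure \<nu> {x \<in> space \<nu>. (\<forall>i\<in>I. x i < \<infinity>) \<and> r \<le> nrm (\<lambda>i\<in>I. enn2real (x i))} = ennreal (c * r powr (- \<alpha>))"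
begin

abbreviation G :: "real \<Rightarrow> ('b \<Rightarrow> ennreal) set" where
  "G L \<equiv> exceedance I id (\<lambda>_. L) I"

abbreviation F :: "real \<Rightarrow> real" where
  "F x \<equiv> prob {\<omega> \<in> space M. \<exists>i\<in>I. x < R i \<omega>}"

lemma infinite_subset_G: "{x \<in> orthant I. \<exists>i\<in>I. x i = \<infinity>} \<subseteq> G L"
proof
  fix x assume "x \<in> {x \<in> orthant I. \<exists>i\<in>I. x i = \<infinity>}"
  then obtain i where i: "x \<in> orthant I" "i \<in> I" "x i = \<infinity>" by blast
  have "ennreal L < x i" unfolding i(3) by simp
  then show "x \<in> G L" using i(1,2) by (auto simp: exceedance_def)
qed

lemma R_event [measurable]: "{\<omega> \<in> space M. \<exists>i\<in>I. x < R i \<omega>} \<in> events"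
proof -
  have [measurable]: "R i \<in> borel_measurable M" if "i \<in> I" for i using R_measurable that .
  show ?thesis using finite_I by measurable
qed

lemma F_exceeds: "prob (exceeds t id (\<lambda>_. L) I) = F (a t * L)"
  by (simp add: exceeds_def)

text \<open>The radial power law concerns an arbitrary norm, whereas exceedance sets concern coordinates.
  A vector of large norm has a large coordinate, which suffices for a lower bound.\<close>

lemma limit_tail_lower:
  obtains \<kappa> where "0 < \<kappa>" "\<And>L. 0 < L \<Longrightarrow> \<kappa> * L powr (- \<alpha>) \<le> measure \<nu> (G L)"
proof -
  obtain C where C: "0 < C" "\<And>x b. x \<in> I \<rightarrow>\<^sub>E UNIV \<Longrightarrow> (\<And>i. i \<in> I \<Longrightarrow> \<bar>x i\<bar> \<le> b) \<Longrightarrow> 0 \<le> b \<Longrightarrow> nrm x \<le> C * b"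
    using norm_on_le_sup[OF finite_I nrm] by blast
  show thesis
  proof (rule that[of "c * (2 * C) powr (- \<alpha>)"])
    show "0 < c * (2 * C) powr (- \<alpha>)" using c C(1) by simp
    fix L :: real assume L: "0 < L"
    let ?S = "{x \<in> space \<nu>. (\<forall>i\<in>I. x i < \<infinity>) \<and> 2 * C * L \<le> nrm (\<lambda>i\<in>I. enn2real (x i))}"
    have "?S \<subseteq> G L"
    proof
      fix x assume x: "x \<in> ?S"
      show "x \<in> G L"
      proof (rule ccontr)
        assume "x \<notin> G L"
        then have le: "x i \<le> ennreal L" if "i \<in> I" for i
          using x that by (auto simp: exceedance_def space_\<nu> not_less)
        have "nrm (\<lambda>i\<in>I. enn2real (x i)) \<le> C * L"
        proof (rule C(2))
          fix i assume i: "i \<in> I"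
          have "enn2real (x i) \<le> enn2real (ennreal L)" using le[OF i] by (intro enn2real_mono) auto
          then show "\<bar>(\<lambda>i\<in>I. enn2real (x i)) i\<bar> \<le> L" using i L by simp
        qed (use L in auto)
        moreover have "2 * C * L \<le> nrm (\<lambda>i\<in>I. enn2real (x i))" using x by blast
        moreover have "0 < C * L" using C(1) L by simp
        ultimately show False by linarith
      qed
    qed
    then have "emeasure \<nu> ?S \<le> emeasure \<nu> (G L)" using finite_I by (intro emeasure_mono) auto
    moreover have "emeasure \<nu> ?S = ennreal (c * (2 * C * L) powr (- \<alpha>))"
      using radial[of "2 * C * L"] C(1) L by simp
    moreover have "emeasure \<nu> (G L) = ennreal (measure \<nu> (G L))"
    proof -
      have "emeasure \<nu> (G L) < \<infinity>" using finite_I L by (intro exceedance_finite) auto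
      then show ?thesis by (intro emeasure_eq_ennreal_measure) auto
    qed
    ultimately have "c * (2 * C * L) powr (- \<alpha>) \<le> measure \<nu> (G L)"
      by (simp add: ennreal_le_iff)
    then show "c * (2 * C) powr (- \<alpha>) * L powr (- \<alpha>) \<le> measure \<nu> (G L)"
      using C(1) L by (simp add: powr_mult mult.assoc)
  qed
qed

lemma tail_lower:
  obtains \<kappa> where "0 < \<kappa>" "\<And>L. 0 < L \<Longrightarrow> \<forall>\<^sub>F t in at_top. \<kappa> * L powr (- \<alpha>) \<le> t * F (a t * L)"
proof -
  obtain k where k: "0 < k" "\<And>L. 0 < L \<Longrightarrow> k * L powr (- \<alpha>) \<le> measure \<nu> (G L)"
    using limit_tail_lower by blast
  show thesis
  proof (rule that[of "k * 2 powr (- \<alpha>) / 2"])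
    show "0 < k * 2 powr (- \<alpha>) / 2" using k(1) by simp
    fix L :: real assume L: "0 < L"
    define e where "e = k * 2 powr (- \<alpha>) / 2 * L powr (- \<alpha>)"
    have e: "0 < e" using k(1) L by (simp add: e_def)
    have "\<forall>\<^sub>F t in at_top. measure \<nu> (exceedance I id (\<lambda>j. L + L) I) - e \<le> t * prob (exceeds t id (\<lambda>_. L) I)"
      using finite_I L e by (intro tail_sandwich(2)) auto
    then show "\<forall>\<^sub>F t in at_top. k * 2 powr (- \<alpha>) / 2 * L powr (- \<alpha>) \<le> t * F (a t * L)"
    proof eventually_elim
      case (elim t)
      have "2 * e = k * (L + L) powr (- \<alpha>)" using L by (simp add: e_def powr_mult flip: mult_2)
      also have "\<dots> \<le> measure \<nu> (G (L + L))" using k(2)[of "L + L"] L by simp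
      finally show ?case using elim unfolding F_exceeds e_def by linarith
    qed
  qed
qed

lemma tail_upper:
  obtains B where "0 < B" "\<forall>\<^sub>F t in at_top. t * F (a t) \<le> B"
proof -
  have "\<forall>\<^sub>F t in at_top. t * prob (exceeds t id (\<lambda>j. 1/2 + 1/2) I) \<le> measure \<nu> (G (1/2)) + 1"
    using finite_I by (intro tail_sandwich(1)) auto
  then show thesis by (intro that[of "measure \<nu> (G (1/2)) + 1"]) (auto simp: F_exceeds add_nonneg_pos)
qed

lemma F_tendsto_0: "(F \<longlongrightarrow> 0) at_top"
proof -
  have mono: "F y \<le> F x" if "x \<le> y" for x y
    using that by (intro finite_measure_mono R_event) (auto intro: le_less_trans)
  have "(\<lambda>n. F (real n)) \<longlonglongrightarrow> prob (\<Inter>n. {\<omega> \<in> space M. \<exists>i\<in>I. real n < R i \<omega>})"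
  proof (rule finite_Lim_measure_decseq)
    show "decseq (\<lambda>n. {\<omega> \<in> space M. \<exists>i\<in>I. real n < R i \<omega>})"
    proof (rule decseq_SucI, rule subsetI)
      fix n \<omega> assume "\<omega> \<in> {\<omega> \<in> space M. \<exists>i\<in>I. real (Suc n) < R i \<omega>}"
      then obtain i where "\<omega> \<in> space M" "i \<in> I" "real (Suc n) < R i \<omega>" by blast
      moreover from this have "real n < R i \<omega>" by simp
      ultimately show "\<omega> \<in> {\<omega> \<in> space M. \<exists>i\<in>I. real n < R i \<omega>}" by blast
    qed
  qed auto
  also have "(\<Inter>n. {\<omega> \<in> space M. \<exists>i\<in>I. real n < R i \<omega>}) = {}"
  proof (rule ccontr)
    assume "(\<Inter>n. {\<omega> \<in> space M. \<exists>i\<in>I. real n < R i \<omega>}) \<noteq> {}"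
    then obtain \<omega> where \<omega>: "\<And>n. \<exists>i\<in>I. real n < R i \<omega>" by auto
    obtain n where n: "(\<Sum>i\<in>I. R i \<omega>) \<le> real n" using real_arch_simple by blast
    obtain i where i: "i \<in> I" "real n < R i \<omega>" using \<omega> by blast
    have "R i \<omega> \<le> (\<Sum>i\<in>I. R i \<omega>)" using finite_I i(1) R_nonneg by (intro member_le_sum) auto
    then show False using n i(2) by linarith
  qed
  finally have lim: "(\<lambda>n. F (real n)) \<longlonglongrightarrow> 0" by simp
  show ?thesis
  proof (rule order_tendstoI)
    fix e :: real assume "0 < e"
    then have "\<forall>\<^sub>F n in sequentially. F (real n) < e" using order_tendstoD(2)[OF lim] by blast
    then obtain n where n: "F (real n) < e" by (auto simp: eventually_sequentially)
    show "\<forall>\<^sub>F x in at_top. F x < e"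
      using eventually_ge_at_top[of "real n"] by eventually_elim (use mono n in \<open>force intro: le_less_trans\<close>)
  next
    fix e :: real assume "e < 0"
    then show "\<forall>\<^sub>F x in at_top. e < F x" by (intro always_eventually allI) (simp add: less_le_trans)
  qed
qed

text \<open>Holds for the tail of the largest coordinate, which inherits a lower bound of index \<open>\<alpha>\<close> from
  the radial law and an upper bound from the finiteness of \<open>\<nu>\<close> away from the origin.\<close>

lemma normalisation_superlinear: "filterlim (\<lambda>t. a t / t) at_top at_top"
proof -
  obtain \<kappa> where \<kappa>: "0 < \<kappa>" "\<And>L. 0 < L \<Longrightarrow> \<forall>\<^sub>F t in at_top. \<kappa> * L powr (- \<alpha>) \<le> t * F (a t * L)"
    using tail_lower by blast
  obtain B where B: "0 < B" "\<forall>\<^sub>F t in at_top. t * F (a t) \<le> B" using tail_upper by blast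
  show ?thesis
  proof (rule ratio_at_top_of_heavy_tail[OF _ _ F_tendsto_0 a_pos B \<kappa>(1) _ \<alpha>(2)])
    show "F y \<le> F x" if "x \<le> y" for x y
      using that by (intro finite_measure_mono R_event) (auto intro: le_less_trans)
    show "\<forall>\<^sub>F t in at_top. \<kappa> * L powr (- \<alpha>) \<le> t * F (a t * L)" if "1 \<le> L" for L
      using \<kappa>(2)[of L] that by simp
  qed auto
qed

text \<open>Let \<open>m\<close> be the mass of points with an infinite coordinate and suppose \<open>m > 0\<close>.  Then
  \<open>t * F (L * a t)\<close> stays above \<open>m / 2\<close> for every fixed \<open>L\<close>, while \<open>t * F (a (l * t))\<close> is at most
  \<open>B / l\<close>, so a large \<open>l\<close> makes \<open>a (l * t)\<close> exceed every multiple of \<open>a t\<close>.  But for the same \<open>l\<close> the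
  lower bound \<open>\<kappa> * r powr (- \<alpha>)\<close> at a small level \<open>r\<close> beats \<open>l * B\<close> and gives \<open>r * a (l * t) < a t\<close>.\<close>

lemma no_mass_at_infinity: "emeasure \<nu> {x \<in> orthant I. \<exists>i\<in>I. x i = \<infinity>} = 0"
proof (rule ccontr)
  let ?S = "{x \<in> orthant I. \<exists>i\<in>I. x i = \<infinity>}"
  define m where "m = measure \<nu> ?S"
  assume nz: "emeasure \<nu> ?S \<noteq> 0"
  have sub: "?S \<subseteq> G L" for L by (rule infinite_subset_G)
  have fin: "emeasure \<nu> (G L) < \<infinity>" if "0 < L" for L
    using finite_I that by (intro exceedance_finite) auto
  have "emeasure \<nu> ?S \<le> emeasure \<nu> (G 1)" using sub finite_I by (intro emeasure_mono) auto
  then have "emeasure \<nu> ?S < \<infinity>" using fin[of 1] by (auto intro: le_less_trans)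
  then have "emeasure \<nu> ?S = ennreal m" unfolding m_def by (intro emeasure_eq_ennreal_measure) auto
  then have m: "0 < m" using nz by (simp add: ennreal_eq_0_iff not_le)
  have S: "?S \<in> sets \<nu>" using nz emeasure_notin_sets by blast
  have m_le: "m \<le> measure \<nu> (G L)" if "0 < L" for L
    unfolding m_def using sub S finite_I fin[OF that]
    by (auto simp: fmeasurable_def intro!: measure_mono_fmeasurable)
  have tail_m: "\<forall>\<^sub>F t in at_top. m / 2 \<le> t * F (a t * L)" if L: "0 < L" for L
  proof -
    have "\<forall>\<^sub>F t in at_top. measure \<nu> (exceedance I id (\<lambda>j. L + 1) I) - m / 2 \<le> t * prob (exceeds t id (\<lambda>_. L) I)"
      using finite_I L m by (intro tail_sandwich(2)) auto
    then show ?thesis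
    proof eventually_elim
      case (elim t)
      then show ?case using m_le[of "L + 1"] L unfolding F_exceeds by linarith
    qed
  qed
  obtain \<kappa> where \<kappa>: "0 < \<kappa>" "\<And>L. 0 < L \<Longrightarrow> \<forall>\<^sub>F t in at_top. \<kappa> * L powr (- \<alpha>) \<le> t * F (a t * L)"
    using tail_lower by blast
  obtain B where B: "0 < B" "\<forall>\<^sub>F t in at_top. t * F (a t) \<le> B" using tail_upper by blast
  have F_mono: "F y \<le> F x" if "x \<le> y" for x y
    using that by (intro finite_measure_mono R_event) (auto intro: le_less_trans)
  \<comment> \<open>\<open>B / l = m / 4 < m / 2\<close>, and \<open>r\<close> solves \<open>\<kappa> * r powr (- \<alpha>) = 2 * l * B\<close>\<close>
  define l where "l = 4 * B / m"
  have l: "0 < l" "l * (m / 2) = 2 * B" using B(1) m by (auto simp: l_def)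
  define r where "r = (2 * l * B / \<kappa>) powr (- 1 / \<alpha>)"
  have r: "0 < r" using l(1) B(1) \<kappa>(1) by (simp add: r_def)
  have "r powr (- \<alpha>) = 2 * l * B / \<kappa>" using \<alpha>(1) l(1) B(1) \<kappa>(1) by (simp add: r_def powr_powr)
  then have rk: "\<kappa> * r powr (- \<alpha>) = 2 * l * B" using \<kappa>(1) by simp
  have scale: "\<forall>\<^sub>F t in at_top. P (l * t)" if "\<forall>\<^sub>F t in at_top. P t" for P :: "real \<Rightarrow> bool"
    using that filterlim_tendsto_pos_mult_at_top[OF tendsto_const l(1) filterlim_ident]
    by (rule eventually_compose_filterlim)
  have r': "0 < 1 / r" using r by simp
  have "\<forall>\<^sub>F t in at_top. 0 < t \<and> t * F (a t) \<le> B \<and> l * t * F (a (l * t)) \<le> B \<and>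
      \<kappa> * r powr (- \<alpha>) \<le> l * t * F (a (l * t) * r) \<and> m / 2 \<le> t * F (a t * (1 / r))"
    by (intro eventually_conj eventually_gt_at_top B(2) scale[OF B(2)] scale[OF \<kappa>(2)[OF r]] tail_m[OF r'])
  then obtain t where t: "0 < t" "t * F (a t) \<le> B" "l * t * F (a (l * t)) \<le> B"
      "\<kappa> * r powr (- \<alpha>) \<le> l * t * F (a (l * t) * r)" "m / 2 \<le> t * F (a t * (1 / r))"
    using eventually_happens'[OF trivial_limit_at_top_linorder] by blast
  have lt: "0 < l * t" using l t by simp
  have "l * t * F (a t) \<le> l * B" using t(2) l(1) by (simp add: mult.assoc)
  also have "\<dots> < l * t * F (a (l * t) * r)" using t(4) rk l(1) B(1) by (simp add: mult.assoc)
  finally have "F (a t) < F (a (l * t) * r)" using lt by (simp add: mult_less_cancel_left_pos)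
  then have 1: "a (l * t) * r < a t" using F_mono[of "a t" "a (l * t) * r"] by linarith
  have "l * t * F (a (l * t)) < 2 * B" using t(3) B(1) by linarith
  also have "2 * B = l * (m / 2)" using l(2) by simp
  also have "\<dots> \<le> l * (t * F (a t * (1 / r)))" using t(5) l(1) by (intro mult_left_mono) auto
  also have "\<dots> = l * t * F (a t * (1 / r))" by (simp only: mult.assoc)
  finally have "F (a (l * t)) < F (a t * (1 / r))" using lt by (simp add: mult_less_cancel_left_pos)
  then have "a t * (1 / r) < a (l * t)" using F_mono[of "a (l * t)" "a t * (1 / r)"] by linarith
  then have "a t < a (l * t) * r" using r by (simp add: field_simps)
  then show False using 1 by linarith
qed

lemma limit_tail_tendsto_0:
  assumes e: "0 < e"
  obtains L where "0 < L" "measure \<nu> (G L) < e"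
proof -
  let ?S = "{x \<in> orthant I. \<exists>i\<in>I. x i = \<infinity>}"
  have fin: "emeasure \<nu> (G (real (Suc n))) < \<infinity>" for n
    using finite_I by (intro exceedance_finite) auto
  have "(\<lambda>n. measure \<nu> (G (real (Suc n)))) \<longlonglongrightarrow> measure \<nu> (\<Inter>n. G (real (Suc n)))"
  proof (rule Lim_measure_decseq)
    show "range (\<lambda>n. G (real (Suc n))) \<subseteq> sets \<nu>" using finite_I by auto
    show "decseq (\<lambda>n. G (real (Suc n)))"
    proof (rule decseq_SucI, rule subsetI)
      fix n x assume x: "x \<in> G (real (Suc (Suc n)))"
      then obtain i where i: "x \<in> orthant I" "i \<in> I" "ennreal (real (Suc (Suc n))) < x i"
        by (auto simp: exceedance_def simp del: of_nat_Suc)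
      have "ennreal (real (Suc n)) \<le> ennreal (real (Suc (Suc n)))" by (intro ennreal_leI) simp
      then have "ennreal (real (Suc n)) < x i" using i(3) by (rule le_less_trans)
      then show "x \<in> G (real (Suc n))" using i(1,2) unfolding exceedance_def by (auto simp del: of_nat_Suc)
    qed
    show "emeasure \<nu> (G (real (Suc n))) \<noteq> \<infinity>" for n using fin[of n] by simp
  qed
  also have "(\<Inter>n. G (real (Suc n))) = ?S"
  proof (intro equalityI subsetI)
    fix x assume x: "x \<in> (\<Inter>n. G (real (Suc n)))"
    have "\<exists>i\<in>I. x i = \<infinity>"
    proof (rule ccontr)
      assume "\<not> (\<exists>i\<in>I. x i = \<infinity>)"
      then have fin_x: "x i = ennreal (enn2real (x i))" if "i \<in> I" for i
        using that by (simp add: less_top)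
      obtain n where n: "(\<Sum>i\<in>I. enn2real (x i)) \<le> real n" using real_arch_simple by blast
      have "x \<in> G (real (Suc n))" using x by blast
      then obtain i where i: "i \<in> I" "ennreal (real (Suc n)) < x i" by (auto simp: exceedance_def)
      have "real (Suc n) < enn2real (x i)"
        using i(2) fin_x[OF i(1)] by (metis ennreal_less_iff of_nat_0_le_iff)
      moreover have "enn2real (x i) \<le> (\<Sum>i\<in>I. enn2real (x i))"
        using finite_I i(1) by (intro member_le_sum) auto
      ultimately show False using n by simp
    qed
    then show "x \<in> ?S" using x by (auto simp: exceedance_def)
  next
    fix x assume "x \<in> ?S"
    then show "x \<in> (\<Inter>n. G (real (Suc n)))" using infinite_subset_G by blast
  qed
  also have "measure \<nu> ?S = 0" using no_mass_at_infinity by (simp add: measure_def)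
  finally have "\<forall>\<^sub>F n in sequentially. measure \<nu> (G (real (Suc n))) < e"
    using e by (rule order_tendstoD(2))
  then obtain n where "measure \<nu> (G (real (Suc n))) < e" by (auto simp: eventually_sequentially)
  then show thesis by (intro that[of "real (Suc n)"]) auto
qed

end

section \<open>Distribution functions of partial maxima\<close>

text \<open>The length of the set of times at which exactly the indices in \<open>V\<close> are active, where \<open>j\<close> is
  active up to time \<open>u j\<close>.  Active sets shrink as time passes, so this set of times is an interval.\<close>

definition window :: "('j \<Rightarrow> real) \<Rightarrow> 'j set \<Rightarrow> 'j set \<Rightarrow> real" where
  "window u J V = max 0 (Min (u ` V) - Max (insert 0 (u ` (J - V))))"

lemma window_nonneg: "0 \<le> window u J V"
  by (simp add: window_def)

lemma emeasure_window:
  assumes J: "finite J" and V: "V \<subseteq> J" "V \<noteq> {}"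
  shows "{s. 0 \<le> s \<and> {j\<in>J. s \<le> u j} = V} \<in> sets lborel"
    "emeasure lborel {s. 0 \<le> s \<and> {j\<in>J. s \<le> u j} = V} = ennreal (window u J V)"
proof -
  define l where "l = Max (insert 0 (u ` (J - V)))"
  define r where "r = Min (u ` V)"
  let ?S = "{s. 0 \<le> s \<and> {j\<in>J. s \<le> u j} = V}"
  have fin: "finite V" "finite (J - V)" using J V finite_subset by auto
  have S: "?S = {s. 0 \<le> s} \<inter> (\<Inter>j\<in>V. {s. s \<le> u j}) \<inter> (\<Inter>j\<in>J - V. {s. u j < s})"
  proof -
    have "{j\<in>J. s \<le> u j} = V \<longleftrightarrow> (\<forall>j\<in>V. s \<le> u j) \<and> (\<forall>j\<in>J - V. u j < s)" for s
      unfolding not_le[symmetric] using V(1) by blast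
    then show ?thesis by auto
  qed
  show sets: "?S \<in> sets lborel"
  proof -
    have "(\<Inter>j\<in>J - V. {s. u j < s}) \<in> sets borel"
    proof (cases "J - V = {}")
      case False
      then show ?thesis using fin(2) by (intro sets.finite_INT) auto
    qed (simp only: INT_empty, simp)
    moreover have "(\<Inter>j\<in>V. {s. s \<le> u j}) \<in> sets borel"
      using fin V by (intro sets.finite_INT) auto
    ultimately show ?thesis unfolding S by auto
  qed
  have le_r: "s \<le> r \<longleftrightarrow> (\<forall>j\<in>V. s \<le> u j)" for s
    unfolding r_def using fin V by (subst Min_ge_iff) auto
  have l_less: "l < s \<longleftrightarrow> 0 < s \<and> (\<forall>j\<in>J - V. u j < s)" for s
    unfolding l_def using fin by (subst Max_less_iff) auto
  have l_le: "l \<le> s \<longleftrightarrow> 0 \<le> s \<and> (\<forall>j\<in>J - V. u j \<le> s)" for s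
    unfolding l_def using fin by (subst Max_le_iff) auto
  have 1: "{l<..r} \<subseteq> ?S" unfolding S using le_r l_less by (auto intro: less_imp_le)
  have 2: "?S \<subseteq> {l..r}" unfolding S using le_r l_le by (auto simp: less_imp_le)
  have w: "window u J V = max 0 (r - l)" by (simp add: window_def l_def r_def)
  show "emeasure lborel ?S = ennreal (window u J V)"
  proof (cases "l \<le> r")
    case True
    have "emeasure lborel {l<..r} \<le> emeasure lborel ?S" using 1 sets by (intro emeasure_mono)
    moreover have "emeasure lborel ?S \<le> emeasure lborel {l..r}" using 2 by (intro emeasure_mono) auto
    ultimately show ?thesis using True by (simp add: w)
  next
    case False
    then have E: "?S = {}" using 2 by auto
    show ?thesis unfolding E w using False by simp
  qed
qed

lemma tendsto_nat_floor_over: "((\<lambda>t. real (nat \<lfloor>t * x\<rfloor>) / t) \<longlongrightarrow> x) at_top" if "0 \<le> x"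
proof (rule tendsto_sandwich)
  show "((\<lambda>t. x - 1 / t) \<longlongrightarrow> x) at_top"
  proof -
    have "((\<lambda>t::real. 1 / t) \<longlongrightarrow> 0) at_top"
      by (intro tendsto_divide_0[OF tendsto_const] filterlim_at_top_imp_at_infinity filterlim_ident)
    from tendsto_diff[OF tendsto_const[of x] this] show ?thesis by simp
  qed
  show "((\<lambda>t. x) \<longlongrightarrow> x) at_top" by simp
  show "\<forall>\<^sub>F t in at_top. x - 1 / t \<le> real (nat \<lfloor>t * x\<rfloor>) / t"
    using eventually_gt_at_top[of 0]
  proof eventually_elim
    case (elim t)
    have "t * x - 1 \<le> real (nat \<lfloor>t * x\<rfloor>)" by linarith
    then have "(t * x - 1) / t \<le> real (nat \<lfloor>t * x\<rfloor>) / t" using elim by (intro divide_right_mono) auto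
    then show ?case using elim by (simp add: diff_divide_distrib)
  qed
  show "\<forall>\<^sub>F t in at_top. real (nat \<lfloor>t * x\<rfloor>) / t \<le> x"
    using eventually_gt_at_top[of 0]
  proof eventually_elim
    case (elim t)
    have "0 \<le> t * x" using elim that by simp
    then have "real (nat \<lfloor>t * x\<rfloor>) \<le> t * x" by linarith
    then show ?case using elim by (simp add: field_simps)
  qed
qed

text \<open>The discrete counterpart of \<open>emeasure_window\<close>: among the integers up to \<open>n t\<close>, those with active
  set \<open>V\<close> form an interval between two rounded multiples of \<open>t\<close>.\<close>

lemma card_window_tendsto:
  assumes J: "finite J" and V: "V \<subseteq> J" "V \<noteq> {}" and u: "\<And>j. j \<in> J \<Longrightarrow> 0 \<le> u j"
    and n: "\<And>t j. j \<in> J \<Longrightarrow> nat \<lfloor>t * u j\<rfloor> \<le> n t"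
  shows "((\<lambda>t. real (card {k \<in> {1..n t}. {j\<in>J. k \<le> nat \<lfloor>t * u j\<rfloor>} = V}) / t) \<longlongrightarrow> window u J V) at_top"
proof -
  define l where "l = Max (insert 0 (u ` (J - V)))"
  define r where "r = Min (u ` V)"
  have fin: "finite V" "finite (J - V)" using J V finite_subset by auto
  have l_in: "l = 0 \<or> l \<in> u ` (J - V)" using Max_in[of "insert 0 (u ` (J - V))"] fin by (auto simp: l_def)
  have l0: "0 \<le> l" using fin by (auto simp: l_def)
  have l_ge: "u j \<le> l" if "j \<in> J - V" for j using fin that by (auto simp: l_def)
  have r_in: "r \<in> u ` V" unfolding r_def using fin V by (intro Min_in) auto
  have r_le: "r \<le> u j" if "j \<in> V" for j using fin that by (auto simp: r_def)
  have r0: "0 \<le> r" using r_in u V by auto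
  have "((\<lambda>t. max 0 (real (nat \<lfloor>t * r\<rfloor>) / t - real (nat \<lfloor>t * l\<rfloor>) / t)) \<longlongrightarrow> max 0 (r - l)) at_top"
    by (intro tendsto_max tendsto_const tendsto_diff tendsto_nat_floor_over r0 l0)
  moreover have "\<forall>\<^sub>F t in at_top. max 0 (real (nat \<lfloor>t * r\<rfloor>) / t - real (nat \<lfloor>t * l\<rfloor>) / t)
      = real (card {k \<in> {1..n t}. {j\<in>J. k \<le> nat \<lfloor>t * u j\<rfloor>} = V}) / t"
    using eventually_gt_at_top[of 0]
  proof eventually_elim
    case (elim t)
    have mono: "nat \<lfloor>t * x\<rfloor> \<le> nat \<lfloor>t * y\<rfloor>" if "x \<le> y" for x y
      using that elim by (intro nat_mono floor_mono mult_left_mono) auto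
    have "{k \<in> {1..n t}. {j\<in>J. k \<le> nat \<lfloor>t * u j\<rfloor>} = V} = {nat \<lfloor>t * l\<rfloor> <.. nat \<lfloor>t * r\<rfloor>}"
    proof (intro equalityI subsetI)
      fix k assume k: "k \<in> {k \<in> {1..n t}. {j\<in>J. k \<le> nat \<lfloor>t * u j\<rfloor>} = V}"
      have "k \<le> nat \<lfloor>t * r\<rfloor>" using k r_in by auto
      moreover have "nat \<lfloor>t * l\<rfloor> < k"
      proof (cases "l = 0")
        case False
        then obtain j where "j \<in> J - V" "l = u j" using l_in by auto
        then show ?thesis using k by auto
      qed (use k in auto)
      ultimately show "k \<in> {nat \<lfloor>t * l\<rfloor> <.. nat \<lfloor>t * r\<rfloor>}" by simp
    next
      fix k assume k: "k \<in> {nat \<lfloor>t * l\<rfloor> <.. nat \<lfloor>t * r\<rfloor>}"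
      have kV: "k \<le> nat \<lfloor>t * u j\<rfloor>" if "j \<in> V" for j
        using mono[OF r_le[OF that]] k by simp
      have kJ: "\<not> k \<le> nat \<lfloor>t * u j\<rfloor>" if "j \<in> J - V" for j
        using mono[OF l_ge[OF that]] k by simp
      have "{j\<in>J. k \<le> nat \<lfloor>t * u j\<rfloor>} = V" using kV kJ V(1) by blast
      moreover have "k \<le> n t"
      proof -
        obtain j where j: "j \<in> V" using V(2) by blast
        then show ?thesis using kV[OF j] n[of j t] V(1) by (meson order_trans subsetD)
      qed
      ultimately show "k \<in> {k \<in> {1..n t}. {j\<in>J. k \<le> nat \<lfloor>t * u j\<rfloor>} = V}" using k by auto
    qed
    then have "real (card {k \<in> {1..n t}. {j\<in>J. k \<le> nat \<lfloor>t * u j\<rfloor>} = V})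
        = max 0 (real (nat \<lfloor>t * r\<rfloor>) - real (nat \<lfloor>t * l\<rfloor>))"
      by (simp add: max_def of_nat_diff)
    then show ?case using elim by (simp add: max_def field_simps)
  qed
  ultimately show ?thesis
    unfolding window_def l_def[symmetric] r_def[symmetric] by (rule Lim_transform_eventually)
qed

lemma eventually_weighted_sum_le:
  fixes w g :: "'v \<Rightarrow> 't \<Rightarrow> real"
  assumes "finite K"
    and w: "\<And>k. k \<in> K \<Longrightarrow> (w k \<longlongrightarrow> l k) F" and l: "\<And>k. k \<in> K \<Longrightarrow> 0 \<le> l k"
    and w0: "\<forall>\<^sub>F t in F. \<forall>k\<in>K. 0 \<le> w k t"
    and g: "\<And>k e. k \<in> K \<Longrightarrow> 0 < e \<Longrightarrow> \<forall>\<^sub>F t in F. g k t \<le> b k + e" and e: "0 < e"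
  shows "\<forall>\<^sub>F t in F. (\<Sum>k\<in>K. w k t * g k t) \<le> (\<Sum>k\<in>K. l k * b k) + e"
proof -
  define e' where "e' = e / (1 + (\<Sum>k\<in>K. l k))"
  have pos: "0 < 1 + (\<Sum>k\<in>K. l k)" using l by (intro add_pos_nonneg sum_nonneg) auto
  have e': "0 < e'" using e pos by (simp add: e'_def)
  have "((\<lambda>t. \<Sum>k\<in>K. w k t * (b k + e')) \<longlongrightarrow> (\<Sum>k\<in>K. l k * (b k + e'))) F"
    by (rule tendsto_sum, rule tendsto_mult_right, rule w)
  moreover have "(\<Sum>k\<in>K. l k * (b k + e')) < (\<Sum>k\<in>K. l k * b k) + e"
  proof -
    have "(\<Sum>k\<in>K. l k * (b k + e')) = (\<Sum>k\<in>K. l k * b k) + (\<Sum>k\<in>K. l k) * e'"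
      by (simp add: distrib_left sum.distrib sum_distrib_right)
    moreover have "(1 + (\<Sum>k\<in>K. l k)) * e' = e" using pos by (simp add: e'_def)
    ultimately show ?thesis using e' by (simp add: algebra_simps)
  qed
  ultimately have "\<forall>\<^sub>F t in F. (\<Sum>k\<in>K. w k t * (b k + e')) < (\<Sum>k\<in>K. l k * b k) + e"
    by (rule order_tendstoD(2))
  moreover have "\<forall>\<^sub>F t in F. \<forall>k\<in>K. g k t \<le> b k + e'"
    using assms(1) g e' by (intro eventually_ball_finite) auto
  ultimately show ?thesis using w0
  proof eventually_elim
    case (elim t)
    have "(\<Sum>k\<in>K. w k t * g k t) \<le> (\<Sum>k\<in>K. w k t * (b k + e'))"
      using elim(2,3) by (intro sum_mono mult_left_mono) auto
    then show ?case using elim(1) by linarith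
  qed
qed

text \<open>Uses \<open>ln (1 - q) \<ge> - q - 2 * q\<^sup>2\<close>; the quadratic term is absorbed by the uniform bound \<open>h\<close> on
  the factors, which may be chosen small since single exceedances are rare.\<close>

lemma exp_le_prod_one_minus:
  fixes q :: "'k \<Rightarrow> real"
  assumes K: "finite K" and q: "\<And>k. k \<in> K \<Longrightarrow> 0 \<le> q k" "\<And>k. k \<in> K \<Longrightarrow> q k \<le> h" and h: "h \<le> 1 / 2"
  shows "exp (- ((1 + 2 * h) * (\<Sum>k\<in>K. q k))) \<le> (\<Prod>k\<in>K. 1 - q k)"
proof -
  have "exp (- ((1 + 2 * h) * (\<Sum>k\<in>K. q k))) = (\<Prod>k\<in>K. exp (- ((1 + 2 * h) * q k)))"
    using K by (simp add: exp_sum sum_distrib_left flip: sum_negf)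
  also have "\<dots> \<le> (\<Prod>k\<in>K. 1 - q k)"
  proof (intro prod_mono conjI)
    fix k assume k: "k \<in> K"
    have "q k * q k \<le> h * q k" using q[OF k] by (intro mult_right_mono) auto
    then have "- ((1 + 2 * h) * q k) \<le> - q k - 2 * (q k)\<^sup>2" by (simp add: power2_eq_square algebra_simps)
    also have "\<dots> \<le> ln (1 - q k)" using q[OF k] h by (intro ln_one_minus_pos_lower_bound) auto
    finally have "exp (- ((1 + 2 * h) * q k)) \<le> exp (ln (1 - q k))" by simp
    also have "\<dots> = 1 - q k" using q(2)[OF k] h by simp
    finally show "exp (- ((1 + 2 * h) * q k)) \<le> 1 - q k" .
  qed simp
  finally show ?thesis .
qed

lemma prod_one_minus_le_exp:
  fixes q :: "'k \<Rightarrow> real"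
  assumes K: "finite K" and q: "\<And>k. k \<in> K \<Longrightarrow> q k \<le> 1"
  shows "(\<Prod>k\<in>K. 1 - q k) \<le> exp (- (\<Sum>k\<in>K. q k))"
proof -
  have "(\<Prod>k\<in>K. 1 - q k) \<le> (\<Prod>k\<in>K. exp (- q k))"
  proof (intro prod_mono conjI)
    fix k assume k: "k \<in> K"
    show "0 \<le> 1 - q k" using q[OF k] by simp
    show "1 - q k \<le> exp (- q k)" using exp_ge_add_one_self[of "- q k"] by simp
  qed
  also have "\<dots> = exp (- (\<Sum>k\<in>K. q k))" using K by (simp add: exp_sum flip: sum_negf)
  finally show ?thesis .
qed

context vague_tail
begin

text \<open>The mean number of points of a Poisson process with intensity \<open>Leb \<Otimes> \<nu>\<close> that fall, for some \<open>j\<close>,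
  before time \<open>u j\<close> and above level \<open>y j\<close> in coordinate \<open>\<pi> j\<close>.  The empty set of active
  indices imposes no condition and is left out.\<close>

definition \<Lambda> :: "('j \<Rightarrow> real) \<Rightarrow> ('j \<Rightarrow> 'i) \<Rightarrow> 'j set \<Rightarrow> ('j \<Rightarrow> real) \<Rightarrow> real" where
  "\<Lambda> u \<pi> J y = (\<Sum>V\<in>Pow J - {{}}. window u J V * measure \<nu> (exceedance I \<pi> y V))"

lemma \<Lambda>_nonneg: "0 \<le> \<Lambda> u \<pi> J y"
  unfolding \<Lambda>_def by (intro sum_nonneg mult_nonneg_nonneg window_nonneg) auto

text \<open>After grouping the factors by active sets, the exponent of the product is a finite sum of terms
  \<open>(N V t / t) * (t * q V t)\<close>, where \<open>N V t\<close> counts the factors with active set \<open>V\<close> and \<open>q V t\<close> is the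
  probability of an exceedance; the first factor tends to \<open>window V\<close> and the second one is
  controlled by \<open>tail_sandwich\<close>.\<close>

lemma prod_not_exceeds_bounds:
  fixes J :: "'j set" and u :: "'j \<Rightarrow> real" and n :: "real \<Rightarrow> nat"
  assumes J: "finite J" "\<pi> ` J \<subseteq> I" and u: "\<And>j. j \<in> J \<Longrightarrow> 0 \<le> u j"
    and n: "\<And>t j. j \<in> J \<Longrightarrow> nat \<lfloor>t * u j\<rfloor> \<le> n t"
    and y: "\<And>j. j \<in> J \<Longrightarrow> 0 < y j" and d: "0 < d" and e: "0 < e"
  defines "P \<equiv> \<lambda>t y. \<Prod>k\<in>{1..n t}. 1 - prob (exceeds t \<pi> y {j\<in>J. k \<le> nat \<lfloor>t * u j\<rfloor>})"
  shows "\<forall>\<^sub>F t in at_top. P t y \<le> exp (- \<Lambda> u \<pi> J (\<lambda>j. y j + d)) + e"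
    and "\<forall>\<^sub>F t in at_top. exp (- \<Lambda> u \<pi> J y) - e \<le> P t (\<lambda>j. y j + d)"
proof -
  define K where "K = Pow J - {{}}"
  define N where "N V t = real (card {k \<in> {1..n t}. {j\<in>J. k \<le> nat \<lfloor>t * u j\<rfloor>} = V})" for V t
  define q where "q y V t = prob (exceeds t \<pi> y V)" for y V t
  have K: "finite K" using J(1) by (simp add: K_def)
  have KD: "finite V" "V \<subseteq> J" "V \<noteq> {}" "\<pi> ` V \<subseteq> I" if "V \<in> K" for V
    using that J(2) finite_subset[OF _ J(1), of V] by (auto simp: K_def)
  have q_empty: "q y {} t = 0" for y t by (simp add: q_def exceeds_def)
  have group: "(\<Sum>k\<in>{1..n t}. q y {j\<in>J. k \<le> nat \<lfloor>t * u j\<rfloor>} t) = (\<Sum>V\<in>K. N V t / t * (t * q y V t))"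
    if "0 < t" for t and y :: "'j \<Rightarrow> real"
  proof -
    have "(\<Sum>k\<in>{1..n t}. q y {j\<in>J. k \<le> nat \<lfloor>t * u j\<rfloor>} t)
        = (\<Sum>V\<in>Pow J. \<Sum>k\<in>{k \<in> {1..n t}. {j\<in>J. k \<le> nat \<lfloor>t * u j\<rfloor>} = V}. q y {j\<in>J. k \<le> nat \<lfloor>t * u j\<rfloor>} t)"
      using J(1) by (intro sum.group[symmetric]) auto
    also have "\<dots> = (\<Sum>V\<in>Pow J. N V t * q y V t)"
      by (intro sum.cong refl) (simp add: N_def)
    also have "\<dots> = (\<Sum>V\<in>K. N V t * q y V t)"
      unfolding K_def using J(1) by (intro sum.mono_neutral_right) (auto simp: q_empty)
    finally show ?thesis using that by simp
  qed
  have N_lim: "((\<lambda>t. N V t / t) \<longlongrightarrow> window u J V) at_top" if "V \<in> K" for V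
    unfolding N_def using KD[OF that] by (intro card_window_tendsto J(1) u n)
  have N_nonneg: "\<forall>\<^sub>F t in at_top. \<forall>V\<in>K. 0 \<le> N V t / t"
    using eventually_gt_at_top[of 0] by eventually_elim (simp add: N_def)
  have q01: "0 \<le> q y V t" "q y V t \<le> 1" for y V t by (simp_all add: q_def)
  show "\<forall>\<^sub>F t in at_top. P t y \<le> exp (- \<Lambda> u \<pi> J (\<lambda>j. y j + d)) + e"
  proof -
    define L where "L = \<Lambda> u \<pi> J (\<lambda>j. y j + d)"
    have "((\<lambda>h. exp (- L + h)) \<longlongrightarrow> exp (- L + 0)) (at_right 0)"
      by (intro tendsto_intros)
    then have "\<forall>\<^sub>F h in at_right 0. exp (- L + h) < exp (- L) + e"
      by (rule order_tendstoD(2)) (use e in simp)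
    then obtain h where h: "0 < h" "exp (- L + h) < exp (- L) + e"
      using eventually_happens'[OF trivial_limit_at_right_real
          eventually_conj[OF eventually_at_right_less[of 0]]] by blast
    have "\<forall>\<^sub>F t in at_top. (\<Sum>V\<in>K. N V t / t * - (t * q y V t))
        \<le> (\<Sum>V\<in>K. window u J V * - measure \<nu> (exceedance I \<pi> (\<lambda>j. y j + d) V)) + h"
    proof (rule eventually_weighted_sum_le[OF K N_lim window_nonneg N_nonneg _ h(1)])
      fix V and e' :: real assume V: "V \<in> K" and e': "0 < e'"
      have "\<forall>\<^sub>F t in at_top. measure \<nu> (exceedance I \<pi> (\<lambda>j. y j + d) V) - e' \<le> t * prob (exceeds t \<pi> y V)"
        using KD[OF V] y d e' by (intro tail_sandwich(2)) auto
      then show "\<forall>\<^sub>F t in at_top. - (t * q y V t) \<le> - measure \<nu> (exceedance I \<pi> (\<lambda>j. y j + d) V) + e'"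
        by eventually_elim (simp add: q_def)
    qed
    then show ?thesis using eventually_gt_at_top[of 0]
    proof eventually_elim
      case (elim t)
      have "P t y \<le> exp (- (\<Sum>k\<in>{1..n t}. q y {j\<in>J. k \<le> nat \<lfloor>t * u j\<rfloor>} t))"
        unfolding P_def q_def by (intro prod_one_minus_le_exp) auto
      also have "\<dots> \<le> exp (- L + h)"
        using elim(1) unfolding group[OF elim(2)] by (simp add: sum_negf L_def \<Lambda>_def K_def)
      also have "\<dots> \<le> exp (- L) + e" using h(2) by simp
      finally show ?case by (simp add: L_def)
    qed
  qed
  show "\<forall>\<^sub>F t in at_top. exp (- \<Lambda> u \<pi> J y) - e \<le> P t (\<lambda>j. y j + d)"
  proof -
    define L where "L = \<Lambda> u \<pi> J y"
    have "((\<lambda>h. exp (- ((1 + 2 * h) * (L + h)))) \<longlongrightarrow> exp (- ((1 + 2 * 0) * (L + 0)))) (at_right 0)"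
      by (intro tendsto_intros)
    then have "\<forall>\<^sub>F h in at_right 0. exp (- L) - e < exp (- ((1 + 2 * h) * (L + h)))"
      by (intro order_tendstoD(1)) (use e in auto)
    moreover have "\<forall>\<^sub>F h in at_right 0. h < (1 / 2 :: real)"
      by (rule eventually_at_right_less[THEN eventually_mono, of 0, THEN eventually_rev_mp])
        (auto simp: eventually_at_right_field intro!: exI[of _ "1 / 2"])
    ultimately obtain h where h: "0 < h" "h < 1 / 2" "exp (- L) - e < exp (- ((1 + 2 * h) * (L + h)))"
      using eventually_happens'[OF trivial_limit_at_right_real
          eventually_conj[OF eventually_at_right_less[of 0] eventually_conj]] by blast
    have up: "\<forall>\<^sub>F t in at_top. t * q (\<lambda>j. y j + d) V t \<le> measure \<nu> (exceedance I \<pi> y V) + e'"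
      if "V \<in> K" "0 < e'" for V e'
      unfolding q_def using KD[OF that(1)] y d that(2) by (intro tail_sandwich(1)) auto
    have "\<forall>\<^sub>F t in at_top. (\<Sum>V\<in>K. N V t / t * (t * q (\<lambda>j. y j + d) V t))
        \<le> (\<Sum>V\<in>K. window u J V * measure \<nu> (exceedance I \<pi> y V)) + h"
      by (rule eventually_weighted_sum_le[OF K N_lim window_nonneg N_nonneg up h(1)])
    moreover have "\<forall>\<^sub>F t in at_top. \<forall>V\<in>K. q (\<lambda>j. y j + d) V t \<le> h"
    proof (intro eventually_ball_finite K ballI)
      fix V assume V: "V \<in> K"
      show "\<forall>\<^sub>F t in at_top. q (\<lambda>j. y j + d) V t \<le> h"
        using up[OF V zero_less_one] eventually_gt_at_top[of 0]
          eventually_ge_at_top[of "(measure \<nu> (exceedance I \<pi> y V) + 1) / h"]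
      proof eventually_elim
        case (elim t)
        have "measure \<nu> (exceedance I \<pi> y V) + 1 \<le> t * h" using elim(3) h(1) by (simp add: field_simps)
        then have "t * q (\<lambda>j. y j + d) V t \<le> t * h" using elim(1) by linarith
        then show ?case using elim(2) by simp
      qed
    qed
    ultimately show ?thesis using eventually_gt_at_top[of 0]
    proof eventually_elim
      case (elim t)
      let ?q = "\<lambda>k. q (\<lambda>j. y j + d) {j\<in>J. k \<le> nat \<lfloor>t * u j\<rfloor>} t"
      have small: "?q k \<le> h" for k
        using elim(2) h(1) q_empty by (cases "{j\<in>J. k \<le> nat \<lfloor>t * u j\<rfloor>} = {}") (auto simp: K_def)
      have "(\<Sum>k\<in>{1..n t}. ?q k) \<le> L + h"
        using elim(1) unfolding group[OF elim(3)] by (simp add: L_def \<Lambda>_def K_def)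
      then have "(1 + 2 * h) * (\<Sum>k\<in>{1..n t}. ?q k) \<le> (1 + 2 * h) * (L + h)"
        using h(1) by (intro mult_left_mono) auto
      then have "exp (- ((1 + 2 * h) * (L + h))) \<le> exp (- ((1 + 2 * h) * (\<Sum>k\<in>{1..n t}. ?q k)))" by simp
      also have "\<dots> \<le> (\<Prod>k\<in>{1..n t}. 1 - ?q k)"
        using small q01 h(2) by (intro exp_le_prod_one_minus) auto
      finally show ?case using h(3) by (simp add: P_def q_def L_def)
    qed
  qed
qed

text \<open>The extreme process stays below its levels iff no Poisson point lies in the union over the
  active sets \<open>V\<close> of the rectangles (times with active set \<open>V\<close>) \<open>\<times>\<close> (exceedance set of \<open>V\<close>).  The
  rectangles are disjoint because the times are.\<close>

lemma poisson_extreme_process_cdf: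
  assumes ppp: "poisson_point_process N (restrict_space lborel {0..} \<Otimes>\<^sub>M \<nu>) Z"
    and J: "finite J" "\<pi> ` J \<subseteq> I" and y: "\<And>j. j \<in> J \<Longrightarrow> 0 < y j"
  shows "measure N {\<omega> \<in> space N. \<forall>j\<in>J. extreme_process Z (u j) (\<pi> j) \<omega> \<le> ennreal (y j)} = exp (- \<Lambda> u \<pi> J y)"
proof -
  let ?T = "restrict_space lborel {0..} :: real measure"
  let ?\<mu> = "?T \<Otimes>\<^sub>M \<nu>"
  interpret \<nu>: sigma_finite_measure \<nu> by (rule sigma_finite_\<nu>)
  define S where "S V = {s. 0 \<le> s \<and> {j\<in>J. s \<le> u j} = V}" for V
  define K where "K = Pow J - {{}}"
  define B where "B = (\<Union>V\<in>K. S V \<times> exceedance I \<pi> y V)"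
  have K: "finite K" using J(1) by (simp add: K_def)
  have KD: "finite V" "V \<subseteq> J" "V \<noteq> {}" "\<pi> ` V \<subseteq> I" if "V \<in> K" for V
    using that J(2) finite_subset[OF _ J(1), of V] by (auto simp: K_def)
  have space_T: "space ?T = {0..}" by (simp add: space_restrict_space)
  have S_sets: "S V \<in> sets ?T" and S_meas: "emeasure ?T (S V) = ennreal (window u J V)" if "V \<in> K" for V
  proof -
    have sub: "S V \<subseteq> {0..}" by (auto simp: S_def)
    show "S V \<in> sets ?T"
      using emeasure_window(1)[OF J(1) KD(2,3)[OF that]] sub by (auto simp: sets_restrict_space_iff S_def)
    show "emeasure ?T (S V) = ennreal (window u J V)"
      using emeasure_window(2)[OF J(1) KD(2,3)[OF that], of u] sub
      by (simp add: emeasure_restrict_space S_def)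
  qed
  have E_sets: "exceedance I \<pi> y V \<in> sets \<nu>"
    and E_meas: "emeasure \<nu> (exceedance I \<pi> y V) = ennreal (measure \<nu> (exceedance I \<pi> y V))" if "V \<in> K" for V
  proof -
    show "exceedance I \<pi> y V \<in> sets \<nu>" using KD[OF that] by simp
    have "emeasure \<nu> (exceedance I \<pi> y V) < \<infinity>"
      using KD[OF that] y by (intro exceedance_finite) auto
    then show "emeasure \<nu> (exceedance I \<pi> y V) = ennreal (measure \<nu> (exceedance I \<pi> y V))"
      by (intro emeasure_eq_ennreal_measure) auto
  qed
  have B_sets: "B \<in> sets ?\<mu>"
    unfolding B_def using K S_sets E_sets by (intro sets.finite_UN pair_measureI) auto
  have "emeasure ?\<mu> B = (\<Sum>V\<in>K. emeasure ?\<mu> (S V \<times> exceedance I \<pi> y V))"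
    unfolding B_def
  proof (rule sum_emeasure[symmetric])
    show "(\<lambda>V. S V \<times> exceedance I \<pi> y V) ` K \<subseteq> sets ?\<mu>" using S_sets E_sets by auto
    show "disjoint_family_on (\<lambda>V. S V \<times> exceedance I \<pi> y V) K"
      by (auto simp: disjoint_family_on_def S_def)
  qed (rule K)
  also have "\<dots> = (\<Sum>V\<in>K. ennreal (window u J V * measure \<nu> (exceedance I \<pi> y V)))"
    using S_sets E_sets S_meas E_meas
    by (intro sum.cong refl) (simp add: \<nu>.emeasure_pair_measure_Times ennreal_mult' window_nonneg)
  also have "\<dots> = ennreal (\<Lambda> u \<pi> J y)"
    unfolding \<Lambda>_def K_def by (intro sum_ennreal) (simp add: window_nonneg)
  finally have B_meas: "emeasure ?\<mu> B = ennreal (\<Lambda> u \<pi> J y)" .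
  have "measure N {\<omega> \<in> space N. num_points Z B \<omega> = of_nat 0} = exp (- measure ?\<mu> B)"
  proof -
    have "\<forall>n::nat. measure N {\<omega> \<in> space N. num_points Z B \<omega> = of_nat n}
        = measure ?\<mu> B ^ n / fact n * exp (- measure ?\<mu> B)"
      using ppp B_sets B_meas unfolding poisson_point_process_def by simp
    from this[rule_format, of 0] show ?thesis by simp
  qed
  moreover have "measure ?\<mu> B = \<Lambda> u \<pi> J y" using B_meas by (simp add: measure_def \<Lambda>_nonneg)
  moreover have "{\<omega> \<in> space N. num_points Z B \<omega> = of_nat 0}
      = {\<omega> \<in> space N. \<forall>j\<in>J. extreme_process Z (u j) (\<pi> j) \<omega> \<le> ennreal (y j)}"
  proof -
    have "num_points Z B \<omega> = 0 \<longleftrightarrow> (\<forall>j\<in>J. extreme_process Z (u j) (\<pi> j) \<omega> \<le> ennreal (y j))"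
      if \<omega>: "\<omega> \<in> space N" for \<omega>
    proof -
      have Z_space: "0 \<le> fst (Z k \<omega>)" "snd (Z k \<omega>) \<in> orthant I" for k
      proof -
        have "Z k \<in> N \<rightarrow>\<^sub>M ?\<mu>" using ppp by (simp add: poisson_point_process_def)
        then have "Z k \<omega> \<in> space ?\<mu>" using \<omega> by (rule measurable_space)
        then show "0 \<le> fst (Z k \<omega>)" "snd (Z k \<omega>) \<in> orthant I"
          by (auto simp: space_pair_measure space_T space_\<nu>)
      qed
      have in_B: "Z k \<omega> \<in> B \<longleftrightarrow> (\<exists>j\<in>J. fst (Z k \<omega>) \<le> u j \<and> ennreal (y j) < snd (Z k \<omega>) (\<pi> j))" for k
      proof
        assume "Z k \<omega> \<in> B"
        then obtain V where V: "V \<in> K" "fst (Z k \<omega>) \<in> S V" "snd (Z k \<omega>) \<in> exceedance I \<pi> y V"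
          unfolding B_def by (auto simp: mem_Times_iff)
        then show "\<exists>j\<in>J. fst (Z k \<omega>) \<le> u j \<and> ennreal (y j) < snd (Z k \<omega>) (\<pi> j)"
          unfolding S_def exceedance_def by blast
      next
        assume "\<exists>j\<in>J. fst (Z k \<omega>) \<le> u j \<and> ennreal (y j) < snd (Z k \<omega>) (\<pi> j)"
        then obtain j where j: "j \<in> J" "fst (Z k \<omega>) \<le> u j" "ennreal (y j) < snd (Z k \<omega>) (\<pi> j)" by blast
        define V where "V = {j\<in>J. fst (Z k \<omega>) \<le> u j}"
        have "V \<in> K" using j by (auto simp: V_def K_def)
        moreover have "fst (Z k \<omega>) \<in> S V" using Z_space by (simp add: S_def V_def)
        moreover have "snd (Z k \<omega>) \<in> exceedance I \<pi> y V"
          using Z_space j by (auto simp: exceedance_def V_def)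
        ultimately show "Z k \<omega> \<in> B" unfolding B_def by (auto simp: mem_Times_iff)
      qed
      have "num_points Z B \<omega> = 0 \<longleftrightarrow> (\<forall>k. Z k \<omega> \<notin> B)"
        by (auto simp: num_points_def emeasure_count_space_eq_0)
      also have "\<dots> \<longleftrightarrow> (\<forall>j\<in>J. extreme_process Z (u j) (\<pi> j) \<omega> \<le> ennreal (y j))"
        unfolding in_B extreme_process_def SUP_le_iff by (auto simp: not_less)
      finally show ?thesis .
    qed
    then show ?thesis by auto
  qed
  ultimately show ?thesis by simp
qed

end

section \<open>Finiteness of the extreme process\<close>

lemma extreme_process_measurable:
  assumes Z: "\<And>k. Z k \<in> N \<rightarrow>\<^sub>M restrict_space lborel {0..} \<Otimes>\<^sub>M \<nu>"
    and \<nu>: "sets \<nu> = sets (orthant_borel I)" and p: "p \<in> I"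
  shows "extreme_process Z u p \<in> borel_measurable N"
proof -
  have time: "(\<lambda>\<omega>. fst (Z k \<omega>)) \<in> borel_measurable N" for k
  proof -
    have "(\<lambda>\<omega>. fst (Z k \<omega>)) \<in> N \<rightarrow>\<^sub>M restrict_space lborel {0..}"
      using Z by (rule measurable_compose[OF _ measurable_fst])
    then show ?thesis using measurable_compose[OF _ measurable_restrict_space1[OF measurable_ident], of _ N lborel] by simp
  qed
  have mark: "(\<lambda>\<omega>. snd (Z k \<omega>) p) \<in> borel_measurable N" for k
  proof -
    have "(\<lambda>\<omega>. snd (Z k \<omega>)) \<in> N \<rightarrow>\<^sub>M orthant_borel I"
      using measurable_compose[OF Z measurable_snd] by (simp add: measurable_cong_sets[OF refl \<nu>])
    then show ?thesis by (rule measurable_compose[OF _ component_measurable_orthant[OF p]])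
  qed
  have "extreme_process Z u p = (\<lambda>\<omega>. SUP k. if fst (Z k \<omega>) \<le> u then snd (Z k \<omega>) p else 0)"
  proof
    fix \<omega>
    show "extreme_process Z u p \<omega> = (SUP k. if fst (Z k \<omega>) \<le> u then snd (Z k \<omega>) p else 0)"
      unfolding extreme_process_def
    proof (rule antisym)
      show "(SUP k\<in>{k. fst (Z k \<omega>) \<le> u}. snd (Z k \<omega>) p) \<le> (SUP k. if fst (Z k \<omega>) \<le> u then snd (Z k \<omega>) p else 0)"
        by (rule SUP_mono) auto
      show "(SUP k. if fst (Z k \<omega>) \<le> u then snd (Z k \<omega>) p else 0) \<le> (SUP k\<in>{k. fst (Z k \<omega>) \<le> u}. snd (Z k \<omega>) p)"
        by (rule SUP_least) (auto intro: SUP_upper)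
    qed
  qed
  moreover have "(\<lambda>\<omega>. SUP k. if fst (Z k \<omega>) \<le> u then snd (Z k \<omega>) p else 0) \<in> borel_measurable N"
  proof (rule borel_measurable_SUP)
    fix k
    note [measurable] = time[of k] mark[of k]
    show "(\<lambda>\<omega>. if fst (Z k \<omega>) \<le> u then snd (Z k \<omega>) p else 0) \<in> borel_measurable N" by measurable
  qed simp
  ultimately show ?thesis by simp
qed

text \<open>The probability of staying below \<open>L\<close> is \<open>exp (- w * \<nu> {x. x p > L})\<close> with a constant \<open>w\<close>, and the
  tail of \<open>\<nu>\<close> vanishes as \<open>L\<close> grows.\<close>

lemma (in heavy_tail) extreme_process_finite:
  assumes ppp: "poisson_point_process N (restrict_space lborel {0..} \<Otimes>\<^sub>M \<nu>) Z" and p: "p \<in> I"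
  shows "AE \<omega> in N. extreme_process Z u p \<omega> < \<infinity>"
proof -
  interpret N: prob_space N using ppp by (simp add: poisson_point_process_def)
  have [measurable]: "extreme_process Z u p \<in> borel_measurable N"
    using ppp p sets_\<nu> by (intro extreme_process_measurable[of Z N \<nu>]) (auto simp: poisson_point_process_def)
  let ?A = "{\<omega> \<in> space N. extreme_process Z u p \<omega> < \<infinity>}"
  define w where "w = window (\<lambda>_. u) {()} {()}"
  have w: "0 \<le> w" by (simp add: w_def window_nonneg)
  have "1 \<le> N.prob ?A + h" if h: "0 < h" for h
  proof -
    obtain L where L: "0 < L" "measure \<nu> (G L) < h / (w + 1)"
      using limit_tail_tendsto_0[of "h / (w + 1)"] h w by auto
    have "\<Lambda> (\<lambda>_. u) (\<lambda>_. p) {()} (\<lambda>_. L) = w * measure \<nu> (exceedance I (\<lambda>_. p) (\<lambda>_. L) {()})"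
    proof -
      have "Pow {()} - {{}} = {{()}}" by auto
      then show ?thesis by (simp add: \<Lambda>_def w_def)
    qed
    also have "\<dots> \<le> w * measure \<nu> (G L)"
    proof (intro mult_left_mono w measure_mono_fmeasurable)
      show "exceedance I (\<lambda>_. p) (\<lambda>_. L) {()} \<subseteq> G L" using p by (auto simp: exceedance_def)
      show "G L \<in> fmeasurable \<nu>"
        using finite_I exceedance_finite[of I id "\<lambda>_. L"] L(1) by (auto simp: fmeasurable_def)
    qed (use p in auto)
    also have "\<dots> \<le> w * (h / (w + 1))" using L(2) w by (intro mult_left_mono) auto
    also have "\<dots> \<le> h" using w h by (simp add: field_simps)
    finally have "1 - h \<le> exp (- \<Lambda> (\<lambda>_. u) (\<lambda>_. p) {()} (\<lambda>_. L))"
      using exp_ge_add_one_self[of "- \<Lambda> (\<lambda>_. u) (\<lambda>_. p) {()} (\<lambda>_. L)"] by linarith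
    also have "\<dots> = N.prob {\<omega> \<in> space N. \<forall>j\<in>{()}. extreme_process Z u p \<omega> \<le> ennreal L}"
      using p L(1) by (intro poisson_extreme_process_cdf[OF ppp, symmetric]) auto
    also have "\<dots> \<le> N.prob ?A"
      by (rule N.finite_measure_mono) (auto intro: le_less_trans)
    finally show ?thesis by simp
  qed
  then have "1 \<le> N.prob ?A" by (rule field_le_epsilon)
  then have "N.prob ?A = 1" using N.prob_le_1[of ?A] by linarith
  then show ?thesis using N.AE_prob_1[of ?A] by auto
qed

section \<open>Sums and maxima of prime exponents\<close>

lemma (in prob_space) prob_iid_all_in:
  assumes indep: "indep_vars (\<lambda>_. S) X {1..}"
    and law: "\<And>k. 1 \<le> k \<Longrightarrow> distr M S (X k) = distr M S Y" and Y: "Y \<in> M \<rightarrow>\<^sub>M S"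
    and A: "\<And>k. k \<in> {1..n} \<Longrightarrow> A k \<in> sets S"
  shows "prob {\<omega> \<in> space M. \<forall>k\<in>{1..n::nat}. X k \<omega> \<in> A k} = (\<Prod>k\<in>{1..n}. prob {\<omega> \<in> space M. Y \<omega> \<in> A k})"
proof (cases "n = 0")
  case True
  then show ?thesis by (simp add: prob_space)
next
  case False
  have X: "X k \<in> M \<rightarrow>\<^sub>M S" if "1 \<le> k" for k
    using indep that by (auto simp: indep_vars_def2)
  have "{\<omega> \<in> space M. \<forall>k\<in>{1..n}. X k \<omega> \<in> A k} = (\<Inter>k\<in>{1..n}. X k -` A k \<inter> space M)"
    using False by auto
  then have "prob {\<omega> \<in> space M. \<forall>k\<in>{1..n}. X k \<omega> \<in> A k} = (\<Prod>k\<in>{1..n}. prob (X k -` A k \<inter> space M))"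
    using indep_varsD[OF indep, of "{1..n}" A] A False by auto
  also have "\<dots> = (\<Prod>k\<in>{1..n}. prob {\<omega> \<in> space M. Y \<omega> \<in> A k})"
  proof (rule prod.cong[OF refl])
    fix k assume k: "k \<in> {1..n}"
    have "prob (X k -` A k \<inter> space M) = measure (distr M S (X k)) (A k)"
      using X[of k] A[OF k] k by (simp add: measure_distr)
    also have "\<dots> = prob (Y -` A k \<inter> space M)"
      using law[of k] A[OF k] Y k by (simp add: measure_distr)
    also have "Y -` A k \<inter> space M = {\<omega> \<in> space M. Y \<omega> \<in> A k}" by auto
    finally show "prob (X k -` A k \<inter> space M) = prob {\<omega> \<in> space M. Y \<omega> \<in> A k}" .
  qed
  finally show ?thesis .
qed

lemma (in prob_space) normalised_sum_negligible:
  fixes g :: "nat \<Rightarrow> 'a \<Rightarrow> real"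
  assumes g: "\<And>k. 1 \<le> k \<Longrightarrow> integrable M (g k)" "\<And>k. 1 \<le> k \<Longrightarrow> expectation (g k) = m"
    and g0: "\<And>k \<omega>. 0 \<le> g k \<omega>"
    and a: "filterlim (\<lambda>t. a t / t) at_top at_top" "\<And>t. 0 < t \<Longrightarrow> 0 < a t"
    and u: "0 \<le> u" and d: "0 < d"
  shows "((\<lambda>t. prob {\<omega> \<in> space M. a t * d < (\<Sum>k\<in>{1..nat \<lfloor>t * u\<rfloor>}. g k \<omega>)}) \<longlongrightarrow> 0) at_top"
proof (rule tendsto_sandwich)
  show "((\<lambda>t. 0) \<longlongrightarrow> (0::real)) at_top" by simp
  show "\<forall>\<^sub>F t in at_top. 0 \<le> prob {\<omega> \<in> space M. a t * d < (\<Sum>k\<in>{1..nat \<lfloor>t * u\<rfloor>}. g k \<omega>)}" by simp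
  have "0 \<le> expectation (g 1)" by (rule Bochner_Integration.integral_nonneg) (rule g0)
  then have m: "0 \<le> m" using g(2)[of 1] by simp
  show "((\<lambda>t. (u * m / d) / (a t / t)) \<longlongrightarrow> 0) at_top"
    by (intro tendsto_divide_0[OF tendsto_const] filterlim_at_top_imp_at_infinity a(1))
  show "\<forall>\<^sub>F t in at_top. prob {\<omega> \<in> space M. a t * d < (\<Sum>k\<in>{1..nat \<lfloor>t * u\<rfloor>}. g k \<omega>)} \<le> (u * m / d) / (a t / t)"
    using eventually_gt_at_top[of 0]
  proof eventually_elim
    case (elim t)
    let ?S = "\<lambda>\<omega>. \<Sum>k\<in>{1..nat \<lfloor>t * u\<rfloor>}. g k \<omega>"
    have int: "integrable M ?S" using g(1) by (intro Bochner_Integration.integrable_sum) auto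
    have ad: "0 < a t * d" using a(2)[OF elim] d by simp
    have "prob {\<omega> \<in> space M. a t * d < ?S \<omega>} \<le> prob {\<omega> \<in> space M. a t * d \<le> ?S \<omega>}"
      using int by (intro finite_measure_mono) auto
    also have "\<dots> \<le> expectation ?S / (a t * d)"
      using ad g0 by (intro integral_Markov_inequality_measure[OF int, of "{}"]) (auto intro: sum_nonneg)
    also have "expectation ?S = real (nat \<lfloor>t * u\<rfloor>) * m"
      using g by (simp add: Bochner_Integration.integral_sum)
    also have "\<dots> / (a t * d) \<le> (t * u) * m / (a t * d)"
    proof -
      have "0 \<le> t * u" using elim u by simp
      then have "real (nat \<lfloor>t * u\<rfloor>) \<le> t * u" by linarith
      then show ?thesis using m ad by (intro divide_right_mono mult_right_mono) auto
    qed
    also have "\<dots> = (u * m / d) / (a t / t)" using elim by (simp add: field_simps)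
    finally show ?case .
  qed
qed

text \<open>Positivity of the factors matters here: the multiplicity of a prime in 0 is 0, which would
  break additivity.\<close>

lemma multiplicity_Theta:
  assumes p: "prime p" and X: "\<And>j. j \<in> {1..<k} \<Longrightarrow> 1 \<le> X j \<omega>" and Y: "1 \<le> Y k \<omega>"
  shows "T X Y k p \<omega> = (\<Sum>j\<in>{1..<k}. multiplicity p (X j \<omega>)) + multiplicity p (Y k \<omega>)"
proof -
  have nz: "X j \<omega> \<noteq> 0" if "j \<in> {1..<k}" for j using X[OF that] by simp
  have p': "prime_elem p" using p by (rule prime_imp_prime_elem)
  have "(\<Prod>j\<in>{1..<k}. X j \<omega>) \<noteq> 0" using nz by (subst prod_zero_iff) blast+
  moreover have "Y k \<omega> \<noteq> 0" using Y by simp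
  ultimately have "T X Y k p \<omega> = multiplicity p (\<Prod>j\<in>{1..<k}. X j \<omega>) + multiplicity p (Y k \<omega>)"
    unfolding T_def Theta_def by (rule prime_elem_multiplicity_mult_distrib[OF p'])
  also have "multiplicity p (\<Prod>j\<in>{1..<k}. X j \<omega>) = (\<Sum>j\<in>{1..<k}. multiplicity p (X j \<omega>))"
  proof (rule prime_elem_multiplicity_prod_distrib[OF p'])
    show "0 \<notin> (\<lambda>j. X j \<omega>) ` {1..<k}"
    proof
      assume "0 \<in> (\<lambda>j. X j \<omega>) ` {1..<k}"
      then obtain j where "j \<in> {1..<k}" "0 = X j \<omega>" by (rule imageE)
      then show False using nz[of j] by simp
    qed
  qed simp
  finally show ?thesis .
qed

lemma max_T_le_iff: "real (max_T X Y n p \<omega>) \<le> z \<longleftrightarrow> 0 \<le> z \<and> (\<forall>k\<in>{1..n}. real (T X Y k p \<omega>) \<le> z)"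
proof -
  let ?A = "insert 0 ((\<lambda>k. T X Y k p \<omega>) ` {1..n})"
  have "Max ?A \<in> ?A" by (intro Max_in) auto
  moreover have "x \<le> Max ?A" if "x \<in> ?A" for x using that by (intro Max_ge) auto
  ultimately have "real (Max ?A) \<le> z \<longleftrightarrow> (\<forall>x\<in>?A. real x \<le> z)"
    by (meson of_nat_mono order_trans)
  then show ?thesis by (simp add: max_T_def)
qed

locale positive_pairs = prob_space M for M :: "'a measure" +
  fixes \<xi>s \<eta>s :: "nat \<Rightarrow> 'a \<Rightarrow> nat"
  assumes pairs: "\<And>k. 1 \<le> k \<Longrightarrow> (\<lambda>\<omega>. (\<xi>s k \<omega>, \<eta>s k \<omega>)) \<in> M \<rightarrow>\<^sub>M Nplus2"
begin

lemma positive: "1 \<le> \<xi>s k \<omega>" "1 \<le> \<eta>s k \<omega>" if "1 \<le> k" "\<omega> \<in> space M"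
  using measurable_space[OF pairs[OF that(1)] that(2)] by (auto simp: Nplus2_def)

lemma pair_function_measurable:
  fixes h :: "nat \<Rightarrow> nat \<Rightarrow> real"
  assumes "1 \<le> k"
  shows "(\<lambda>\<omega>. h (\<xi>s k \<omega>) (\<eta>s k \<omega>)) \<in> borel_measurable M"
  using measurable_compose[OF pairs[OF assms], of "\<lambda>z. h (fst z) (snd z)" borel] by (simp add: Nplus2_def)

lemma factor_measurable:
  assumes "1 \<le> k"
  shows "(\<lambda>\<omega>. real (multiplicity p (\<xi>s k \<omega>))) \<in> borel_measurable M"
  using pair_function_measurable[OF assms, of "\<lambda>x y. real (multiplicity p x)"] .

lemma perturbation_measurable:
  assumes "1 \<le> k"
  shows "(\<lambda>\<omega>. real (multiplicity p (\<eta>s k \<omega>))) \<in> borel_measurable M"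
  using pair_function_measurable[OF assms, of "\<lambda>x y. real (multiplicity p y)"] .

lemma T_decomposition:
  assumes "prime p" "1 \<le> k" "\<omega> \<in> space M"
  shows "real (T \<xi>s \<eta>s k p \<omega>) = (\<Sum>j\<in>{1..<k}. real (multiplicity p (\<xi>s j \<omega>))) + real (multiplicity p (\<eta>s k \<omega>))"
proof -
  have "T \<xi>s \<eta>s k p \<omega> = (\<Sum>j\<in>{1..<k}. multiplicity p (\<xi>s j \<omega>)) + multiplicity p (\<eta>s k \<omega>)"
    using assms positive by (intro multiplicity_Theta) auto
  then show ?thesis by simp
qed

lemma max_T_measurable:
  assumes p: "prime p"
  shows "(\<lambda>\<omega>. real (max_T \<xi>s \<eta>s n p \<omega>)) \<in> borel_measurable M"
proof (rule borel_measurableI_le)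
  fix z :: real
  have T: "(\<lambda>\<omega>. real (T \<xi>s \<eta>s k p \<omega>)) \<in> borel_measurable M" if k: "1 \<le> k" for k
  proof -
    have "(\<lambda>\<omega>. real (T \<xi>s \<eta>s k p \<omega>)) \<in> borel_measurable M \<longleftrightarrow>
        (\<lambda>\<omega>. (\<Sum>j\<in>{1..<k}. real (multiplicity p (\<xi>s j \<omega>))) + real (multiplicity p (\<eta>s k \<omega>))) \<in> borel_measurable M"
      by (rule measurable_cong) (rule T_decomposition[OF p k])
    moreover have "(\<lambda>\<omega>. \<Sum>j\<in>{1..<k}. real (multiplicity p (\<xi>s j \<omega>))) \<in> borel_measurable M"
      by (rule borel_measurable_sum) (simp add: factor_measurable)
    ultimately show ?thesis
      using perturbation_measurable[OF k, of p] by (simp add: borel_measurable_add)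
  qed
  have "{\<omega> \<in> space M. \<forall>k\<in>{1..n}. real (T \<xi>s \<eta>s k p \<omega>) \<le> z} \<in> events"
  proof (intro sets.sets_Collect_finite_All)
    fix k assume "k \<in> {1..n}"
    then have [measurable]: "(\<lambda>\<omega>. real (T \<xi>s \<eta>s k p \<omega>)) \<in> borel_measurable M" using T by auto
    show "{\<omega> \<in> space M. real (T \<xi>s \<eta>s k p \<omega>) \<le> z} \<in> events" by measurable
  qed simp
  then show "{\<omega> \<in> space M. real (max_T \<xi>s \<eta>s n p \<omega>) \<le> z} \<in> events"
    unfolding max_T_le_iff by (cases "0 \<le> z") auto
qed

lemma perturbation_le_max_T:
  assumes "prime p" "\<omega> \<in> space M" "real (max_T \<xi>s \<eta>s n p \<omega>) \<le> z" "k \<in> {1..n}"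
  shows "real (multiplicity p (\<eta>s k \<omega>)) \<le> z"
proof -
  have "real (T \<xi>s \<eta>s k p \<omega>) \<le> z" using assms(3,4) by (simp add: max_T_le_iff)
  moreover have "0 \<le> (\<Sum>j\<in>{1..<k}. real (multiplicity p (\<xi>s j \<omega>)))" by (intro sum_nonneg) auto
  ultimately show ?thesis using T_decomposition[of p k \<omega>] assms by simp
qed

text \<open>Together with \<open>perturbation_le_max_T\<close> this sandwiches the maximum between the maximal
  perturbation and the maximal perturbation plus one sum of factor exponents.\<close>

lemma max_T_le_sum_plus:
  assumes p: "prime p" and \<omega>: "\<omega> \<in> space M" and z: "0 \<le> z" and d: "0 \<le> d"
    and \<eta>: "\<And>k. k \<in> {1..n} \<Longrightarrow> real (multiplicity p (\<eta>s k \<omega>)) \<le> z"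
    and \<xi>: "(\<Sum>k\<in>{1..n}. real (multiplicity p (\<xi>s k \<omega>))) \<le> d"
  shows "real (max_T \<xi>s \<eta>s n p \<omega>) \<le> z + d"
  unfolding max_T_le_iff
proof (intro conjI ballI)
  show "0 \<le> z + d" using z d by simp
  fix k assume k: "k \<in> {1..n}"
  have "(\<Sum>j\<in>{1..<k}. real (multiplicity p (\<xi>s j \<omega>))) \<le> (\<Sum>k\<in>{1..n}. real (multiplicity p (\<xi>s k \<omega>)))"
    using k by (intro sum_mono2) auto
  then show "real (T \<xi>s \<eta>s k p \<omega>) \<le> z + d"
    using T_decomposition[of p k \<omega>] p \<omega> k \<eta>[OF k] \<xi> by simp
qed

lemma max_T_le_total:
  assumes p: "prime p" and \<omega>: "\<omega> \<in> space M"
  shows "real (max_T \<xi>s \<eta>s n p \<omega>)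
    \<le> (\<Sum>k\<in>{1..n}. real (multiplicity p (\<xi>s k \<omega>)) + real (multiplicity p (\<eta>s k \<omega>)))"
proof -
  have "real (multiplicity p (\<eta>s k \<omega>)) \<le> (\<Sum>k\<in>{1..n}. real (multiplicity p (\<eta>s k \<omega>)))"
    if "k \<in> {1..n}" for k
    using that by (intro member_le_sum) auto
  then show ?thesis
    using max_T_le_sum_plus[OF p \<omega> _ _ _ order_refl, of "\<Sum>k\<in>{1..n}. real (multiplicity p (\<eta>s k \<omega>))" n]
    by (simp add: sum.distrib sum_nonneg add.commute)
qed

end

lemma multiplicity_le_ln:
  assumes "prime p" "1 \<le> n"
  shows "real (multiplicity p n) * ln 2 \<le> ln (real n)"
proof -
  have "(2::nat) ^ multiplicity p n \<le> p ^ multiplicity p n"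
    using prime_ge_2_nat[OF assms(1)] by (intro power_mono) auto
  also have "\<dots> \<le> n" using assms(2) by (intro dvd_imp_le multiplicity_dvd) auto
  finally have "(2::real) ^ multiplicity p n \<le> real n" by (metis of_nat_le_iff of_nat_numeral of_nat_power)
  then have "ln ((2::real) ^ multiplicity p n) \<le> ln (real n)" using assms(2) by (subst ln_le_cancel_iff) auto
  then show ?thesis by (simp add: ln_realpow)
qed

locale iid_pairs = positive_pairs M \<xi>s \<eta>s for M :: "'a measure" and \<xi>s \<eta>s :: "nat \<Rightarrow> 'a \<Rightarrow> nat" +
  fixes \<xi> \<eta> :: "'a \<Rightarrow> nat"
  assumes pair: "(\<lambda>\<omega>. (\<xi> \<omega>, \<eta> \<omega>)) \<in> M \<rightarrow>\<^sub>M Nplus2"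
    and indep: "indep_vars (\<lambda>_. Nplus2) (\<lambda>k \<omega>. (\<xi>s k \<omega>, \<eta>s k \<omega>)) {1..}"
    and law: "\<And>k. 1 \<le> k \<Longrightarrow>
      distr M Nplus2 (\<lambda>\<omega>. (\<xi>s k \<omega>, \<eta>s k \<omega>)) = distr M Nplus2 (\<lambda>\<omega>. (\<xi> \<omega>, \<eta> \<omega>))"
    and log_moment: "integrable M (\<lambda>\<omega>. ln (real (\<xi> \<omega>)))"
begin

lemma same_law:
  fixes h :: "nat \<Rightarrow> nat \<Rightarrow> real"
  assumes k: "1 \<le> k"
  shows "integrable M (\<lambda>\<omega>. h (\<xi>s k \<omega>) (\<eta>s k \<omega>)) \<longleftrightarrow> integrable M (\<lambda>\<omega>. h (\<xi> \<omega>) (\<eta> \<omega>))"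
    and "expectation (\<lambda>\<omega>. h (\<xi>s k \<omega>) (\<eta>s k \<omega>)) = expectation (\<lambda>\<omega>. h (\<xi> \<omega>) (\<eta> \<omega>))"
proof -
  have h: "(\<lambda>z. h (fst z) (snd z)) \<in> borel_measurable Nplus2" by (simp add: Nplus2_def)
  show "integrable M (\<lambda>\<omega>. h (\<xi>s k \<omega>) (\<eta>s k \<omega>)) \<longleftrightarrow> integrable M (\<lambda>\<omega>. h (\<xi> \<omega>) (\<eta> \<omega>))"
    using integrable_distr_eq[OF pairs[OF k] h] integrable_distr_eq[OF pair h] law[OF k] by simp
  show "expectation (\<lambda>\<omega>. h (\<xi>s k \<omega>) (\<eta>s k \<omega>)) = expectation (\<lambda>\<omega>. h (\<xi> \<omega>) (\<eta> \<omega>))"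
    using integral_distr[OF pairs[OF k] h] integral_distr[OF pair h] law[OF k] by simp
qed

lemma copy_function_measurable:
  fixes h :: "nat \<Rightarrow> nat \<Rightarrow> real"
  shows "(\<lambda>\<omega>. h (\<xi> \<omega>) (\<eta> \<omega>)) \<in> borel_measurable M"
  using measurable_compose[OF pair, of "\<lambda>z. h (fst z) (snd z)" borel] by (simp add: Nplus2_def)

lemma integrable_multiplicity_factor:
  assumes p: "prime p"
  shows "integrable M (\<lambda>\<omega>. real (multiplicity p (\<xi> \<omega>)))"
proof (rule Bochner_Integration.integrable_bound)
  show "integrable M (\<lambda>\<omega>. ln (real (\<xi> \<omega>)) / ln 2)" using log_moment by simp
  show "(\<lambda>\<omega>. real (multiplicity p (\<xi> \<omega>))) \<in> borel_measurable M"
    using copy_function_measurable[of "\<lambda>x y. real (multiplicity p x)"] .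
  show "AE \<omega> in M. norm (real (multiplicity p (\<xi> \<omega>))) \<le> norm (ln (real (\<xi> \<omega>)) / ln 2)"
  proof (rule AE_I2)
    fix \<omega> assume "\<omega> \<in> space M"
    then have "1 \<le> \<xi> \<omega>" using measurable_space[OF pair] by (auto simp: Nplus2_def)
    from multiplicity_le_ln[OF p this]
    have "real (multiplicity p (\<xi> \<omega>)) \<le> ln (real (\<xi> \<omega>)) / ln 2" by (simp add: field_simps)
    then show "norm (real (multiplicity p (\<xi> \<omega>))) \<le> norm (ln (real (\<xi> \<omega>)) / ln 2)"
      unfolding real_norm_def abs_of_nat by linarith
  qed
qed

lemma factor_sum_negligible:
  assumes p: "prime p" and a: "filterlim (\<lambda>t. a t / t) at_top at_top" "\<And>t. 0 < t \<Longrightarrow> 0 < a t"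
    and u: "0 \<le> u" and d: "0 < d"
  shows "((\<lambda>t. prob {\<omega> \<in> space M. a t * d < (\<Sum>k\<in>{1..nat \<lfloor>t * u\<rfloor>}. real (multiplicity p (\<xi>s k \<omega>)))}) \<longlongrightarrow> 0) at_top"
  using same_law[of _ "\<lambda>x y. real (multiplicity p x)"] integrable_multiplicity_factor[OF p]
  by (intro normalised_sum_negligible[where m = "expectation (\<lambda>\<omega>. real (multiplicity p (\<xi> \<omega>)))"] a u d) auto

lemma max_T_negligible:
  assumes p: "prime p" and \<eta>_int: "integrable M (\<lambda>\<omega>. real (multiplicity p (\<eta> \<omega>)))"
    and a: "filterlim (\<lambda>t. a t / t) at_top at_top" "\<And>t. 0 < t \<Longrightarrow> 0 < a t"
    and u: "0 \<le> u" and d: "0 < d"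
  shows "((\<lambda>t. prob {\<omega> \<in> space M. a t * d < real (max_T \<xi>s \<eta>s (nat \<lfloor>t * u\<rfloor>) p \<omega>)}) \<longlongrightarrow> 0) at_top"
proof (rule tendsto_sandwich)
  show "((\<lambda>t. 0) \<longlongrightarrow> (0::real)) at_top" by simp
  let ?S = "\<lambda>t \<omega>. \<Sum>k\<in>{1..nat \<lfloor>t * u\<rfloor>}. real (multiplicity p (\<xi>s k \<omega>)) + real (multiplicity p (\<eta>s k \<omega>))"
  have "integrable M (\<lambda>\<omega>. real (multiplicity p (\<xi> \<omega>)) + real (multiplicity p (\<eta> \<omega>)))"
    using integrable_multiplicity_factor[OF p] \<eta>_int by simp
  then show "((\<lambda>t. prob {\<omega> \<in> space M. a t * d < ?S t \<omega>}) \<longlongrightarrow> 0) at_top"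
    using same_law[of _ "\<lambda>x y. real (multiplicity p x) + real (multiplicity p y)"]
    by (intro normalised_sum_negligible[where
          m = "expectation (\<lambda>\<omega>. real (multiplicity p (\<xi> \<omega>)) + real (multiplicity p (\<eta> \<omega>)))"] a u d) auto
  have meas: "?S t \<in> borel_measurable M" for t
    by (rule borel_measurable_sum) (simp add: factor_measurable perturbation_measurable borel_measurable_add)
  show "\<forall>\<^sub>F t in at_top. prob {\<omega> \<in> space M. a t * d < real (max_T \<xi>s \<eta>s (nat \<lfloor>t * u\<rfloor>) p \<omega>)}
      \<le> prob {\<omega> \<in> space M. a t * d < ?S t \<omega>}"
  proof (intro always_eventually allI finite_measure_mono subsetI)
    fix t \<omega> assume "\<omega> \<in> {\<omega> \<in> space M. a t * d < real (max_T \<xi>s \<eta>s (nat \<lfloor>t * u\<rfloor>) p \<omega>)}"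
    then show "\<omega> \<in> {\<omega> \<in> space M. a t * d < ?S t \<omega>}"
      using max_T_le_total[OF p, of \<omega> "nat \<lfloor>t * u\<rfloor>"] by (auto intro: less_le_trans)
  next
    fix t
    note [measurable] = meas[of t]
    show "{\<omega> \<in> space M. a t * d < ?S t \<omega>} \<in> events" by measurable
  qed
  show "\<forall>\<^sub>F t in at_top. 0 \<le> prob {\<omega> \<in> space M. a t * d < real (max_T \<xi>s \<eta>s (nat \<lfloor>t * u\<rfloor>) p \<omega>)}" by simp
qed

text \<open>The \<open>k\<close>-th perturbation has to respect the bounds of those \<open>j\<close> whose range \<open>{1..m j}\<close> contains \<open>k\<close>,
  which makes the event an intersection of independent events, one for each \<open>k\<close>.\<close>

lemma prob_perturbations_le:
  assumes J: "finite J" and n: "\<And>j. j \<in> J \<Longrightarrow> m j \<le> n" and primes: "\<And>j. j \<in> J \<Longrightarrow> prime (\<pi> j)"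
  shows "prob {\<omega> \<in> space M. \<forall>j\<in>J. \<forall>k\<in>{1..m j}. real (multiplicity (\<pi> j) (\<eta>s k \<omega>)) \<le> b j}
    = (\<Prod>k\<in>{1..n}. 1 - prob {\<omega> \<in> space M. \<exists>j\<in>{j\<in>J. k \<le> m j}. b j < real (multiplicity (\<pi> j) (\<eta> \<omega>))})"
proof -
  let ?V = "\<lambda>k. {j\<in>J. k \<le> m j}"
  let ?A = "\<lambda>k. {z \<in> space Nplus2. \<forall>j\<in>?V k. real (multiplicity (\<pi> j) (snd z)) \<le> b j}"
  have "{\<omega> \<in> space M. \<forall>j\<in>J. \<forall>k\<in>{1..m j}. real (multiplicity (\<pi> j) (\<eta>s k \<omega>)) \<le> b j}
      = {\<omega> \<in> space M. \<forall>k\<in>{1..n}. (\<xi>s k \<omega>, \<eta>s k \<omega>) \<in> ?A k}"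
  proof (intro equalityI subsetI)
    fix \<omega> assume \<omega>: "\<omega> \<in> {\<omega> \<in> space M. \<forall>j\<in>J. \<forall>k\<in>{1..m j}. real (multiplicity (\<pi> j) (\<eta>s k \<omega>)) \<le> b j}"
    then show "\<omega> \<in> {\<omega> \<in> space M. \<forall>k\<in>{1..n}. (\<xi>s k \<omega>, \<eta>s k \<omega>) \<in> ?A k}"
      using measurable_space[OF pairs] by auto
  next
    fix \<omega> assume \<omega>: "\<omega> \<in> {\<omega> \<in> space M. \<forall>k\<in>{1..n}. (\<xi>s k \<omega>, \<eta>s k \<omega>) \<in> ?A k}"
    have "real (multiplicity (\<pi> j) (\<eta>s k \<omega>)) \<le> b j" if "j \<in> J" "k \<in> {1..m j}" for j k
    proof -
      have "k \<in> {1..n}" using that n[of j] by auto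
      then have "(\<xi>s k \<omega>, \<eta>s k \<omega>) \<in> ?A k" using \<omega> by blast
      then show ?thesis using that by auto
    qed
    then show "\<omega> \<in> {\<omega> \<in> space M. \<forall>j\<in>J. \<forall>k\<in>{1..m j}. real (multiplicity (\<pi> j) (\<eta>s k \<omega>)) \<le> b j}"
      using \<omega> by blast
  qed
  also have "prob \<dots> = (\<Prod>k\<in>{1..n}. prob {\<omega> \<in> space M. (\<xi> \<omega>, \<eta> \<omega>) \<in> ?A k})"
    by (rule prob_iid_all_in[OF indep law pair]) (auto simp: Nplus2_def)
  also have "\<dots> = (\<Prod>k\<in>{1..n}. 1 - prob {\<omega> \<in> space M. \<exists>j\<in>?V k. b j < real (multiplicity (\<pi> j) (\<eta> \<omega>))})"
  proof (rule prod.cong[OF refl])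
    fix k
    have ev: "{\<omega> \<in> space M. \<exists>j\<in>?V k. b j < real (multiplicity (\<pi> j) (\<eta> \<omega>))} \<in> events"
    proof (intro sets.sets_Collect_finite_Ex)
      fix j
      have [measurable]: "(\<lambda>\<omega>. real (multiplicity (\<pi> j) (\<eta> \<omega>))) \<in> borel_measurable M"
        using copy_function_measurable[of "\<lambda>x y. real (multiplicity (\<pi> j) y)"] .
      show "{\<omega> \<in> space M. b j < real (multiplicity (\<pi> j) (\<eta> \<omega>))} \<in> events" by measurable
    qed (use J in simp)
    have "{\<omega> \<in> space M. (\<xi> \<omega>, \<eta> \<omega>) \<in> ?A k}
        = space M - {\<omega> \<in> space M. \<exists>j\<in>?V k. b j < real (multiplicity (\<pi> j) (\<eta> \<omega>))}"
      using measurable_space[OF pair] by (auto simp: not_less)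
    then show "prob {\<omega> \<in> space M. (\<xi> \<omega>, \<eta> \<omega>) \<in> ?A k}
        = 1 - prob {\<omega> \<in> space M. \<exists>j\<in>?V k. b j < real (multiplicity (\<pi> j) (\<eta> \<omega>))}"
      using prob_compl[OF ev] by simp
  qed
  finally show ?thesis .
qed

end

section \<open>Convergence of the maxima\<close>

locale heavy_perturbations =
  iid_pairs M \<xi>s \<eta>s \<xi> \<eta> + heavy_tail M P0 "\<lambda>p \<omega>. real (multiplicity p (\<eta> \<omega>))" a \<nu> nrm c \<alpha>
  for M :: "'a measure" and \<xi>s \<eta>s \<xi> \<eta> P0 a \<nu> nrm c \<alpha> +
  assumes primes: "P0 \<subseteq> {p. prime p}"
begin

text \<open>The upper bound drops the factors \<open>\<xi>\<close> altogether; the lower bound gives half of the shift \<open>d\<close> to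
  their sum, which exceeds \<open>a t * (d / 2)\<close> with vanishing probability, and half to \<open>\<nu>\<close>.\<close>

lemma max_T_cdf_bounds:
  fixes J :: "(real \<times> nat) set"
  assumes J: "finite J" "J \<subseteq> {0..} \<times> P0" and y: "\<And>j. j \<in> J \<Longrightarrow> 0 < y j" and d: "0 < d" and e: "0 < e"
  defines "Q \<equiv> \<lambda>t y. prob {\<omega> \<in> space M. \<forall>j\<in>J. real (max_T \<xi>s \<eta>s (nat \<lfloor>t * fst j\<rfloor>) (snd j) \<omega>) / a t \<le> y j}"
  shows "\<forall>\<^sub>F t in at_top. Q t y \<le> exp (- \<Lambda> fst snd J (\<lambda>j. y j + d)) + e"
    and "\<forall>\<^sub>F t in at_top. exp (- \<Lambda> fst snd J y) - e \<le> Q t (\<lambda>j. y j + d)"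
proof -
  define n where "n t = (\<Sum>j\<in>J. nat \<lfloor>t * fst j\<rfloor>)" for t :: real
  have n: "nat \<lfloor>t * fst j\<rfloor> \<le> n t" if "j \<in> J" for t j
    unfolding n_def using J(1) that by (intro member_le_sum) auto
  have prime_J: "prime (snd j)" and u: "0 \<le> fst j" if "j \<in> J" for j
    using subsetD[OF J(2) that] primes by (auto simp: mem_Times_iff)
  have sndJ: "snd ` J \<subseteq> P0" using J(2) by auto
  define E where "E t y = {\<omega> \<in> space M. \<forall>j\<in>J. \<forall>k\<in>{1..nat \<lfloor>t * fst j\<rfloor>}.
      real (multiplicity (snd j) (\<eta>s k \<omega>)) \<le> a t * y j}" for t and y :: "real \<times> nat \<Rightarrow> real"
  define P where "P t y = (\<Prod>k\<in>{1..n t}. 1 - prob (exceeds t snd y {j\<in>J. k \<le> nat \<lfloor>t * fst j\<rfloor>}))"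
    for t and y :: "real \<times> nat \<Rightarrow> real"
  have prob_E: "prob (E t y) = P t y" for t y
    unfolding E_def P_def exceeds_def by (intro prob_perturbations_le J(1) n prime_J)
  have E_event: "E t y \<in> events" for t y
    unfolding E_def
  proof (intro sets.sets_Collect_finite_All)
    fix j k assume "j \<in> J" "k \<in> {1..nat \<lfloor>t * fst j\<rfloor>}"
    then have [measurable]: "(\<lambda>\<omega>. real (multiplicity (snd j) (\<eta>s k \<omega>))) \<in> borel_measurable M"
      by (simp add: perturbation_measurable)
    show "{\<omega> \<in> space M. real (multiplicity (snd j) (\<eta>s k \<omega>)) \<le> a t * y j} \<in> events" by measurable
  qed (use J in auto)
  have Q_event: "{\<omega> \<in> space M. \<forall>j\<in>J. real (max_T \<xi>s \<eta>s (nat \<lfloor>t * fst j\<rfloor>) (snd j) \<omega>) / a t \<le> y j} \<in> events" for t y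
  proof (intro sets.sets_Collect_finite_All)
    fix j assume "j \<in> J"
    note [measurable] = max_T_measurable[OF prime_J[OF this]]
    show "{\<omega> \<in> space M. real (max_T \<xi>s \<eta>s (nat \<lfloor>t * fst j\<rfloor>) (snd j) \<omega>) / a t \<le> y j} \<in> events" by measurable
  qed (rule J(1))
  show "\<forall>\<^sub>F t in at_top. Q t y \<le> exp (- \<Lambda> fst snd J (\<lambda>j. y j + d)) + e"
  proof -
    have "\<forall>\<^sub>F t in at_top. P t y \<le> exp (- \<Lambda> fst snd J (\<lambda>j. y j + d)) + e"
      unfolding P_def by (rule prod_not_exceeds_bounds(1)[OF J(1) sndJ u n y d e])
    then show ?thesis using eventually_gt_at_top[of 0]
    proof eventually_elim
      case (elim t)
      have "Q t y \<le> prob (E t y)"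
        unfolding Q_def
      proof (rule finite_measure_mono[OF _ E_event], rule subsetI)
        fix \<omega> assume \<omega>: "\<omega> \<in> {\<omega> \<in> space M. \<forall>j\<in>J. real (max_T \<xi>s \<eta>s (nat \<lfloor>t * fst j\<rfloor>) (snd j) \<omega>) / a t \<le> y j}"
        have "real (multiplicity (snd j) (\<eta>s k \<omega>)) \<le> a t * y j"
          if "j \<in> J" "k \<in> {1..nat \<lfloor>t * fst j\<rfloor>}" for j k
        proof (rule perturbation_le_max_T[OF prime_J[OF that(1)] _ _ that(2)])
          have "real (max_T \<xi>s \<eta>s (nat \<lfloor>t * fst j\<rfloor>) (snd j) \<omega>) / a t \<le> y j" using \<omega> that(1) by blast
          then show "real (max_T \<xi>s \<eta>s (nat \<lfloor>t * fst j\<rfloor>) (snd j) \<omega>) \<le> a t * y j"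
            using a_pos[OF elim(2)] by (simp add: pos_divide_le_eq mult.commute)
        qed (use \<omega> in blast)
        then show "\<omega> \<in> E t y" using \<omega> by (simp add: E_def)
      qed
      then show ?case using elim(1) unfolding prob_E by linarith
    qed
  qed
  show "\<forall>\<^sub>F t in at_top. exp (- \<Lambda> fst snd J y) - e \<le> Q t (\<lambda>j. y j + d)"
  proof -
    define D where "D t j = {\<omega> \<in> space M. a t * (d / 2)
        < (\<Sum>k\<in>{1..nat \<lfloor>t * fst j\<rfloor>}. real (multiplicity (snd j) (\<xi>s k \<omega>)))}" for t and j :: "real \<times> nat"
    have D_event: "D t j \<in> events" for t j
    proof -
      have [measurable]: "(\<lambda>\<omega>. \<Sum>k\<in>{1..nat \<lfloor>t * fst j\<rfloor>}. real (multiplicity (snd j) (\<xi>s k \<omega>))) \<in> borel_measurable M"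
        by (rule borel_measurable_sum) (simp add: factor_measurable)
      show ?thesis unfolding D_def by measurable
    qed
    have "((\<lambda>t. \<Sum>j\<in>J. prob (D t j)) \<longlongrightarrow> (\<Sum>j\<in>J. 0)) at_top"
      unfolding D_def
      by (rule tendsto_sum, rule factor_sum_negligible[OF prime_J normalisation_superlinear a_pos u])
        (use d in auto)
    then have "\<forall>\<^sub>F t in at_top. (\<Sum>j\<in>J. prob (D t j)) < e / 2"
      by (rule order_tendstoD(2)) (use e in simp)
    moreover have "\<forall>\<^sub>F t in at_top. exp (- \<Lambda> fst snd J y) - e / 2 \<le> P t (\<lambda>j. y j + d / 2)"
      unfolding P_def using d e by (intro prod_not_exceeds_bounds(2)[OF J(1) sndJ u n y]) auto
    ultimately show ?thesis using eventually_gt_at_top[of 0]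
    proof eventually_elim
      case (elim t)
      let ?Q = "{\<omega> \<in> space M. \<forall>j\<in>J. real (max_T \<xi>s \<eta>s (nat \<lfloor>t * fst j\<rfloor>) (snd j) \<omega>) / a t \<le> y j + d}"
      have "E t (\<lambda>j. y j + d / 2) \<subseteq> ?Q \<union> (\<Union>j\<in>J. D t j)"
      proof
        fix \<omega> assume \<omega>: "\<omega> \<in> E t (\<lambda>j. y j + d / 2)"
        have "real (max_T \<xi>s \<eta>s (nat \<lfloor>t * fst j\<rfloor>) (snd j) \<omega>) / a t \<le> y j + d"
          if j: "j \<in> J" and nD: "\<omega> \<notin> D t j" for j
        proof -
          have \<omega>M: "\<omega> \<in> space M" using \<omega> by (simp add: E_def)
          have "real (max_T \<xi>s \<eta>s (nat \<lfloor>t * fst j\<rfloor>) (snd j) \<omega>) \<le> a t * (y j + d / 2) + a t * (d / 2)"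
            using a_pos[OF elim(3)] y[OF j] d \<omega> nD j \<omega>M
            by (intro max_T_le_sum_plus[OF prime_J[OF j]]) (auto simp: E_def D_def not_less)
          then show ?thesis using a_pos[OF elim(3)] by (simp add: field_simps)
        qed
        then show "\<omega> \<in> ?Q \<union> (\<Union>j\<in>J. D t j)" using \<omega> by (auto simp: E_def)
      qed
      moreover have UN: "(\<Union>j\<in>J. D t j) \<in> events" using J(1) D_event by (rule sets.finite_UN)
      ultimately have "prob (E t (\<lambda>j. y j + d / 2)) \<le> prob (?Q \<union> (\<Union>j\<in>J. D t j))"
        by (intro finite_measure_mono sets.Un Q_event)
      also have "\<dots> \<le> prob ?Q + prob (\<Union>j\<in>J. D t j)"
        using Q_event UN by (rule measure_Un_le)
      also have "prob (\<Union>j\<in>J. D t j) \<le> (\<Sum>j\<in>J. prob (D t j))"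
        using D_event J(1) by (intro measure_UNION_le) auto
      finally show ?case using elim(1,2) unfolding prob_E Q_def by linarith
    qed
  qed
qed

text \<open>The bounds of \<open>max_T_cdf_bounds\<close> require positive levels.  If a level is negative, the side
  that has to be the smaller one vanishes, because all variables are nonnegative; otherwise half of
  the available shift makes all levels positive.\<close>

lemma max_T_converges_to_extreme_process:
  assumes ppp: "poisson_point_process N (restrict_space lborel {0..} \<Otimes>\<^sub>M \<nu>) Z"
    and J: "finite J" "J \<subseteq> {0..} \<times> P0"
  shows "convergence_in_distribution (powertop_real J)
    M (\<lambda>t \<omega>. \<lambda>j\<in>J. real (max_T \<xi>s \<eta>s (nat \<lfloor>t * fst j\<rfloor>) (snd j) \<omega>) / a t)
    N (\<lambda>\<omega>. \<lambda>j\<in>J. enn2real (extreme_process Z (fst j) (snd j) \<omega>)) at_top"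
proof (rule convergence_in_distributionI_sandwich[OF J(1)])
  interpret N: prob_space N using ppp by (simp add: poisson_point_process_def)
  show "prob_space N" by (rule N.prob_space_axioms)
  have prime_J: "prime (snd j)" and P0_J: "snd j \<in> P0" if "j \<in> J" for j
    using subsetD[OF J(2) that] primes by (auto simp: mem_Times_iff)
  show "(\<lambda>\<omega>. real (max_T \<xi>s \<eta>s (nat \<lfloor>t * fst j\<rfloor>) (snd j) \<omega>) / a t) \<in> borel_measurable M" if "j \<in> J" for t j
    using max_T_measurable[OF prime_J[OF that]] by (intro borel_measurable_divide borel_measurable_const)
  have ext: "extreme_process Z (fst j) (snd j) \<in> borel_measurable N" if "j \<in> J" for j
    using ppp P0_J[OF that] sets_\<nu>
    by (intro extreme_process_measurable[of Z N \<nu> P0]) (auto simp: poisson_point_process_def)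
  show Y: "(\<lambda>\<omega>. enn2real (extreme_process Z (fst j) (snd j) \<omega>)) \<in> borel_measurable N" if "j \<in> J" for j
    using ext[OF that] by measurable
  let ?X = "\<lambda>t y. prob {\<omega> \<in> space M. \<forall>j\<in>J. real (max_T \<xi>s \<eta>s (nat \<lfloor>t * fst j\<rfloor>) (snd j) \<omega>) / a t \<le> y j}"
  let ?Y = "\<lambda>y. measure N {\<omega> \<in> space N. \<forall>j\<in>J. enn2real (extreme_process Z (fst j) (snd j) \<omega>) \<le> y j}"
  have Y_event: "{\<omega> \<in> space N. \<forall>j\<in>J. enn2real (extreme_process Z (fst j) (snd j) \<omega>) \<le> y j} \<in> sets N" for y
  proof (intro sets.sets_Collect_finite_All J(1))
    fix j assume "j \<in> J"
    note [measurable] = Y[OF this]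
    show "{\<omega> \<in> space N. enn2real (extreme_process Z (fst j) (snd j) \<omega>) \<le> y j} \<in> sets N" by measurable
  qed
  have X_event: "{\<omega> \<in> space M. \<forall>j\<in>J. real (max_T \<xi>s \<eta>s (nat \<lfloor>t * fst j\<rfloor>) (snd j) \<omega>) / a t \<le> y j} \<in> events" for t y
  proof (intro sets.sets_Collect_finite_All J(1))
    fix j assume "j \<in> J"
    note [measurable] = max_T_measurable[OF prime_J[OF this]]
    show "{\<omega> \<in> space M. real (max_T \<xi>s \<eta>s (nat \<lfloor>t * fst j\<rfloor>) (snd j) \<omega>) / a t \<le> y j} \<in> events" by measurable
  qed
  have Y_cdf: "?Y y = exp (- \<Lambda> fst snd J y)" if y: "\<And>j. j \<in> J \<Longrightarrow> 0 < y j" for y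
  proof -
    have E_event: "{\<omega> \<in> space N. \<forall>j\<in>J. extreme_process Z (fst j) (snd j) \<omega> \<le> ennreal (y j)} \<in> sets N"
    proof (intro sets.sets_Collect_finite_All J(1))
      fix j assume "j \<in> J"
      note [measurable] = ext[OF this]
      show "{\<omega> \<in> space N. extreme_process Z (fst j) (snd j) \<omega> \<le> ennreal (y j)} \<in> sets N" by measurable
    qed
    have "AE \<omega> in N. \<forall>j\<in>J. extreme_process Z (fst j) (snd j) \<omega> < \<infinity>"
      using P0_J by (intro AE_finite_allI J(1) extreme_process_finite[OF ppp])
    then have "?Y y = measure N {\<omega> \<in> space N. \<forall>j\<in>J. extreme_process Z (fst j) (snd j) \<omega> \<le> ennreal (y j)}"
    proof (intro N.finite_measure_eq_AE Y_event E_event, eventually_elim)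
      case (elim \<omega>)
      have "enn2real (extreme_process Z (fst j) (snd j) \<omega>) \<le> y j
          \<longleftrightarrow> extreme_process Z (fst j) (snd j) \<omega> \<le> ennreal (y j)" if "j \<in> J" for j
        using elim that y[OF that] by (cases "extreme_process Z (fst j) (snd j) \<omega>") auto
      then show ?case by auto
    qed
    also have "\<dots> = exp (- \<Lambda> fst snd J y)"
      using J P0_J y by (intro poisson_extreme_process_cdf[OF ppp]) auto
    finally show ?thesis .
  qed
  show "\<forall>\<^sub>F t in at_top. ?X t y \<le> ?Y (\<lambda>j. y j + d) + e" if d: "0 < d" and e: "0 < e" for y d e
  proof (cases "\<exists>j\<in>J. y j < 0")
    case True
    then obtain j where j: "j \<in> J" "y j < 0" by blast
    show ?thesis using eventually_gt_at_top[of 0]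
    proof eventually_elim
      case (elim t)
      have "\<not> real (max_T \<xi>s \<eta>s (nat \<lfloor>t * fst j\<rfloor>) (snd j) \<omega>) / a t \<le> y j" for \<omega>
      proof -
        have "0 \<le> real (max_T \<xi>s \<eta>s (nat \<lfloor>t * fst j\<rfloor>) (snd j) \<omega>) / a t"
          using a_pos[OF elim] by simp
        then show ?thesis using j(2) by linarith
      qed
      then have "{\<omega> \<in> space M. \<forall>j\<in>J. real (max_T \<xi>s \<eta>s (nat \<lfloor>t * fst j\<rfloor>) (snd j) \<omega>) / a t \<le> y j} = {}"
        using j(1) by blast
      then have "?X t y = 0" by (simp only: measure_empty)
      then show ?case using e by (simp add: add_nonneg_nonneg)
    qed
  next
    case False
    have pos: "0 < y j + d / 2" if "j \<in> J" for j using False that d by force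
    have pos': "0 < y j + d" if "j \<in> J" for j using False that d by force
    have "\<forall>\<^sub>F t in at_top. ?X t (\<lambda>j. y j + d / 2) \<le> exp (- \<Lambda> fst snd J (\<lambda>j. y j + d / 2 + d / 2)) + e"
      using d e by (intro max_T_cdf_bounds(1)[OF J pos]) auto
    then show ?thesis
    proof eventually_elim
      case (elim t)
      have "?X t y \<le> ?X t (\<lambda>j. y j + d / 2)"
        by (rule finite_measure_mono[OF _ X_event]) (use d in \<open>fastforce intro: order_trans\<close>)
      then show ?case using elim Y_cdf[OF pos'] by (simp add: add.assoc)
    qed
  qed
  show "\<forall>\<^sub>F t in at_top. ?Y (\<lambda>j. y j - d) - e \<le> ?X t y" if d: "0 < d" and e: "0 < e" for y d e
  proof (cases "\<exists>j\<in>J. y j - d < 0")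
    case True
    then obtain j where j: "j \<in> J" "y j - d < 0" by blast
    have "\<not> enn2real (extreme_process Z (fst j) (snd j) \<omega>) \<le> y j - d" for \<omega>
      using j(2) enn2real_nonneg[of "extreme_process Z (fst j) (snd j) \<omega>"] by linarith
    then have "{\<omega> \<in> space N. \<forall>j\<in>J. enn2real (extreme_process Z (fst j) (snd j) \<omega>) \<le> y j - d} = {}"
      using j(1) by blast
    then have "?Y (\<lambda>j. y j - d) = 0" by (simp only: measure_empty)
    then show ?thesis using e by (simp add: order_trans[OF _ measure_nonneg])
  next
    case False
    have pos: "0 < y j - d + d / 2" if "j \<in> J" for j using False that d by force
    have "\<forall>\<^sub>F t in at_top. exp (- \<Lambda> fst snd J (\<lambda>j. y j - d + d / 2)) - e \<le> ?X t (\<lambda>j. y j - d + d / 2 + d / 2)"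
      using d e by (intro max_T_cdf_bounds(2)[OF J pos]) auto
    then show ?thesis
    proof eventually_elim
      case (elim t)
      have "?Y (\<lambda>j. y j - d) \<le> ?Y (\<lambda>j. y j - d + d / 2)"
        by (rule N.finite_measure_mono[OF _ Y_event]) (use d in \<open>fastforce intro: order_trans\<close>)
      then show ?case using elim Y_cdf[OF pos] by simp
    qed
  qed
qed

lemma max_T_converges_to_zero:
  assumes \<eta>_int: "\<And>p. prime p \<Longrightarrow> p \<notin> P0 \<Longrightarrow> integrable M (\<lambda>\<omega>. real (multiplicity p (\<eta> \<omega>)))"
    and J: "finite J" "J \<subseteq> {0..} \<times> ({p. prime p} - P0)"
  shows "convergence_in_distribution (powertop_real J)
    M (\<lambda>t \<omega>. \<lambda>j\<in>J. real (max_T \<xi>s \<eta>s (nat \<lfloor>t * fst j\<rfloor>) (snd j) \<omega>) / a t) M (\<lambda>\<omega>. \<lambda>j\<in>J. 0) at_top"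
proof (rule convergence_in_distributionI_sandwich[OF J(1) prob_space_axioms])
  have prime_J: "prime (snd j)" and P0_J: "snd j \<notin> P0" and u: "0 \<le> fst j" if "j \<in> J" for j
    using subsetD[OF J(2) that] by (auto simp: mem_Times_iff)
  let ?X = "\<lambda>t j \<omega>. real (max_T \<xi>s \<eta>s (nat \<lfloor>t * fst j\<rfloor>) (snd j) \<omega>)"
  show X: "(\<lambda>\<omega>. ?X t j \<omega> / a t) \<in> borel_measurable M" if "j \<in> J" for t j
    using max_T_measurable[OF prime_J[OF that]] by (intro borel_measurable_divide borel_measurable_const)
  have X_event: "{\<omega> \<in> space M. \<forall>j\<in>J. ?X t j \<omega> / a t \<le> y j} \<in> events" for t y
  proof (intro sets.sets_Collect_finite_All J(1))
    fix j assume "j \<in> J"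
    note [measurable] = X[OF this]
    show "{\<omega> \<in> space M. ?X t j \<omega> / a t \<le> y j} \<in> events" by measurable
  qed
  show "\<forall>\<^sub>F t in at_top. prob {\<omega> \<in> space M. \<forall>j\<in>J. ?X t j \<omega> / a t \<le> y j}
      \<le> prob {\<omega> \<in> space M. \<forall>j\<in>J. 0 \<le> y j + d} + e" if d: "0 < d" and e: "0 < e" for y d e
    using eventually_gt_at_top[of 0]
  proof eventually_elim
    case (elim t)
    have "prob {\<omega> \<in> space M. \<forall>j\<in>J. ?X t j \<omega> / a t \<le> y j} \<le> prob {\<omega> \<in> space M. \<forall>j\<in>J. 0 \<le> y j + d}"
    proof (rule finite_measure_mono, rule subsetI)
      fix \<omega> assume \<omega>: "\<omega> \<in> {\<omega> \<in> space M. \<forall>j\<in>J. ?X t j \<omega> / a t \<le> y j}"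
      have "0 \<le> y j + d" if "j \<in> J" for j
      proof -
        have "0 \<le> ?X t j \<omega> / a t" using a_pos[OF elim] by simp
        also have "\<dots> \<le> y j" using \<omega> that by blast
        finally show ?thesis using d by simp
      qed
      then show "\<omega> \<in> {\<omega> \<in> space M. \<forall>j\<in>J. 0 \<le> y j + d}" using \<omega> by blast
    qed (cases "\<forall>j\<in>J. 0 \<le> y j + d"; simp)
    then show ?case using e by simp
  qed
  show "\<forall>\<^sub>F t in at_top. prob {\<omega> \<in> space M. \<forall>j\<in>J. 0 \<le> y j - d} - e
      \<le> prob {\<omega> \<in> space M. \<forall>j\<in>J. ?X t j \<omega> / a t \<le> y j}" if d: "0 < d" and e: "0 < e" for y d e
  proof (cases "\<forall>j\<in>J. 0 \<le> y j - d")
    case False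
    then have "{\<omega> \<in> space M. \<forall>j\<in>J. 0 \<le> y j - d} = {}" by blast
    then have "prob {\<omega> \<in> space M. \<forall>j\<in>J. 0 \<le> y j - d} = 0" by (simp only: measure_empty)
    then show ?thesis using e by (simp add: order_trans[OF _ measure_nonneg])
  next
    case True
    have "((\<lambda>t. \<Sum>j\<in>J. prob {\<omega> \<in> space M. a t * d < ?X t j \<omega>}) \<longlongrightarrow> (\<Sum>j\<in>J. 0)) at_top"
      by (rule tendsto_sum, rule max_T_negligible[OF prime_J \<eta>_int[OF prime_J P0_J] normalisation_superlinear a_pos u])
        (use d in auto)
    then have "\<forall>\<^sub>F t in at_top. (\<Sum>j\<in>J. prob {\<omega> \<in> space M. a t * d < ?X t j \<omega>}) < e"
      by (rule order_tendstoD(2)) (use e in simp)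
    then show ?thesis using eventually_gt_at_top[of 0]
    proof eventually_elim
      case (elim t)
      have D_event: "{\<omega> \<in> space M. a t * d < ?X t j \<omega>} \<in> events" if "j \<in> J" for j
      proof -
        note [measurable] = max_T_measurable[OF prime_J[OF that]]
        show ?thesis by measurable
      qed
      have "space M \<subseteq> {\<omega> \<in> space M. \<forall>j\<in>J. ?X t j \<omega> / a t \<le> y j} \<union> (\<Union>j\<in>J. {\<omega> \<in> space M. a t * d < ?X t j \<omega>})"
      proof
        fix \<omega> assume \<omega>: "\<omega> \<in> space M"
        have "?X t j \<omega> / a t \<le> y j" if "j \<in> J" "\<not> a t * d < ?X t j \<omega>" for j
        proof -
          have "?X t j \<omega> / a t \<le> d" using that(2) a_pos[OF elim(2)] by (simp add: field_simps)
          then show ?thesis using True that(1) by force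
        qed
        then show "\<omega> \<in> {\<omega> \<in> space M. \<forall>j\<in>J. ?X t j \<omega> / a t \<le> y j} \<union> (\<Union>j\<in>J. {\<omega> \<in> space M. a t * d < ?X t j \<omega>})"
          using \<omega> by blast
      qed
      moreover have UN: "(\<Union>j\<in>J. {\<omega> \<in> space M. a t * d < ?X t j \<omega>}) \<in> events"
        using J(1) D_event by (rule sets.finite_UN)
      ultimately have "prob (space M) \<le> prob ({\<omega> \<in> space M. \<forall>j\<in>J. ?X t j \<omega> / a t \<le> y j} \<union> (\<Union>j\<in>J. {\<omega> \<in> space M. a t * d < ?X t j \<omega>}))"
        by (intro finite_measure_mono sets.Un X_event)
      also have "\<dots> \<le> prob {\<omega> \<in> space M. \<forall>j\<in>J. ?X t j \<omega> / a t \<le> y j} + prob (\<Union>j\<in>J. {\<omega> \<in> space M. a t * d < ?X t j \<omega>})"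
        using X_event UN by (rule measure_Un_le)
      also have "prob (\<Union>j\<in>J. {\<omega> \<in> space M. a t * d < ?X t j \<omega>}) \<le> (\<Sum>j\<in>J. prob {\<omega> \<in> space M. a t * d < ?X t j \<omega>})"
        using D_event J(1) by (intro measure_UNION_le) auto
      finally have "1 - e \<le> prob {\<omega> \<in> space M. \<forall>j\<in>J. ?X t j \<omega> / a t \<le> y j}"
        using elim(1) by (simp add: prob_space)
      then show ?case using prob_le_1[of "{\<omega> \<in> space M. \<forall>j\<in>J. 0 \<le> y j - d}"] by linarith
    qed
  qed
qed simp

end

theorem theorem6:
  fixes M :: "'a measure"
    and \<xi> \<eta> :: "'a \<Rightarrow> nat"
    and \<xi>s \<eta>s :: "nat \<Rightarrow> 'a \<Rightarrow> nat"
    and P0 :: "nat set"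
    and nrm :: "(nat \<Rightarrow> real) \<Rightarrow> real"
    and a :: "real \<Rightarrow> real"
    and \<nu> :: "(nat \<Rightarrow> ennreal) measure"
    and c \<alpha> :: real
    and N :: "'b measure"
    and Z :: "nat \<Rightarrow> 'b \<Rightarrow> real \<times> (nat \<Rightarrow> ennreal)"
  assumes "prob_space M"
    and "(\<lambda>\<omega>. (\<xi> \<omega>, \<eta> \<omega>)) \<in> M \<rightarrow>\<^sub>M Nplus2"
    and "prob_space.indep_vars M (\<lambda>_. Nplus2) (\<lambda>k \<omega>. (\<xi>s k \<omega>, \<eta>s k \<omega>)) {1..}"
    and "\<And>k. k \<ge> 1 \<Longrightarrow>
           distr M Nplus2 (\<lambda>\<omega>. (\<xi>s k \<omega>, \<eta>s k \<omega>)) = distr M Nplus2 (\<lambda>\<omega>. (\<xi> \<omega>, \<eta> \<omega>))"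
    and "integrable M (\<lambda>\<omega>. ln (real (\<xi> \<omega>)))"
    and "finite P0" and "P0 \<subseteq> {p. prime p}"
    and "norm_on P0 nrm"
    and "\<And>t. t > 0 \<Longrightarrow> a t > 0"
    and "sets \<nu> = sets (orthant_borel P0)"
    and "locally_finite_measure (orthant_top P0) \<nu>"
    and "c > 0" and "0 < \<alpha>" and "\<alpha> < 1"
    and "\<And>r. r > 0 \<Longrightarrow>
           emeasure \<nu> {x \<in> space \<nu>. (\<forall>p\<in>P0. x p < \<infinity>) \<and> nrm (\<lambda>p\<in>P0. enn2real (x p)) \<ge> r}
             = ennreal (c * r powr (- \<alpha>))"
    and "vague_convergence (orthant_top P0)
           (\<lambda>t. scale_measure (ennreal t)
                  (restrict_space
                    (distr M (Pi\<^sub>M P0 (\<lambda>_. borel))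
                      (\<lambda>\<omega>. \<lambda>p\<in>P0. ennreal (real (multiplicity p (\<eta> \<omega>)) / a t)))
                    (orthant P0)))
           \<nu> at_top"
    and "\<And>p. prime p \<Longrightarrow> p \<notin> P0 \<Longrightarrow> integrable M (\<lambda>\<omega>. real (multiplicity p (\<eta> \<omega>)))"
    and "poisson_point_process N (restrict_space lborel {0..} \<Otimes>\<^sub>M \<nu>) Z"
  shows "(\<forall>u\<ge>0. \<forall>p\<in>P0. AE \<omega> in N. extreme_process Z u p \<omega> < \<infinity>) \<and>
    fdd_convergence ({0..} \<times> P0)
      M (\<lambda>t (u, p) \<omega>. real (max_T \<xi>s \<eta>s (nat \<lfloor>t * u\<rfloor>) p \<omega>) / a t)
      N (\<lambda>(u, p) \<omega>. enn2real (extreme_process Z u p \<omega>)) at_top \<and>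
    fdd_convergence ({0..} \<times> ({p. prime p} - P0))
      M (\<lambda>t (u, p) \<omega>. real (max_T \<xi>s \<eta>s (nat \<lfloor>t * u\<rfloor>) p \<omega>) / a t)
      M (\<lambda>_ _. 0) at_top"
proof -
  interpret prob_space M by fact
  have pairs: "(\<lambda>\<omega>. (\<xi>s k \<omega>, \<eta>s k \<omega>)) \<in> M \<rightarrow>\<^sub>M Nplus2" if "1 \<le> k" for k
    using assms(3) that by (auto simp: indep_vars_def2)
  have mult: "(\<lambda>\<omega>. real (multiplicity p (\<eta> \<omega>))) \<in> borel_measurable M" for p
    using measurable_compose[OF assms(2), of "\<lambda>z. real (multiplicity p (snd z))" borel]
    by (simp add: Nplus2_def)
  interpret heavy_perturbations M \<xi>s \<eta>s \<xi> \<eta> P0 a \<nu> nrm c \<alpha>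
    by unfold_locales (use assms pairs mult in auto)
  note ppp = assms(18)
  show ?thesis
  proof (intro conjI allI impI ballI)
    show "AE \<omega> in N. extreme_process Z u p \<omega> < \<infinity>" if "p \<in> P0" for u p
      using ppp that by (rule extreme_process_finite)
    show "fdd_convergence ({0..} \<times> P0)
      M (\<lambda>t (u, p) \<omega>. real (max_T \<xi>s \<eta>s (nat \<lfloor>t * u\<rfloor>) p \<omega>) / a t)
      N (\<lambda>(u, p) \<omega>. enn2real (extreme_process Z u p \<omega>)) at_top"
      unfolding fdd_convergence_def case_prod_beta
      using max_T_converges_to_extreme_process[OF ppp] by blast
    show "fdd_convergence ({0..} \<times> ({p. prime p} - P0))
      M (\<lambda>t (u, p) \<omega>. real (max_T \<xi>s \<eta>s (nat \<lfloor>t * u\<rfloor>) p \<omega>) / a t)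
      M (\<lambda>_ _. 0) at_top"
      unfolding fdd_convergence_def case_prod_beta
      using max_T_converges_to_zero[OF assms(17)] by blast
  qed
qed

end
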